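(* Let $m\ge1$ and $D=\sum_{i=0}^n\alpha_iD_i$ a $\mathbb{Q}$-divisor on $\mathbb{P}^m=\operatorname{Proj}k[x_0,\dots,x_m]$ with $D_i=V(f_i)$ distinct prime divisors, $f_i$ irreducible homogeneous of degree $a_i$, $\alpha_i=c_i/k_i\in\mathbb{Q}$ in lowest terms (with $\alpha_i=0$ allowed, written $0/1$), and $\deg D=\sum_i\alpha_ia_i>0$. Suppose $\{f_0,\dots,f_n\}$ contains $m+1$ linearly independent linear forms. Let $\ell_i=\operatorname{lcm}_{j\ne i}(k_j)$. Then $R_D$ is generated as a $k$-algebra in degrees at most $\sum_{i=0}^n\ell_ia_i$, and its relations are generated in degrees at most $\max\Big(2\sum_{i=0}^n\ell_ia_i,\ \frac{\max_{0\le i\le n}a_i}{\deg D}+\sum_{i=0}^n\ell_ia_i\Big).$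
   Context: $k$ is algebraically closed. $R_D=\bigoplus_{d\ge0}u^dH^0(\mathbb{P}^m,\lfloor dD\rfloor)$, graded by $d$ ($u$ formal), where $\lfloor\cdot\rfloor$ floors each coefficient and $H^0(X,E)=\{g\in k(X)^\times:\operatorname{div}(g)+E\ge0\}\cup\{0\}$. "Relations generated in degrees at most $M$" means: for a minimal set of homogeneous algebra generators $g_1,\dots,g_r$ of $R_D$, the kernel of $k[w_1,\dots,w_r]\to R_D$, $w_i\mapsto g_i$ ($\deg w_i=\deg g_i$), is generated by homogeneous elements of degree at most $M$. *)

theory Defs
  imports "HOL-Library.Poly_Mapping" "HOL-Computational_Algebra.Polynomial"
          "HOL-Computational_Algebra.Fraction_Field"
begin

text \<open>The polynomial ring k[x_0,...,x_m] is modelled as finitely supported maps from monomials ('n to nat) to 'k,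
  where 'n is a finite (linearly ordered) type with CARD('n) = m+1.\<close>

definition mdeg :: "('n \<Rightarrow>\<^sub>0 nat) \<Rightarrow> nat" where
  "mdeg \<mu> = (\<Sum>i\<in>Poly_Mapping.keys \<mu>. Poly_Mapping.lookup \<mu> i)"

definition homog_of :: "nat \<Rightarrow> (('n \<Rightarrow>\<^sub>0 nat) \<Rightarrow>\<^sub>0 'k::zero) \<Rightarrow> bool" where
  "homog_of d P \<longleftrightarrow> (\<forall>\<mu>\<in>Poly_Mapping.keys P. mdeg \<mu> = d)"

definition homogeneous :: "(('n \<Rightarrow>\<^sub>0 nat) \<Rightarrow>\<^sub>0 'k::zero) \<Rightarrow> bool" where
  "homogeneous P \<longleftrightarrow> (\<exists>d. homog_of d P)"

definition mconst :: "'k::zero \<Rightarrow> (('n \<Rightarrow>\<^sub>0 nat) \<Rightarrow>\<^sub>0 'k)" where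
  "mconst c = Poly_Mapping.single 0 c"

definition lin_indep_on :: "nat set \<Rightarrow> (nat \<Rightarrow> (('n \<Rightarrow>\<^sub>0 nat) \<Rightarrow>\<^sub>0 'k::field)) \<Rightarrow> bool" where
  "lin_indep_on J f \<longleftrightarrow>
     (\<forall>c. (\<Sum>j\<in>J. mconst (c j) * f j) = 0 \<longrightarrow> (\<forall>j\<in>J. c j = 0))"

text \<open>Multiplicity of p in x (same text as the library's definition, which is only
  available in factorial_semiring).\<close>
definition mult_of :: "'a::comm_semiring_1 \<Rightarrow> 'a \<Rightarrow> nat" where
  "mult_of p x = (if finite {n. p ^ n dvd x} then Max {n. p ^ n dvd x} else 0)"

definition rat_fun :: "(('n::{finite,linorder} \<Rightarrow>\<^sub>0 nat) \<Rightarrow>\<^sub>0 'k::field) fract \<Rightarrow> bool" where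
  "rat_fun g \<longleftrightarrow> (\<exists>P Q d. Q \<noteq> 0 \<and> homog_of d P \<and> homog_of d Q \<and> g = Fract P Q)"

text \<open>Prime divisors of P^m are V(h), h irreducible homogeneous (up to scalars).\<close>
definition prime_div :: "(('n::{finite,linorder} \<Rightarrow>\<^sub>0 nat) \<Rightarrow>\<^sub>0 'k::field) \<Rightarrow> bool" where
  "prime_div h \<longleftrightarrow> irreducible h \<and> homogeneous h"

definition ord :: "(('n::{finite,linorder} \<Rightarrow>\<^sub>0 nat) \<Rightarrow>\<^sub>0 'k::field)
    \<Rightarrow> (('n \<Rightarrow>\<^sub>0 nat) \<Rightarrow>\<^sub>0 'k) fract \<Rightarrow> int" where
  "ord h g = (THE z. \<exists>P Q. P \<noteq> 0 \<and> Q \<noteq> 0 \<and> g = Fract P Q \<and>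
                         z = int (mult_of h P) - int (mult_of h Q))"

text \<open>A divisor E is given by its coefficient E h at the prime divisor V(h).
  H^0(P^m, E) = {g nonzero rational function. div g + E \<ge> 0} \<union> {0}.\<close>
definition H0 :: "((('n::{finite,linorder} \<Rightarrow>\<^sub>0 nat) \<Rightarrow>\<^sub>0 'k::field) \<Rightarrow> int)
    \<Rightarrow> (('n \<Rightarrow>\<^sub>0 nat) \<Rightarrow>\<^sub>0 'k) fract set" where
  "H0 E = {g. g = 0 \<or> (rat_fun g \<and> (\<forall>h. prime_div h \<longrightarrow> ord h g + E h \<ge> 0))}"

text \<open>The Q-divisor D = sum_{i \<le> n} alpha_i V(f_i): coefficient at V(h).\<close>
definition Qdiv :: "nat \<Rightarrow> (nat \<Rightarrow> (('n \<Rightarrow>\<^sub>0 nat) \<Rightarrow>\<^sub>0 'k::field)) \<Rightarrow> (nat \<Rightarrow> rat)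
    \<Rightarrow> (('n \<Rightarrow>\<^sub>0 nat) \<Rightarrow>\<^sub>0 'k) \<Rightarrow> rat" where
  "Qdiv n f \<alpha> h = (\<Sum>i\<in>{i. i \<le> n \<and> h dvd f i \<and> f i dvd h}. \<alpha> i)"

text \<open>The section ring R_D = \<Oplus>_d u^d H^0(\<lfloor>dD\<rfloor>) as a subring of k(P^m)[u].\<close>
definition section_ring :: "nat \<Rightarrow> (nat \<Rightarrow> (('n::{finite,linorder} \<Rightarrow>\<^sub>0 nat) \<Rightarrow>\<^sub>0 'k::field))
    \<Rightarrow> (nat \<Rightarrow> rat) \<Rightarrow> (('n \<Rightarrow>\<^sub>0 nat) \<Rightarrow>\<^sub>0 'k) fract poly set" where
  "section_ring n f \<alpha> =
     {p. \<forall>d. coeff p d \<in> H0 (\<lambda>h. \<lfloor>of_nat d * Qdiv n f \<alpha> h\<rfloor>)}"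

definition kconst :: "'k::field \<Rightarrow> (('n::{finite,linorder} \<Rightarrow>\<^sub>0 nat) \<Rightarrow>\<^sub>0 'k) fract poly" where
  "kconst c = [: Fract (mconst c) 1 :]"

inductive_set alg_gen :: "(('n::{finite,linorder} \<Rightarrow>\<^sub>0 nat) \<Rightarrow>\<^sub>0 'k::field) fract poly set
    \<Rightarrow> (('n \<Rightarrow>\<^sub>0 nat) \<Rightarrow>\<^sub>0 'k) fract poly set" for S where
  const: "kconst c \<in> alg_gen S"
| gen: "s \<in> S \<Longrightarrow> s \<in> alg_gen S"
| add: "p \<in> alg_gen S \<Longrightarrow> q \<in> alg_gen S \<Longrightarrow> p + q \<in> alg_gen S"
| mult: "p \<in> alg_gen S \<Longrightarrow> q \<in> alg_gen S \<Longrightarrow> p * q \<in> alg_gen S"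

definition homog_el :: "'a::zero poly \<Rightarrow> bool" where
  "homog_el p \<longleftrightarrow> p = monom (lead_coeff p) (degree p)"

definition generated_in_degrees_le ::
    "(('n::{finite,linorder} \<Rightarrow>\<^sub>0 nat) \<Rightarrow>\<^sub>0 'k::field) fract poly set \<Rightarrow> nat \<Rightarrow> bool" where
  "generated_in_degrees_le R N \<longleftrightarrow> R = alg_gen {p \<in> R. homog_el p \<and> degree p \<le> N}"

definition min_hom_gens ::
    "(('n::{finite,linorder} \<Rightarrow>\<^sub>0 nat) \<Rightarrow>\<^sub>0 'k::field) fract poly set \<Rightarrow> nat
     \<Rightarrow> (nat \<Rightarrow> (('n \<Rightarrow>\<^sub>0 nat) \<Rightarrow>\<^sub>0 'k) fract poly) \<Rightarrow> bool" where
  "min_hom_gens R r g \<longleftrightarrow>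
     (\<forall>i<r. g i \<in> R \<and> homog_el (g i) \<and> g i \<noteq> 0) \<and> inj_on g {..<r} \<and>
     alg_gen (g ` {..<r}) = R \<and>
     (\<forall>A. A \<subset> g ` {..<r} \<longrightarrow> alg_gen A \<noteq> R)"

definition in_vars :: "nat \<Rightarrow> ((nat \<Rightarrow>\<^sub>0 nat) \<Rightarrow>\<^sub>0 'k::zero) \<Rightarrow> bool" where
  "in_vars r P \<longleftrightarrow> (\<forall>\<mu>\<in>Poly_Mapping.keys P. Poly_Mapping.keys \<mu> \<subseteq> {..<r})"

definition eval_w :: "(nat \<Rightarrow> (('n::{finite,linorder} \<Rightarrow>\<^sub>0 nat) \<Rightarrow>\<^sub>0 'k::field) fract poly)
    \<Rightarrow> ((nat \<Rightarrow>\<^sub>0 nat) \<Rightarrow>\<^sub>0 'k) \<Rightarrow> (('n \<Rightarrow>\<^sub>0 nat) \<Rightarrow>\<^sub>0 'k) fract poly" where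
  "eval_w g P = (\<Sum>\<mu>\<in>Poly_Mapping.keys P. kconst (Poly_Mapping.lookup P \<mu>) * (\<Prod>i\<in>Poly_Mapping.keys \<mu>. g i ^ Poly_Mapping.lookup \<mu> i))"

definition wdeg :: "(nat \<Rightarrow> nat) \<Rightarrow> (nat \<Rightarrow>\<^sub>0 nat) \<Rightarrow> nat" where
  "wdeg e \<mu> = (\<Sum>i\<in>Poly_Mapping.keys \<mu>. Poly_Mapping.lookup \<mu> i * e i)"

definition whomog :: "(nat \<Rightarrow> nat) \<Rightarrow> nat \<Rightarrow> ((nat \<Rightarrow>\<^sub>0 nat) \<Rightarrow>\<^sub>0 'k::zero) \<Rightarrow> bool" where
  "whomog e t P \<longleftrightarrow> (\<forall>\<mu>\<in>Poly_Mapping.keys P. wdeg e \<mu> = t)"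

definition rel_kernel :: "nat \<Rightarrow> (nat \<Rightarrow> (('n::{finite,linorder} \<Rightarrow>\<^sub>0 nat) \<Rightarrow>\<^sub>0 'k::field) fract poly)
    \<Rightarrow> ((nat \<Rightarrow>\<^sub>0 nat) \<Rightarrow>\<^sub>0 'k) set" where
  "rel_kernel r g = {P. in_vars r P \<and> eval_w g P = 0}"

definition ideal_gen :: "nat \<Rightarrow> ((nat \<Rightarrow>\<^sub>0 nat) \<Rightarrow>\<^sub>0 'k::comm_ring_1) set
    \<Rightarrow> ((nat \<Rightarrow>\<^sub>0 nat) \<Rightarrow>\<^sub>0 'k) set" where
  "ideal_gen r S = {\<Sum>i<q. c i * s i | (q::nat) (c::nat \<Rightarrow> (nat \<Rightarrow>\<^sub>0 nat) \<Rightarrow>\<^sub>0 'k) s.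
                       \<forall>i<q. in_vars r (c i) \<and> s i \<in> S}"

definition relations_generated_le ::
    "nat \<Rightarrow> (nat \<Rightarrow> (('n::{finite,linorder} \<Rightarrow>\<^sub>0 nat) \<Rightarrow>\<^sub>0 'k::field) fract poly) \<Rightarrow> rat \<Rightarrow> bool" where
  "relations_generated_le r g M \<longleftrightarrow>
     (\<exists>S \<subseteq> rel_kernel r g.
        (\<forall>P\<in>S. \<exists>t. whomog (\<lambda>i. degree (g i)) t P \<and> of_nat t \<le> M) \<and>
        ideal_gen r S = rel_kernel r g)"

definition den :: "(nat \<Rightarrow> rat) \<Rightarrow> nat \<Rightarrow> int" where
  "den \<alpha> i = snd (quotient_of (\<alpha> i))"

definition ell :: "nat \<Rightarrow> (nat \<Rightarrow> rat) \<Rightarrow> nat \<Rightarrow> int" where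
  "ell n \<alpha> i = Lcm (den \<alpha> ` ({..n} - {i}))"

end

(* The linear forms among the f_i serve as coordinates, so in degree d the section ring is spanned by
   the monomials u^d * prod f_i^(c_i) with sum a_i c_i = 0 and all slacks c_i + d alpha_i >= 0. Their
   exponents form the lattice points of a simplicial cone: the ray on which only the j-th slack is
   nonzero contains a lattice point of degree l_j a_j, so every exponent is a sum of ray points and
   one point of the half-open box they span, which has degree < sum l_j a_j; this bounds the
   generators. Relations come in two kinds. Products of two box points have degree
   < 2 * sum l_j a_j. Rewriting an f_i that is not a coordinate as a polynomial in the coordinates
   gives relations indexed by the shifted cone sum a_i c_i = -a_i, whose apex lies in degree
   a_i / deg D, so its box points have degree < a_i / deg D + sum l_j a_j. Modulo these relations
   every polynomial reduces to monomials involving only the coordinates, which are linearly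
   independent because linearly independent linear forms are algebraically independent.
   That sections have no poles off the D_i uses that irreducible polynomials are prime. *)

theory Submission
  imports Defs
begin

section \<open>Evaluation of multivariate polynomials\<close>

text \<open>The slacks are the working coordinates of the cone. Since sum a_i c_i is fixed, degree
  is linear in them: d * deg D = q + sum a_i * slack_i, with q = 0 for sections and q = a_i for the
  shifted cone. The constant l_j arises as follows: if only the j-th slack is nonzero, then c_i = -d
  \<alpha>_i for all other i, and d = l_j a_j makes these numbers integers, and c_j too; the j-th
  slack is then l_j * deg D. Box slacks below l_i * deg D give every degree bound. The obstacle is
  that relations must have bounded degree although the monomials to be multiplied do not, and that
  the given generators are arbitrary homogeneous elements rather than monomials. Therefore
  polynomial preimages are chosen freely only for rays and box points; every other monomial gets the
  product of these. Adding rays then commutes with lifting exactly, so an unbounded relation is a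
  ray factor times a bounded one, and a bounded one is just a difference of two preimages of the
  same element.\<close>

definition mexp :: "('v \<Rightarrow> 'b::comm_monoid_mult) \<Rightarrow> ('v \<Rightarrow>\<^sub>0 nat) \<Rightarrow> 'b" where
  "mexp \<eta> \<mu> = (\<Prod>i\<in>Poly_Mapping.keys \<mu>. \<eta> i ^ Poly_Mapping.lookup \<mu> i)"

text \<open>Coefficient map and values of the variables are both left free, so that one set of
  homomorphism rules serves linear substitutions, the grading, the isolation of a single variable
  and \<open>eval_w\<close>.\<close>

definition ev :: "('k::zero \<Rightarrow> 'b::comm_semiring_1) \<Rightarrow> ('v \<Rightarrow> 'b) \<Rightarrow> (('v \<Rightarrow>\<^sub>0 nat) \<Rightarrow>\<^sub>0 'k) \<Rightarrow> 'b" where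
  "ev \<kappa> \<eta> P = (\<Sum>\<mu>\<in>Poly_Mapping.keys P. \<kappa> (Poly_Mapping.lookup P \<mu>) * mexp \<eta> \<mu>)"

definition pvar :: "'v \<Rightarrow> (('v \<Rightarrow>\<^sub>0 nat) \<Rightarrow>\<^sub>0 'k::zero_neq_one)" where
  "pvar i = Poly_Mapping.single (Poly_Mapping.single i 1) 1"

lemma mexp_superset:
  assumes "finite A" "Poly_Mapping.keys \<mu> \<subseteq> A"
  shows "mexp \<eta> \<mu> = (\<Prod>i\<in>A. \<eta> i ^ Poly_Mapping.lookup \<mu> i)"
  unfolding mexp_def using assms
  by (intro prod.mono_neutral_left) (auto simp: in_keys_iff)

lemma mexp_add: "mexp \<eta> (\<mu> + \<nu>) = mexp \<eta> \<mu> * mexp \<eta> \<nu>"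
proof -
  let ?A = "Poly_Mapping.keys \<mu> \<union> Poly_Mapping.keys \<nu>"
  have "Poly_Mapping.keys (\<mu> + \<nu>) \<subseteq> ?A" by (rule Poly_Mapping.keys_add)
  then show ?thesis
    by (simp add: mexp_superset[of ?A] lookup_add power_add prod.distrib)
qed

lemma mexp_zero [simp]: "mexp \<eta> 0 = 1"
  by (simp add: mexp_def)

lemma mexp_single [simp]: "mexp \<eta> (Poly_Mapping.single i k) = \<eta> i ^ k"
  by (cases "k = 0") (simp_all add: mexp_def)

lemma poly_mapping_expand:
  fixes P :: "'a \<Rightarrow>\<^sub>0 'b::comm_monoid_add"
  shows "P = (\<Sum>\<mu>\<in>Poly_Mapping.keys P. Poly_Mapping.single \<mu> (Poly_Mapping.lookup P \<mu>))"
proof (rule poly_mapping_eqI)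
  fix k
  have "(\<Sum>\<mu>\<in>Poly_Mapping.keys P. Poly_Mapping.lookup (Poly_Mapping.single \<mu> (Poly_Mapping.lookup P \<mu>)) k)
      = (\<Sum>\<mu>\<in>Poly_Mapping.keys P. if \<mu> = k then Poly_Mapping.lookup P \<mu> else 0)"
    by (intro sum.cong refl) (auto simp: lookup_single when_def)
  then show "Poly_Mapping.lookup P k = Poly_Mapping.lookup (\<Sum>\<mu>\<in>Poly_Mapping.keys P. Poly_Mapping.single \<mu> (Poly_Mapping.lookup P \<mu>)) k"
    by (simp add: lookup_sum in_keys_iff)
qed

lemma poly_mapping_single_induct [case_names zero single add]:
  fixes P :: "'a \<Rightarrow>\<^sub>0 'b::comm_monoid_add"
  assumes "Q 0" "\<And>\<mu> c. Q (Poly_Mapping.single \<mu> c)" "\<And>A B. Q A \<Longrightarrow> Q B \<Longrightarrow> Q (A + B)"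
  shows "Q P"
proof -
  have "finite A \<Longrightarrow> Q (\<Sum>\<mu>\<in>A. Poly_Mapping.single \<mu> (Poly_Mapping.lookup P \<mu>))" for A
    by (induction A rule: finite_induct) (auto intro: assms)
  from this[OF finite_keys[of P]] show ?thesis using poly_mapping_expand[of P] by simp
qed

locale eval_hom =
  fixes \<kappa> :: "'k::comm_ring_1 \<Rightarrow> 'b::comm_ring_1"
  assumes \<kappa>_add: "\<kappa> (x + y) = \<kappa> x + \<kappa> y"
    and \<kappa>_mult: "\<kappa> (x * y) = \<kappa> x * \<kappa> y"
    and \<kappa>_one: "\<kappa> 1 = 1"
begin

lemma \<kappa>_zero [simp]: "\<kappa> 0 = 0"
  using \<kappa>_add[of 0 0] by simp

lemma ev_add: "ev \<kappa> \<eta> (P + Q) = ev \<kappa> \<eta> P + ev \<kappa> \<eta> Q"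
  unfolding ev_def
  by (rule setsum_keys_plus_distrib) (simp_all add: \<kappa>_add algebra_simps)

lemma ev_zero [simp]: "ev \<kappa> \<eta> 0 = 0"
  by (simp add: ev_def)

lemma ev_uminus: "ev \<kappa> \<eta> (- P) = - ev \<kappa> \<eta> P"
  using ev_add[of \<eta> P "- P"] by (simp add: eq_neg_iff_add_eq_0 add.commute)

lemma ev_diff: "ev \<kappa> \<eta> (P - Q) = ev \<kappa> \<eta> P - ev \<kappa> \<eta> Q"
  using ev_add[of \<eta> P "- Q"] by (simp add: ev_uminus)

lemma ev_sum: "ev \<kappa> \<eta> (\<Sum>x\<in>A. h x) = (\<Sum>x\<in>A. ev \<kappa> \<eta> (h x))"
  by (induction A rule: infinite_finite_induct) (simp_all add: ev_add)

lemma ev_single: "ev \<kappa> \<eta> (Poly_Mapping.single \<mu> c) = \<kappa> c * mexp \<eta> \<mu>"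
  by (cases "c = 0") (simp_all add: ev_def)

lemma ev_mconst: "ev \<kappa> \<eta> (mconst c) = \<kappa> c"
  by (simp add: mconst_def ev_single)

lemma ev_one: "ev \<kappa> \<eta> 1 = 1"
  using ev_mconst[of \<eta> 1] by (simp add: mconst_def \<kappa>_one)

lemma ev_pvar: "ev \<kappa> \<eta> (pvar i) = \<eta> i"
  by (simp add: pvar_def ev_single \<kappa>_one)

lemma ev_mult: "ev \<kappa> \<eta> (P * Q) = ev \<kappa> \<eta> P * ev \<kappa> \<eta> Q"
proof (induction P rule: poly_mapping_single_induct)
  case (single \<mu> c)
  show ?case
    by (induction Q rule: poly_mapping_single_induct)
      (simp_all add: mult_single ev_single mexp_add \<kappa>_mult distrib_left ev_add algebra_simps)
qed (simp_all add: distrib_right ev_add)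

lemma ev_power: "ev \<kappa> \<eta> (P ^ k) = ev \<kappa> \<eta> P ^ k"
  by (induction k) (simp_all add: ev_one ev_mult)

lemma ev_prod: "ev \<kappa> \<eta> (\<Prod>x\<in>A. h x) = (\<Prod>x\<in>A. ev \<kappa> \<eta> (h x))"
  by (induction A rule: infinite_finite_induct) (simp_all add: ev_one ev_mult)

lemma ev_mexp: "ev \<kappa> \<eta> (mexp h \<mu>) = mexp (\<lambda>x. ev \<kappa> \<eta> (h x)) \<mu>"
  by (simp add: mexp_def ev_prod ev_power)

end

lemma mconst_hom: "eval_hom (mconst :: 'k::comm_ring_1 \<Rightarrow> ('v \<Rightarrow>\<^sub>0 nat) \<Rightarrow>\<^sub>0 'k)"
  by unfold_locales (simp_all add: mconst_def single_add mult_single)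

lemma mexp_pvar: "mexp pvar \<mu> = Poly_Mapping.single \<mu> (1::'k::comm_semiring_1)"
proof (induction \<mu> rule: poly_mapping_single_induct)
  case (single i k)
  show ?case
    by (induction k) (simp_all add: pvar_def mult_single flip: single_add)
qed (simp_all add: mexp_add mult_single)

lemma ev_mconst_pvar: "ev mconst pvar P = (P :: ('v \<Rightarrow>\<^sub>0 nat) \<Rightarrow>\<^sub>0 'k::comm_ring_1)"
  using poly_mapping_expand[of P]
  by (simp add: ev_def mexp_pvar mconst_def mult_single)

section \<open>Irreducible polynomials are prime\<close>

text \<open>Unique factorization is proved by induction on the number of variables. As a type cannot vary in
  an induction, the polynomials in a subset of the variables form a subring given by a carrier set.\<close>

locale subdom =
  fixes S :: "'a::idom set"
  assumes S_zero [simp, intro]: "0 \<in> S"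
    and S_one [simp, intro]: "1 \<in> S"
    and S_add [intro]: "x \<in> S \<Longrightarrow> y \<in> S \<Longrightarrow> x + y \<in> S"
    and S_mult [intro]: "x \<in> S \<Longrightarrow> y \<in> S \<Longrightarrow> x * y \<in> S"
    and S_uminus [intro]: "x \<in> S \<Longrightarrow> - x \<in> S"
begin

lemma S_diff [intro]: "x \<in> S \<Longrightarrow> y \<in> S \<Longrightarrow> x - y \<in> S"
  using S_add[OF _ S_uminus, of x y] by simp

lemma S_sum [intro]: "(\<And>x. x \<in> A \<Longrightarrow> h x \<in> S) \<Longrightarrow> sum h A \<in> S"
  by (induction A rule: infinite_finite_induct) auto

definition sdvd :: "'a \<Rightarrow> 'a \<Rightarrow> bool" where
  "sdvd a b \<longleftrightarrow> (\<exists>c\<in>S. b = a * c)"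

definition sprime :: "'a \<Rightarrow> bool" where
  "sprime p \<longleftrightarrow> p \<in> S \<and> p \<noteq> 0 \<and> \<not> sdvd p 1 \<and>
     (\<forall>a\<in>S. \<forall>b\<in>S. sdvd p (a * b) \<longrightarrow> sdvd p a \<or> sdvd p b)"

definition sirred :: "'a \<Rightarrow> bool" where
  "sirred p \<longleftrightarrow> p \<in> S \<and> p \<noteq> 0 \<and> \<not> sdvd p 1 \<and>
     (\<forall>a\<in>S. \<forall>b\<in>S. p = a * b \<longrightarrow> sdvd a 1 \<or> sdvd b 1)"

lemma sdvd_add: "sdvd p a \<Longrightarrow> sdvd p b \<Longrightarrow> sdvd p (a + b)"
  unfolding sdvd_def by (metis S_add distrib_left)

lemma sdvd_diff: "sdvd p a \<Longrightarrow> sdvd p b \<Longrightarrow> sdvd p (a - b)"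
  unfolding sdvd_def by (metis S_diff right_diff_distrib)

lemma sdvd_zero: "sdvd p 0"
  unfolding sdvd_def by (intro bexI[of _ 0]) auto

lemma sdvd_sum: "(\<And>x. x \<in> A \<Longrightarrow> sdvd p (h x)) \<Longrightarrow> sdvd p (sum h A)"
  by (induction A rule: infinite_finite_induct) (auto intro: sdvd_add sdvd_zero)

lemma sdvd_mult_right: "sdvd p a \<Longrightarrow> b \<in> S \<Longrightarrow> sdvd p (a * b)"
  unfolding sdvd_def by (metis S_mult mult.assoc)

lemma sdvd_mult_left: "sdvd p a \<Longrightarrow> b \<in> S \<Longrightarrow> sdvd p (b * a)"
  using sdvd_mult_right by (simp add: mult.commute)

definition sp :: "'a poly set" where
  "sp = {f. \<forall>i. coeff f i \<in> S}"

lemma subdom_sp: "subdom sp"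
  by unfold_locales (auto simp: sp_def coeff_mult)

end

text \<open>The additive measure \<open>\<delta>\<close>, zero exactly at the units, replaces a
  chain condition: it drops strictly when a nonunit factor is split off, so factorizations exist by
  induction.\<close>

locale ufd_sub = subdom S for S :: "'a::idom set" +
  fixes \<delta> :: "'a \<Rightarrow> nat"
  assumes \<delta>_mult: "a \<in> S \<Longrightarrow> a \<noteq> 0 \<Longrightarrow> b \<in> S \<Longrightarrow> b \<noteq> 0 \<Longrightarrow> \<delta> (a * b) = \<delta> a + \<delta> b"
    and \<delta>_unit: "a \<in> S \<Longrightarrow> a \<noteq> 0 \<Longrightarrow> \<delta> a = 0 \<longleftrightarrow> sdvd a 1"
    and irred_prime: "sirred p \<Longrightarrow> sprime p"
begin

lemma ex_irred_factor:
  assumes "a \<in> S" "a \<noteq> 0" "\<not> sdvd a 1"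
  shows "\<exists>p b. sirred p \<and> b \<in> S \<and> a = p * b"
  using assms
proof (induction "\<delta> a" arbitrary: a rule: less_induct)
  case less
  show ?case
  proof (cases "sirred a")
    case True
    then show ?thesis by (intro exI[of _ a] exI[of _ 1]) auto
  next
    case False
    then obtain b c where bc: "b \<in> S" "c \<in> S" "a = b * c" "\<not> sdvd b 1" "\<not> sdvd c 1"
      using less.prems by (auto simp: sirred_def)
    then have nz: "b \<noteq> 0" "c \<noteq> 0" using less.prems by auto
    then have "\<delta> c \<noteq> 0" using bc \<delta>_unit by blast
    then have "\<delta> b < \<delta> a" using bc nz \<delta>_mult by simp
    from less.hyps[OF this bc(1) nz(1) bc(4)] obtain p b' where
      "sirred p" "b' \<in> S" "b = p * b'" by blast
    with bc show ?thesis by (metis S_mult mult.assoc)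
  qed
qed

lemma ufd_induct [consumes 2, case_names unit prime]:
  assumes "a \<in> S" "a \<noteq> 0"
    and unit: "\<And>u v. u \<in> S \<Longrightarrow> v \<in> S \<Longrightarrow> u * v = 1 \<Longrightarrow> Q u"
    and prime: "\<And>p b. sprime p \<Longrightarrow> b \<in> S \<Longrightarrow> b \<noteq> 0 \<Longrightarrow> Q b \<Longrightarrow> Q (p * b)"
  shows "Q a"
  using assms(1,2)
proof (induction "\<delta> a" arbitrary: a rule: less_induct)
  case less
  show ?case
  proof (cases "sdvd a 1")
    case True
    then obtain c where "c \<in> S" "1 = a * c" unfolding sdvd_def by blast
    then show ?thesis using unit[of a c] less.prems by simp
  next
    case False
    then obtain p b where pb: "sirred p" "b \<in> S" "a = p * b"
      using ex_irred_factor less.prems by blast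
    have p: "sprime p" by (rule irred_prime) fact
    have nz: "p \<noteq> 0" "b \<noteq> 0" using pb less.prems by auto
    have pS: "p \<in> S" "\<not> sdvd p 1" using p by (auto simp: sprime_def)
    then have "\<delta> p \<noteq> 0" using \<delta>_unit nz by blast
    then have "\<delta> b < \<delta> a" using \<delta>_mult pS nz pb by simp
    from less.hyps[OF this pb(2) nz(2)] show ?thesis
      using prime[OF p pb(2) nz(2)] pb(3) by simp
  qed
qed

section \<open>Polynomials in one variable over a factorial subring\<close>

interpretation P: subdom sp by (rule subdom_sp)

lemma sp_coeff: "f \<in> sp \<Longrightarrow> coeff f i \<in> S"
  by (simp add: sp_def)

lemma sp_smult: "c \<in> S \<Longrightarrow> f \<in> sp \<Longrightarrow> smult c f \<in> sp"
  by (auto simp: sp_def)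

lemma sp_monom: "c \<in> S \<Longrightarrow> monom c n \<in> sp"
  by (auto simp: sp_def)

lemma sp_const: "c \<in> S \<Longrightarrow> [:c:] \<in> sp"
  by (auto simp: sp_def coeff_pCons split: nat.split)

lemma const_sdvd_iff:
  assumes "f \<in> sp"
  shows "P.sdvd [:p:] f \<longleftrightarrow> (\<forall>i. sdvd p (coeff f i))"
proof
  assume "P.sdvd [:p:] f"
  then obtain g where "g \<in> sp" "f = [:p:] * g" unfolding P.sdvd_def by blast
  then show "\<forall>i. sdvd p (coeff f i)" by (auto simp: sdvd_def sp_def)
next
  assume "\<forall>i. sdvd p (coeff f i)"
  then have "\<forall>i. \<exists>c\<in>S. coeff f i = p * c" by (simp add: sdvd_def)
  then obtain h where h: "\<And>i. h i \<in> S" "\<And>i. coeff f i = p * h i" by metis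
  define g where "g = (\<Sum>i\<le>degree f. monom (h i) i)"
  have "g \<in> sp" unfolding g_def by (intro P.S_sum sp_monom h)
  moreover have "f = [:p:] * g"
    unfolding g_def by (subst poly_as_sum_of_monoms[symmetric])
      (simp add: sum_distrib_left smult_monom h(2) flip: h(2))
  ultimately show "P.sdvd [:p:] f" unfolding P.sdvd_def by blast
qed

text \<open>Take the least indices \<open>i\<close>, \<open>j\<close> at which \<open>p\<close>
  fails to divide the coefficients of \<open>f\<close> and \<open>g\<close>. In the coefficient of
  the product at \<open>i + j\<close>, every term except the one at \<open>i\<close> has a factor
  divisible by \<open>p\<close>.\<close>

lemma sprime_const_mult:
  assumes p: "sprime p" and fg: "f \<in> sp" "g \<in> sp" "P.sdvd [:p:] (f * g)"
  shows "P.sdvd [:p:] f \<or> P.sdvd [:p:] g"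
proof (rule ccontr)
  assume "\<not> ?thesis"
  then have ex: "\<exists>i. \<not> sdvd p (coeff f i)" "\<exists>i. \<not> sdvd p (coeff g i)"
    using const_sdvd_iff fg by auto
  define i where "i = (LEAST i. \<not> sdvd p (coeff f i))"
  define j where "j = (LEAST j. \<not> sdvd p (coeff g j))"
  have i: "\<not> sdvd p (coeff f i)" "\<And>k. k < i \<Longrightarrow> sdvd p (coeff f k)"
    unfolding i_def using LeastI_ex[OF ex(1)] not_less_Least by blast+
  have j: "\<not> sdvd p (coeff g j)" "\<And>k. k < j \<Longrightarrow> sdvd p (coeff g k)"
    unfolding j_def using LeastI_ex[OF ex(2)] not_less_Least by blast+
  let ?t = "\<lambda>k. coeff f k * coeff g (i + j - k)"
  have split: "coeff (f * g) (i + j) = ?t i + (\<Sum>k\<in>{..i+j} - {i}. ?t k)"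
    unfolding coeff_mult by (subst sum.remove[of _ i]) auto
  have "sdvd p (?t k)" if "k \<in> {..i+j} - {i}" for k
  proof (cases "k < i")
    case True
    then show ?thesis using i(2) fg sp_coeff by (intro sdvd_mult_right) auto
  next
    case False
    then have "i + j - k < j" using that by auto
    then show ?thesis using j(2) fg sp_coeff by (intro sdvd_mult_left) auto
  qed
  then have "sdvd p (\<Sum>k\<in>{..i+j} - {i}. ?t k)" by (intro sdvd_sum) auto
  moreover have "sdvd p (coeff (f * g) (i + j))"
    using const_sdvd_iff[of "f * g"] fg by auto
  moreover have "?t i = coeff (f * g) (i + j) - (\<Sum>k\<in>{..i+j} - {i}. ?t k)" using split by simp
  ultimately have "sdvd p (?t i)" by (simp only: sdvd_diff)
  then show False using i(1) j(1) p sp_coeff[OF fg(1), of i] sp_coeff[OF fg(2), of j] by (auto simp: sprime_def)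
qed

lemma const_sdvdE:
  assumes "P.sdvd [:p:] f"
  obtains g where "g \<in> sp" "f = smult p g"
  using assms unfolding P.sdvd_def by auto

text \<open>The primes of \<open>c\<close> are cancelled one by one. Each divides \<open>q\<close>
  or \<open>e\<close> because it stays prime over polynomials; those taken out of \<open>e\<close>
  are collected in \<open>c1\<close>, and unit factors are absorbed into \<open>q\<close>.\<close>

lemma cancel_const_factor:
  assumes "c \<in> S" "c \<noteq> 0" "f \<in> sp" "q \<in> sp" "e \<in> sp" "smult c f = q * e"
  shows "\<exists>c1\<in>S. \<exists>q'\<in>sp. \<exists>e'\<in>sp. f = q' * e' \<and> e = smult c1 e'"
  using assms
proof (induction c arbitrary: q e rule: ufd_induct)
  case (unit u v)
  have "f = smult (v * u) f" using unit by (simp add: mult.commute)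
  also have "\<dots> = smult v q * e" using unit by (metis mult_smult_left smult_smult)
  finally show ?case using unit
    by (intro bexI[of _ 1] bexI[of _ "smult v q"] bexI[of _ e]) (auto simp: sp_smult)
next
  case (prime p b)
  have pS: "p \<in> S" "p \<noteq> 0" using prime by (auto simp: sprime_def)
  have eq: "smult p (smult b f) = q * e" using prime.prems(4) by (simp only: smult_smult)
  have "q * e = [:p:] * smult b f" unfolding eq[symmetric] by (simp add: mult.commute)
  then have "P.sdvd [:p:] (q * e)" unfolding P.sdvd_def
    by (rule bexI) (rule sp_smult[OF prime.hyps(2) prime.prems(1)])
  from sprime_const_mult[OF prime(1) _ _ this] prime
  consider "P.sdvd [:p:] q" | "P.sdvd [:p:] e" by blast
  then show ?case
  proof cases
    case 1
    then obtain q1 where q1: "q1 \<in> sp" "q = smult p q1" by (rule const_sdvdE)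
    have "smult p (smult b f) = smult p (q1 * e)" unfolding eq q1(2) by simp
    then have "smult b f = q1 * e" using pS by (simp only: smult_cancel)
    then show ?thesis using prime.IH[OF prime.prems(1) q1(1) prime.prems(3)] by simp
  next
    case 2
    then obtain e1 where e1: "e1 \<in> sp" "e = smult p e1" by (rule const_sdvdE)
    have "smult p (smult b f) = smult p (q * e1)" unfolding eq e1(2) by simp
    then have "smult b f = q * e1" using pS by (simp only: smult_cancel)
    then obtain c1 q' e' where "c1 \<in> S" "q' \<in> sp" "e' \<in> sp" "f = q' * e'" "e1 = smult c1 e'"
      using prime.IH[OF prime.prems(1) prime.prems(2) e1(1)] by blast
    moreover from this have "e = smult (p * c1) e'" using e1(2) by simp
    moreover have "p * c1 \<in> S" using pS \<open>c1 \<in> S\<close> by (rule_tac S_mult)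
    ultimately show ?thesis by blast
  qed
qed

text \<open>Since \<open>f\<close> is primitive, every prime of \<open>c\<close> has to divide the
  cofactor \<open>s\<close>, from which it can be cancelled.\<close>

lemma cancel_const_dvd:
  assumes "c \<in> S" "c \<noteq> 0" "f \<in> sp" "g \<in> sp" "s \<in> sp" "smult c g = f * s"
    and prim: "\<And>p. sprime p \<Longrightarrow> \<not> P.sdvd [:p:] f"
  shows "P.sdvd f g"
  using assms(1-6)
proof (induction c arbitrary: s rule: ufd_induct)
  case (unit u v)
  have "g = smult (v * u) g" using unit by (simp add: mult.commute)
  also have "\<dots> = f * smult v s" using unit by (metis mult_smult_right smult_smult)
  finally show ?case using unit sp_smult unfolding P.sdvd_def by blast
next
  case (prime p b)
  have pS: "p \<in> S" "p \<noteq> 0" using prime by (auto simp: sprime_def)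
  have eq: "smult p (smult b g) = f * s" using prime.prems(4) by (simp only: smult_smult)
  have "f * s = [:p:] * smult b g" unfolding eq[symmetric] by (simp add: mult.commute)
  then have "P.sdvd [:p:] (f * s)" unfolding P.sdvd_def
    by (rule bexI) (rule sp_smult[OF prime.hyps(2) prime.prems(2)])
  from sprime_const_mult[OF prime(1) _ _ this] prime prim
  have "P.sdvd [:p:] s" by blast
  then obtain s1 where s1: "s1 \<in> sp" "s = smult p s1" by (rule const_sdvdE)
  have "smult p (smult b g) = smult p (f * s1)" unfolding eq s1(2) by simp
  then have "smult b g = f * s1" using pS by (simp only: smult_cancel)
  then show ?case using prime.IH[OF prime.prems(1,2) s1(1)] by simp
qed

text \<open>Leading coefficients cannot be inverted in \<open>S\<close>, so \<open>f\<close> is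
  scaled by the leading coefficient of \<open>e\<close> before each subtraction; \<open>c\<close> is
  the product of these scalings.\<close>

lemma pseudo_division:
  assumes e: "e \<in> sp" "e \<noteq> 0" and f: "f \<in> sp"
  shows "\<exists>c\<in>S. \<exists>q\<in>sp. \<exists>r\<in>sp. c \<noteq> 0 \<and> smult c f = q * e + r \<and> (r = 0 \<or> degree r < degree e)"
  using f
\<comment> \<open>The measure places zero strictly below the nonzero constants, which
  \<open>degree\<close> does not; this matters when \<open>e\<close> is itself constant.\<close>
proof (induction "if f = 0 then 0 else Suc (degree f)" arbitrary: f rule: less_induct)
  case less
  show ?case
  proof (cases "f = 0 \<or> degree f < degree e")
    case True
    then show ?thesis using less.prems
      by (intro bexI[of _ 1] bexI[of _ 0] bexI[of _ f]) auto
  next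
    case False
    then have nz: "f \<noteq> 0" "degree e \<le> degree f" by auto
    define m where "m = monom (lead_coeff f) (degree f - degree e)"
    define f' where "f' = smult (lead_coeff e) f - m * e"
    have m: "m \<in> sp" unfolding m_def using less.prems sp_coeff by (intro sp_monom) auto
    have f': "f' \<in> sp" unfolding f'_def using less.prems m e sp_coeff
      by (intro P.S_diff P.S_mult sp_smult) auto
    have lc: "lead_coeff f \<noteq> 0" "lead_coeff e \<noteq> 0" using nz e by auto
    have dm1: "degree (m * e) = degree f"
      using lc nz e by (simp add: m_def degree_mult_eq degree_monom_eq)
    have "lead_coeff (m * e) = lead_coeff f * lead_coeff e"
      unfolding lead_coeff_mult unfolding m_def lead_coeff_monom ..
    then have dm: "degree (m * e) = degree f" "coeff (m * e) (degree f) = lead_coeff f * lead_coeff e"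
      unfolding dm1 by simp_all
    have "f' = 0 \<or> degree f' < degree f"
    proof -
      have "degree f' \<le> degree f" unfolding f'_def
        by (rule order_trans[OF degree_diff_le_max]) (simp add: dm lc)
      moreover have "coeff f' (degree f) = 0" using dm by (simp add: f'_def)
      ultimately show ?thesis using le_neq_implies_less eq_zero_or_degree_less by blast
    qed
    then have "(if f' = 0 then 0 else Suc (degree f')) < (if f = 0 then 0 else Suc (degree f))"
      using nz by auto
    from less.hyps[OF this f'] obtain c q r where
      cqr: "c \<in> S" "q \<in> sp" "r \<in> sp" "c \<noteq> 0" "smult c f' = q * e + r" "r = 0 \<or> degree r < degree e"
      by blast
    have "smult (c * lead_coeff e) f = smult c f' + smult c m * e"
      by (simp add: f'_def smult_diff_right)
    also have "\<dots> = (q + smult c m) * e + r" using cqr by (simp add: algebra_simps)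
    finally have "smult (c * lead_coeff e) f = (q + smult c m) * e + r" .
    then show ?thesis using cqr lc m e sp_coeff
      by (intro bexI[of _ "c * lead_coeff e"] bexI[of _ "q + smult c m"] bexI[of _ r])
        (auto intro: sp_smult P.S_add)
  qed
qed

text \<open>Gauss's lemma without fraction fields: if an irreducible \<open>f\<close> divides \<open>g * h\<close>, an element \<open>e\<close> of
  least degree in the ideal \<open>(f, g)\<close> divides constant multiples of \<open>f\<close> and \<open>g\<close>. Either \<open>e\<close> has the
  degree of \<open>f\<close>, and \<open>f\<close> divides \<open>g\<close>, or \<open>e\<close> is a constant with \<open>f dvd e * h\<close>.\<close>

lemma sirred_poly_sprime:
  assumes f: "P.sirred f"
  shows "P.sprime f"
proof (cases "degree f = 0")
  case True
  then obtain p where p: "f = [:p:]" by (rule degree_eq_zeroE)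
  have pS: "p \<in> S" using f p sp_coeff[of f 0] by (simp add: P.sirred_def)
  have unit: "sdvd a 1 \<longleftrightarrow> P.sdvd [:a:] 1" for a
    by (subst const_sdvd_iff) (auto simp: sdvd_zero coeff_1)
  have "sirred p" unfolding sirred_def
  proof (intro conjI ballI impI)
    show "p \<in> S" by fact
    show "p \<noteq> 0" "\<not> sdvd p 1" using f p unit by (auto simp: P.sirred_def)
    fix a b assume "a \<in> S" "b \<in> S" "p = a * b"
    then have "f = [:a:] * [:b:]" using p by simp
    then show "sdvd a 1 \<or> sdvd b 1"
      using f \<open>a \<in> S\<close> \<open>b \<in> S\<close> sp_const unit by (simp add: P.sirred_def)
  qed
  then have "sprime p" by (rule irred_prime)
  then show ?thesis using f sprime_const_mult unfolding P.sprime_def P.sirred_def p by blast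
next
  case False
  have fS: "f \<in> sp" "f \<noteq> 0" "\<not> P.sdvd f 1" using f by (auto simp: P.sirred_def)
  have unit_deg: "degree a = 0" if a: "P.sdvd a 1" for a
  proof -
    obtain b where "1 = a * b" using a unfolding P.sdvd_def by blast
    then have "a \<noteq> 0" "b \<noteq> 0" "degree (a * b) = 0" by auto
    then show ?thesis by (simp add: degree_mult_eq)
  qed
  \<comment> \<open>\<open>f\<close> is primitive: a prime constant is no unit, and the
    complementary factor keeps the positive degree of \<open>f\<close>, so it is no unit
    either.\<close>
  have prim: "\<not> P.sdvd [:p:] f" if p: "sprime p" for p
  proof
    assume "P.sdvd [:p:] f"
    then obtain g where g: "g \<in> sp" "f = smult p g" by (rule const_sdvdE)
    have pS: "p \<in> S" "p \<noteq> 0" "\<not> sdvd p 1" using p by (auto simp: sprime_def)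
    have "f = [:p:] * g" using g by simp
    then have "P.sdvd [:p:] 1 \<or> P.sdvd g 1" using f g pS sp_const unfolding P.sirred_def by blast
    moreover have "\<not> P.sdvd [:p:] 1" using pS by (subst const_sdvd_iff) (auto simp: coeff_1)
    moreover have "degree g \<noteq> 0" using False g pS by simp
    ultimately show False using unit_deg[of g] by auto
  qed
  show ?thesis unfolding P.sprime_def
  proof (intro conjI ballI impI)
    fix g h assume g: "g \<in> sp" and h: "h \<in> sp" and dvd: "P.sdvd f (g * h)"
    define I where "I = {w. \<exists>u\<in>sp. \<exists>v\<in>sp. w = u * f + v * g}"
    have fI: "f \<in> I" unfolding I_def by (intro CollectI bexI[of _ 1] bexI[of _ 0]) auto
    have gI: "g \<in> I" unfolding I_def by (intro CollectI bexI[of _ 1] bexI[of _ 0]) auto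
    have Isp: "w \<in> sp" if "w \<in> I" for w using that fS g unfolding I_def by auto
    obtain e where e: "e \<in> I" "e \<noteq> 0" "\<And>w. w \<in> I \<Longrightarrow> w \<noteq> 0 \<Longrightarrow> degree e \<le> degree w"
      using ex_has_least_nat[of "\<lambda>w. w \<in> I \<and> w \<noteq> 0" f degree] fI fS by blast
    have div: "\<exists>c\<in>S. \<exists>q\<in>sp. c \<noteq> 0 \<and> smult c w = q * e" if w: "w \<in> I" for w
    proof -
      obtain c q r where cqr: "c \<in> S" "q \<in> sp" "r \<in> sp" "c \<noteq> 0" "smult c w = q * e + r"
        "r = 0 \<or> degree r < degree e"
        using pseudo_division[OF Isp[OF e(1)] e(2) Isp[OF w]] by blast
      obtain u v where uv: "u \<in> sp" "v \<in> sp" "w = u * f + v * g" using w unfolding I_def by blast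
      obtain u' v' where uv': "u' \<in> sp" "v' \<in> sp" "e = u' * f + v' * g" using e(1) unfolding I_def by blast
      \<comment> \<open>The remainder lies in the ideal again, hence vanishes by the minimal degree
        of \<open>e\<close>.\<close>
      have "r = smult c w - q * e" using cqr by simp
      also have "\<dots> = (smult c u - q * u') * f + (smult c v - q * v') * g"
        unfolding uv(3) uv'(3) by (simp add: algebra_simps smult_add_right)
      finally have "r \<in> I" unfolding I_def using uv uv' cqr sp_smult
        by (intro CollectI bexI[of _ "smult c u - q * u'"] bexI[of _ "smult c v - q * v'"]) auto
      then have "r = 0" using cqr(6) e(3)[of r] by (metis leD)
      then show ?thesis using cqr by auto
    qed
    obtain c q where cq: "c \<in> S" "q \<in> sp" "c \<noteq> 0" "smult c f = q * e" using div[OF fI] by blast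
    obtain c1 q' e' where ce: "c1 \<in> S" "q' \<in> sp" "e' \<in> sp" "f = q' * e'" "e = smult c1 e'"
      using cancel_const_factor[OF cq(1,3) fS(1) cq(2) Isp[OF e(1)] cq(4)] by blast
    have "P.sdvd q' 1 \<or> P.sdvd e' 1" using f ce unfolding P.sirred_def by blast
    then show "P.sdvd f g \<or> P.sdvd f h"
    proof
      assume "P.sdvd q' 1"
      then obtain t where t: "t \<in> sp" "1 = q' * t" unfolding P.sdvd_def by blast
      \<comment> \<open>With \<open>q'\<close> a unit, \<open>f\<close> divides \<open>e\<close>,
        which in turn divides a constant multiple of \<open>g\<close>; primitivity removes the
        constant.\<close>
      have e': "e' = f * t" using ce t by (metis mult.assoc mult.commute mult.right_neutral)
      obtain c' q'' where cq': "c' \<in> S" "q'' \<in> sp" "c' \<noteq> 0" "smult c' g = q'' * e" using div[OF gI] by blast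
      have "smult c' g = f * (smult c1 (q'' * t))" using cq' ce(5) e' by (simp add: mult_ac)
      moreover have "smult c1 (q'' * t) \<in> sp" using ce(1) cq'(2) t(1) by (intro sp_smult P.S_mult)
      ultimately have "P.sdvd f g"
        using cancel_const_dvd[OF cq'(1,3) fS(1) g _ _ prim] by blast
      then show ?thesis ..
    next
      assume "P.sdvd e' 1"
      then have "degree e = 0" using unit_deg[of e'] ce by simp
      then obtain e0 where e0: "e = [:e0:]" by (rule degree_eq_zeroE)
      have e0S: "e0 \<in> S" "e0 \<noteq> 0" using e e0 sp_coeff[OF Isp[OF e(1)], of 0] by auto
      obtain u v where uv: "u \<in> sp" "v \<in> sp" "e = u * f + v * g" using e(1) unfolding I_def by blast
      obtain w where w: "w \<in> sp" "g * h = f * w" using dvd unfolding P.sdvd_def by blast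
      have "smult e0 h = e * h" using e0 by simp
      also have "\<dots> = f * (u * h) + v * (g * h)" unfolding uv(3) by (simp add: algebra_simps)
      also have "\<dots> = f * (u * h + v * w)" unfolding w(2) by (simp add: algebra_simps)
      finally have "smult e0 h = f * (u * h + v * w)" .
      moreover have "u * h + v * w \<in> sp" using uv(1,2) h w(1) by (intro P.S_add P.S_mult)
      ultimately have "P.sdvd f h"
        using cancel_const_dvd[OF e0S fS(1) h _ _ prim] by blast
      then show ?thesis ..
    qed
  qed (use fS in auto)
qed

text \<open>Degree and leading coefficient are both multiplicative over a domain, so the measure is
  additive; it is zero only for constants that are units of \<open>S\<close>.\<close>

lemma ufd_poly: "ufd_sub sp (\<lambda>f. degree f + \<delta> (lead_coeff f))"
proof (intro ufd_sub.intro ufd_sub_axioms.intro subdom_sp)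
  fix f g assume fg: "f \<in> sp" "f \<noteq> 0" "g \<in> sp" "g \<noteq> 0"
  then show "degree (f * g) + \<delta> (lead_coeff (f * g)) =
    degree f + \<delta> (lead_coeff f) + (degree g + \<delta> (lead_coeff g))"
    unfolding lead_coeff_mult by (simp add: degree_mult_eq \<delta>_mult sp_coeff)
next
  fix f assume f: "f \<in> sp" "f \<noteq> 0"
  show "degree f + \<delta> (lead_coeff f) = 0 \<longleftrightarrow> P.sdvd f 1"
  proof
    assume *: "degree f + \<delta> (lead_coeff f) = 0"
    then obtain c where c: "f = [:c:]" by (metis add_is_0 degree_eq_zeroE)
    then have "sdvd c 1" using * \<delta>_unit[of c] f sp_coeff[of f 0] by simp
    then show "P.sdvd f 1"
      unfolding c by (subst const_sdvd_iff) (auto simp: coeff_1 sdvd_zero)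
  next
    assume "P.sdvd f 1"
    then obtain g where g: "g \<in> sp" "1 = f * g" unfolding P.sdvd_def by blast
    then have "degree (f * g) = 0" by (metis degree_1)
    moreover have "g \<noteq> 0" using g by auto
    ultimately have deg: "degree f = 0" "degree g = 0" using f by (simp_all add: degree_mult_eq)
    have lc: "lead_coeff f * lead_coeff g = 1" using g by (metis lead_coeff_mult lead_coeff_1)
    moreover have "sdvd (lead_coeff f) 1"
      unfolding sdvd_def using lc[symmetric] sp_coeff[OF g(1), of "degree g"] by blast
    ultimately show "degree f + \<delta> (lead_coeff f) = 0"
      using \<delta>_unit[OF sp_coeff[OF f(1)], of "degree f"] f(2) deg(1) leading_coeff_0_iff[of f] by simp
  qed
qed (rule sirred_poly_sprime)

text \<open>Each adjoined variable would wrap the type in another \<open>poly\<close>. Transport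
  along an injective homomorphism brings the result back into the original polynomial ring.\<close>

lemma ufd_image:
  fixes \<phi> :: "'a \<Rightarrow> 'b::idom"
  assumes add: "\<And>x y. \<phi> (x + y) = \<phi> x + \<phi> y" and mult: "\<And>x y. \<phi> (x * y) = \<phi> x * \<phi> y"
    and one: "\<phi> 1 = 1" and inj: "inj_on \<phi> S"
  shows "ufd_sub (\<phi> ` S) (\<delta> \<circ> inv_into S \<phi>)"
proof -
  have zero: "\<phi> 0 = 0" using add[of 0 0] by (metis add_0 add_cancel_left_right)
  have neg: "\<phi> (- x) = - \<phi> x" for x using add[of x "- x"] zero by (simp add: eq_neg_iff_add_eq_0 add.commute)
  interpret T: subdom "\<phi> ` S"
  proof
    show "0 \<in> \<phi> ` S" "1 \<in> \<phi> ` S" using zero one by (metis S_zero image_eqI, metis S_one image_eqI)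
  qed (auto simp flip: add mult neg)
  have eq: "\<phi> x = \<phi> y \<longleftrightarrow> x = y" if "x \<in> S" "y \<in> S" for x y
    using inj that by (auto simp: inj_on_def)
  have dvd: "T.sdvd (\<phi> x) (\<phi> y) \<longleftrightarrow> sdvd x y" if "x \<in> S" "y \<in> S" for x y
    unfolding T.sdvd_def sdvd_def using that by (auto simp: eq S_mult simp flip: mult)
  have dvd1: "T.sdvd (\<phi> x) 1 \<longleftrightarrow> sdvd x 1" if "x \<in> S" for x using dvd[OF that S_one] one by simp
  have nz: "\<phi> x = 0 \<longleftrightarrow> x = 0" if "x \<in> S" for x using eq[OF that S_zero] zero by simp
  have inv: "inv_into S \<phi> (\<phi> x) = x" if "x \<in> S" for x using inj that by simp
  show ?thesis
  proof
    fix a b assume "a \<in> \<phi> ` S" "a \<noteq> 0" "b \<in> \<phi> ` S" "b \<noteq> 0"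
    then show "(\<delta> \<circ> inv_into S \<phi>) (a * b) = (\<delta> \<circ> inv_into S \<phi>) a + (\<delta> \<circ> inv_into S \<phi>) b"
      by (auto simp: nz inv \<delta>_mult S_mult simp flip: mult)
  next
    fix a assume "a \<in> \<phi> ` S" "a \<noteq> 0"
    then show "((\<delta> \<circ> inv_into S \<phi>) a = 0) = T.sdvd a 1"
      by (auto simp: nz inv \<delta>_unit dvd1)
  next
    fix p assume p: "T.sirred p"
    then obtain x where x: "p = \<phi> x" "x \<in> S" by (auto simp: T.sirred_def)
    have "sirred x" using p x unfolding T.sirred_def sirred_def
      by (auto simp: nz dvd1 eq S_mult simp flip: mult)
    then have "sprime x" by (rule irred_prime)
    then show "T.sprime p" using x unfolding T.sprime_def sprime_def
      by (auto simp: nz dvd1 dvd S_mult simp flip: mult)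
  qed
qed

end

section \<open>Adjoining the variables one at a time\<close>

definition polys_in :: "'v set \<Rightarrow> (('v \<Rightarrow>\<^sub>0 nat) \<Rightarrow>\<^sub>0 'k::zero) set" where
  "polys_in V = {P. \<forall>\<mu>\<in>Poly_Mapping.keys P. Poly_Mapping.keys \<mu> \<subseteq> V}"

lemma polys_in_add: "P \<in> polys_in V \<Longrightarrow> Q \<in> polys_in V \<Longrightarrow> P + Q \<in> polys_in V"
  using Poly_Mapping.keys_add[of P Q] by (auto simp: polys_in_def)

lemma polys_in_mult:
  fixes P Q :: "('v \<Rightarrow>\<^sub>0 nat) \<Rightarrow>\<^sub>0 'k::semiring_0"
  assumes "P \<in> polys_in V" "Q \<in> polys_in V" shows "P * Q \<in> polys_in V"
proof -
  have "Poly_Mapping.keys \<rho> \<subseteq> V" if "\<rho> \<in> Poly_Mapping.keys (P * Q)" for \<rho>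
  proof -
    obtain \<mu> \<nu> where "\<rho> = \<mu> + \<nu>" "\<mu> \<in> Poly_Mapping.keys P" "\<nu> \<in> Poly_Mapping.keys Q"
      using keys_mult[of P Q] \<open>\<rho> \<in> _\<close> by auto
    with assms Poly_Mapping.keys_add[of \<mu> \<nu>] show ?thesis by (fastforce simp: polys_in_def)
  qed
  then show ?thesis by (auto simp: polys_in_def)
qed

lemma polys_in_zero: "0 \<in> polys_in V"
  by (simp add: polys_in_def)

lemma polys_in_one: "(1 :: ('v \<Rightarrow>\<^sub>0 nat) \<Rightarrow>\<^sub>0 'k::zero_neq_one) \<in> polys_in V"
  by (simp add: polys_in_def)

lemma polys_in_uminus: "(P :: ('v \<Rightarrow>\<^sub>0 nat) \<Rightarrow>\<^sub>0 'k::ab_group_add) \<in> polys_in V \<Longrightarrow> - P \<in> polys_in V"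
  by (simp add: polys_in_def in_keys_iff)

lemma polys_in_single: "Poly_Mapping.keys \<mu> \<subseteq> V \<Longrightarrow> Poly_Mapping.single \<mu> c \<in> polys_in V"
  by (auto simp: polys_in_def)

lemma polys_in_empty: "P \<in> polys_in {} \<Longrightarrow> P = mconst (Poly_Mapping.lookup P 0)"
  by (rule poly_mapping_eqI)
    (auto simp: polys_in_def mconst_def lookup_single when_def simp flip: not_in_keys_iff_lookup_eq_zero)

lemma subdom_polys_in: "subdom (polys_in V :: (('v::linorder \<Rightarrow>\<^sub>0 nat) \<Rightarrow>\<^sub>0 'k::idom) set)"
  by unfold_locales
    (auto intro: polys_in_add polys_in_mult polys_in_zero polys_in_one polys_in_uminus)

lemma ufd_polys_in_empty: "ufd_sub (polys_in {} :: (('v::linorder \<Rightarrow>\<^sub>0 nat) \<Rightarrow>\<^sub>0 'k::field) set) (\<lambda>_. 0)"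
proof -
  interpret subdom "polys_in {} :: (('v \<Rightarrow>\<^sub>0 nat) \<Rightarrow>\<^sub>0 'k) set" by (rule subdom_polys_in)
  have unit: "sdvd P 1" if P: "P \<in> polys_in {}" "P \<noteq> 0" for P :: "('v \<Rightarrow>\<^sub>0 nat) \<Rightarrow>\<^sub>0 'k"
  proof -
    obtain c where c: "P = mconst c" using polys_in_empty P by blast
    then have "c \<noteq> 0" using P by (auto simp: mconst_def)
    then have "1 = P * mconst (inverse c)" using c by (simp add: mconst_def mult_single)
    then show ?thesis unfolding sdvd_def
      by (intro bexI[of _ "mconst (inverse c)"]) (auto simp: mconst_def polys_in_single)
  qed
  show ?thesis by unfold_locales (auto simp: unit sirred_def)
qed

lemma ufd_polys_in_insert:
  fixes x :: "'v::linorder"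
  assumes x: "x \<notin> V" and ufd: "ufd_sub (polys_in V :: (('v \<Rightarrow>\<^sub>0 nat) \<Rightarrow>\<^sub>0 'k::field) set) \<delta>"
  shows "\<exists>\<delta>'. ufd_sub (polys_in (insert x V) :: (('v \<Rightarrow>\<^sub>0 nat) \<Rightarrow>\<^sub>0 'k) set) \<delta>'"
proof -
  interpret ufd_sub "polys_in V :: (('v \<Rightarrow>\<^sub>0 nat) \<Rightarrow>\<^sub>0 'k) set" \<delta> by fact
  interpret P: ufd_sub sp "\<lambda>f. degree f + \<delta> (lead_coeff f)" by (rule ufd_poly)
  define X :: "('v \<Rightarrow>\<^sub>0 nat) \<Rightarrow>\<^sub>0 'k" where "X = pvar x"
  define \<phi> where "\<phi> = (\<lambda>f. poly f X)"
  \<comment> \<open>Evaluation with \<open>\<kappa>\<close> and \<open>\<eta>\<close> reads a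
    polynomial as one in \<open>x\<close> over the other variables. It is a left inverse of
    \<open>\<phi>\<close> on \<open>sp\<close>, which gives the injectivity that the transport
    requires.\<close>
  define \<kappa> where "\<kappa> = (\<lambda>c. [:mconst c :: ('v \<Rightarrow>\<^sub>0 nat) \<Rightarrow>\<^sub>0 'k:])"
  define \<eta> where "\<eta> = (\<lambda>y. if y = x then [:0, 1:] else [:pvar y :: ('v \<Rightarrow>\<^sub>0 nat) \<Rightarrow>\<^sub>0 'k:])"
  interpret E: eval_hom \<kappa>
    by unfold_locales (simp_all add: \<kappa>_def mconst_def single_add mult_single one_pCons mult.commute)
  have const_prod: "(\<Prod>i\<in>A. [:h i:]) = [:\<Prod>i\<in>A. h i:]" for A and h :: "'v \<Rightarrow> ('v \<Rightarrow>\<^sub>0 nat) \<Rightarrow>\<^sub>0 'k"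
    by (induction A rule: infinite_finite_induct) (simp_all add: one_pCons)
  have const: "ev \<kappa> \<eta> c = [:c:]" if "c \<in> polys_in V" for c
  proof -
    have "mexp \<eta> \<mu> = [:mexp pvar \<mu>:]" if "Poly_Mapping.keys \<mu> \<subseteq> V" for \<mu>
    proof -
      have "\<eta> i ^ k = [:pvar i ^ k:]" if "i \<in> Poly_Mapping.keys \<mu>" for i k
        using that \<open>Poly_Mapping.keys \<mu> \<subseteq> V\<close> x
        by (auto simp: \<eta>_def poly_const_pow)
      then have "mexp \<eta> \<mu> = (\<Prod>i\<in>Poly_Mapping.keys \<mu>. [:pvar i ^ Poly_Mapping.lookup \<mu> i:])"
        by (simp add: mexp_def)
      also have "\<dots> = [:mexp pvar \<mu>:]" unfolding mexp_def by (rule const_prod)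
      finally show ?thesis .
    qed
    then have "ev \<kappa> \<eta> c = (\<Sum>\<mu>\<in>Poly_Mapping.keys c. [:mconst (Poly_Mapping.lookup c \<mu>) * mexp pvar \<mu>:])"
      unfolding ev_def using that by (intro sum.cong) (auto simp: \<kappa>_def polys_in_def)
    also have "\<dots> = [:ev mconst pvar c:]" unfolding ev_def
      by (rule poly_eqI) (simp add: coeff_sum coeff_pCons split: nat.split)
    finally show ?thesis by (simp add: ev_mconst_pvar)
  qed
  have \<eta>_x: "\<eta> x = [:0, 1:]" by (simp add: \<eta>_def)
  have left_inv: "ev \<kappa> \<eta> (\<phi> f) = f" if "f \<in> sp" for f
  proof -
    have "ev \<kappa> \<eta> (\<phi> f) = (\<Sum>i\<le>degree f. [:coeff f i:] * [:0, 1:] ^ i)"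
      using that const sp_coeff[OF that]
      by (simp add: \<phi>_def poly_altdef E.ev_sum E.ev_mult E.ev_power X_def E.ev_pvar \<eta>_x)
    also have "\<dots> = (\<Sum>i\<le>degree f. monom (coeff f i) i)"
      by (simp add: monom_altdef)
    finally show ?thesis by (simp add: poly_as_sum_of_monoms)
  qed
  have "ufd_sub (\<phi> ` sp) ((\<lambda>f. degree f + \<delta> (lead_coeff f)) \<circ> inv_into sp \<phi>)"
    by (rule P.ufd_image) (auto simp: \<phi>_def intro!: inj_on_inverseI[of _ "ev \<kappa> \<eta>"] left_inv[unfolded \<phi>_def])
  moreover have "\<phi> ` sp = polys_in (insert x V)"
  proof (intro equalityI subsetI)
    fix P :: "('v \<Rightarrow>\<^sub>0 nat) \<Rightarrow>\<^sub>0 'k" assume "P \<in> \<phi> ` sp"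
    then obtain f where f: "f \<in> sp" "P = \<phi> f" by blast
    interpret T: subdom "polys_in (insert x V) :: (('v \<Rightarrow>\<^sub>0 nat) \<Rightarrow>\<^sub>0 'k) set" by (rule subdom_polys_in)
    have X: "X \<in> polys_in (insert x V)" by (simp add: X_def pvar_def polys_in_single)
    have "X ^ i \<in> polys_in (insert x V)" for i by (induction i) (auto intro: T.S_mult X)
    moreover have "coeff f i \<in> polys_in (insert x V)" for i
      using sp_coeff[OF f(1), of i] unfolding polys_in_def by blast
    ultimately show "P \<in> polys_in (insert x V)"
      unfolding f \<phi>_def poly_altdef by (intro T.S_sum T.S_mult) auto
  next
    fix P :: "('v \<Rightarrow>\<^sub>0 nat) \<Rightarrow>\<^sub>0 'k" assume P: "P \<in> polys_in (insert x V)"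
    have im_sum: "sum h A \<in> \<phi> ` sp" if im: "\<And>\<mu>. \<mu> \<in> A \<Longrightarrow> h \<mu> \<in> \<phi> ` sp" for h and A :: "('v \<Rightarrow>\<^sub>0 nat) set"
    proof -
      have "\<forall>\<mu>\<in>A. \<exists>w. w \<in> sp \<and> h \<mu> = \<phi> w" using im by blast
      from bchoice[OF this] obtain w where "\<forall>\<mu>\<in>A. w \<mu> \<in> sp \<and> h \<mu> = \<phi> (w \<mu>)" ..
      then have "sum h A = \<phi> (sum w A)" "sum w A \<in> sp" by (auto simp: \<phi>_def poly_sum)
      then show ?thesis by blast
    qed
    have "Poly_Mapping.single \<mu> c \<in> \<phi> ` sp" if \<mu>: "Poly_Mapping.keys \<mu> \<subseteq> insert x V" for \<mu> c
    proof -
      let ?i = "Poly_Mapping.lookup \<mu> x"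
      define \<nu> where "\<nu> = \<mu> - Poly_Mapping.single x ?i"
      have split: "\<mu> = \<nu> + Poly_Mapping.single x ?i"
        by (rule poly_mapping_eqI) (simp add: \<nu>_def lookup_add lookup_minus lookup_single when_def)
      have "y \<in> V" if y: "y \<in> Poly_Mapping.keys \<nu>" for y
      proof -
        have "y \<noteq> x" using y by (auto simp: \<nu>_def in_keys_iff lookup_minus)
        then have "y \<in> Poly_Mapping.keys \<mu>"
          using y by (simp add: \<nu>_def in_keys_iff lookup_minus lookup_single)
        then show ?thesis using \<mu> \<open>y \<noteq> x\<close> by blast
      qed
      then have "Poly_Mapping.keys \<nu> \<subseteq> V" by blast
      then have "monom (Poly_Mapping.single \<nu> c) ?i \<in> sp" by (intro sp_monom polys_in_single)
      moreover have "X ^ k = Poly_Mapping.single (Poly_Mapping.single x k) 1" for k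
        using mexp_pvar[of "Poly_Mapping.single x k"] by (simp add: X_def)
      then have "\<phi> (monom (Poly_Mapping.single \<nu> c) ?i) = Poly_Mapping.single \<mu> c"
        by (subst split) (simp add: \<phi>_def poly_monom mult_single)
      ultimately show ?thesis by (metis image_eqI)
    qed
    then have "(\<Sum>\<mu>\<in>Poly_Mapping.keys P. Poly_Mapping.single \<mu> (Poly_Mapping.lookup P \<mu>)) \<in> \<phi> ` sp"
      using P by (intro im_sum) (auto simp: polys_in_def)
    then show "P \<in> \<phi> ` sp" by (simp flip: poly_mapping_expand)
  qed
  ultimately show ?thesis by auto
qed

lemma ufd_UNIV: "\<exists>\<delta>. ufd_sub (UNIV :: (('v::{finite,linorder} \<Rightarrow>\<^sub>0 nat) \<Rightarrow>\<^sub>0 'k::field) set) \<delta>"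
proof -
  have "finite V \<Longrightarrow> \<exists>\<delta>. ufd_sub (polys_in V :: (('v \<Rightarrow>\<^sub>0 nat) \<Rightarrow>\<^sub>0 'k) set) \<delta>" for V
    by (induction V rule: finite_induct) (use ufd_polys_in_empty ufd_polys_in_insert in blast)+
  from this[OF finite_UNIV] show ?thesis by (simp add: polys_in_def)
qed

lemma irreducible_imp_prime_elem_mpoly:
  fixes p :: "('v::{finite,linorder} \<Rightarrow>\<^sub>0 nat) \<Rightarrow>\<^sub>0 'k::field"
  assumes "irreducible p" shows "prime_elem p"
proof -
  obtain \<delta> where "ufd_sub (UNIV :: (('v \<Rightarrow>\<^sub>0 nat) \<Rightarrow>\<^sub>0 'k) set) \<delta>" using ufd_UNIV by blast
  then interpret ufd_sub "UNIV :: (('v \<Rightarrow>\<^sub>0 nat) \<Rightarrow>\<^sub>0 'k) set" \<delta> .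
  have [simp]: "sdvd a b \<longleftrightarrow> a dvd b" for a b by (simp add: sdvd_def dvd_def)
  have "sirred p" using assms by (auto simp: sirred_def irreducible_def)
  then have "sprime p" by (rule irred_prime)
  then show ?thesis by (auto simp: sprime_def prime_elem_def)
qed

lemma ex_irreducible_factor_mpoly:
  fixes P :: "('v::{finite,linorder} \<Rightarrow>\<^sub>0 nat) \<Rightarrow>\<^sub>0 'k::field"
  assumes "P \<noteq> 0" "\<not> P dvd 1" shows "\<exists>p. irreducible p \<and> p dvd P"
proof -
  obtain \<delta> where "ufd_sub (UNIV :: (('v \<Rightarrow>\<^sub>0 nat) \<Rightarrow>\<^sub>0 'k) set) \<delta>" using ufd_UNIV by blast
  then interpret ufd_sub "UNIV :: (('v \<Rightarrow>\<^sub>0 nat) \<Rightarrow>\<^sub>0 'k) set" \<delta> .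
  have [simp]: "sdvd a b \<longleftrightarrow> a dvd b" for a b by (simp add: sdvd_def dvd_def)
  obtain p b where "sirred p" "P = p * b" using ex_irred_factor[of P] assms by auto
  then show ?thesis by (intro exI[of _ p]) (auto simp: sirred_def irreducible_def)
qed

section \<open>Homogeneous polynomials\<close>

lemma mdeg_superset:
  assumes "finite A" "Poly_Mapping.keys \<mu> \<subseteq> A"
  shows "mdeg \<mu> = (\<Sum>i\<in>A. Poly_Mapping.lookup \<mu> i)"
  unfolding mdeg_def using assms
  by (intro sum.mono_neutral_left) (auto simp: in_keys_iff)

lemma mdeg_add: "mdeg (\<mu> + \<nu>) = mdeg \<mu> + mdeg \<nu>"
proof -
  let ?A = "Poly_Mapping.keys \<mu> \<union> Poly_Mapping.keys \<nu>"
  have "Poly_Mapping.keys (\<mu> + \<nu>) \<subseteq> ?A" by (rule Poly_Mapping.keys_add)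
  then show ?thesis
    by (simp add: mdeg_superset[of ?A] lookup_add sum.distrib)
qed

lemma mdeg_zero [simp]: "mdeg 0 = 0"
  by (simp add: mdeg_def)

lemma mdeg_single [simp]: "mdeg (Poly_Mapping.single i k) = k"
  by (cases "k = 0") (simp_all add: mdeg_def)

lemma mdeg_eq_0_iff: "mdeg \<mu> = 0 \<longleftrightarrow> \<mu> = 0"
  by (auto simp: mdeg_def in_keys_iff intro!: poly_mapping_eqI)

text \<open>The substitution x_i -> x_i T. Homogeneity of degree \<open>d\<close> becomes the
  equation \<open>grade P = monom P d\<close>, so degrees of products and factors can be studied in
  one variable over a domain.\<close>

definition grade :: "(('v \<Rightarrow>\<^sub>0 nat) \<Rightarrow>\<^sub>0 'k::comm_ring_1) \<Rightarrow> (('v \<Rightarrow>\<^sub>0 nat) \<Rightarrow>\<^sub>0 'k) poly" where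
  "grade = ev (\<lambda>c. [:mconst c:]) (\<lambda>i. monom (pvar i) 1)"

lemma grade_hom: "eval_hom (\<lambda>c. [:mconst c :: ('v \<Rightarrow>\<^sub>0 nat) \<Rightarrow>\<^sub>0 'k::comm_ring_1:])"
  by unfold_locales (simp_all add: mconst_def single_add mult_single one_pCons mult.commute)

lemma grade_mult: "grade (P * Q) = grade P * grade Q"
  unfolding grade_def by (rule eval_hom.ev_mult[OF grade_hom])

lemma grade_add: "grade (P + Q) = grade P + grade Q"
  unfolding grade_def by (rule eval_hom.ev_add[OF grade_hom])

lemma mexp_grade: "mexp (\<lambda>i. monom (pvar i) 1) \<mu> = monom (Poly_Mapping.single \<mu> (1::'k::comm_ring_1)) (mdeg \<mu>)"
proof (induction \<mu> rule: poly_mapping_single_induct)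
  case zero
  then show ?case by (simp add: monom_0 one_pCons)
next
  case (single i k)
  show ?case using mexp_pvar[of "Poly_Mapping.single i k"]
    by (simp add: monom_power)
qed (simp add: mexp_add mdeg_add mult_monom mult_single)

lemma grade_altdef: "grade P = (\<Sum>\<mu>\<in>Poly_Mapping.keys P. monom (Poly_Mapping.single \<mu> (Poly_Mapping.lookup P \<mu>)) (mdeg \<mu>))"
  unfolding grade_def ev_def mexp_grade
  by (simp add: mconst_def smult_monom mult_single)

lemma lookup_coeff_grade:
  "Poly_Mapping.lookup (coeff (grade P) j) \<mu> = (if mdeg \<mu> = j then Poly_Mapping.lookup P \<mu> else 0)"
proof -
  have "Poly_Mapping.lookup (coeff (grade P) j) \<mu> =
    (\<Sum>\<nu>\<in>Poly_Mapping.keys P. if \<nu> = \<mu> then (if mdeg \<mu> = j then Poly_Mapping.lookup P \<mu> else 0) else 0)"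
    unfolding grade_altdef coeff_sum lookup_sum
    by (intro sum.cong refl) (auto simp: lookup_single when_def)
  then show ?thesis by (simp add: in_keys_iff)
qed

lemma homog_of_iff: "homog_of d P \<longleftrightarrow> grade P = monom P d"
proof
  assume h: "homog_of d P"
  show "grade P = monom P d"
    by (intro poly_eqI poly_mapping_eqI)
      (use h in \<open>auto simp: lookup_coeff_grade homog_of_def simp flip: not_in_keys_iff_lookup_eq_zero\<close>)
next
  assume g: "grade P = monom P d"
  show "homog_of d P" unfolding homog_of_def
  proof
    fix \<mu> assume "\<mu> \<in> Poly_Mapping.keys P"
    moreover have "Poly_Mapping.lookup P \<mu> = Poly_Mapping.lookup (coeff (monom P d) (mdeg \<mu>)) \<mu>"
      using lookup_coeff_grade[of P "mdeg \<mu>" \<mu>] g by simp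
    ultimately show "mdeg \<mu> = d" by (auto simp: in_keys_iff split: if_splits)
  qed
qed

lemma homog_of_grade_monom:
  assumes "grade P = monom Q d"
  shows "homog_of d P"
  unfolding homog_of_def
proof
  fix \<mu> assume "\<mu> \<in> Poly_Mapping.keys P"
  moreover have "Poly_Mapping.lookup P \<mu> = Poly_Mapping.lookup (coeff (monom Q d) (mdeg \<mu>)) \<mu>"
    using lookup_coeff_grade[of P "mdeg \<mu>" \<mu>] assms by simp
  ultimately show "mdeg \<mu> = d" by (auto simp: in_keys_iff split: if_splits)
qed

lemma grade_eq_0_iff: "grade P = 0 \<longleftrightarrow> P = 0"
proof
  assume "grade P = 0"
  then have "Poly_Mapping.lookup P \<mu> = 0" for \<mu>
    using lookup_coeff_grade[of P "mdeg \<mu>" \<mu>] by simp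
  then show "P = 0" by (intro poly_mapping_eqI) simp
qed (simp add: grade_altdef)

lemma homog_of_zero [simp]: "homog_of d 0"
  by (simp add: homog_of_def)

lemma homog_of_mult: "homog_of d P \<Longrightarrow> homog_of e Q \<Longrightarrow> homog_of (d + e) (P * Q)"
  for P Q :: "('v \<Rightarrow>\<^sub>0 nat) \<Rightarrow>\<^sub>0 'k::comm_ring_1"
  by (simp add: homog_of_iff grade_mult mult_monom)

lemma homog_of_add: "homog_of d P \<Longrightarrow> homog_of d Q \<Longrightarrow> homog_of d (P + Q)"
  for P Q :: "('v \<Rightarrow>\<^sub>0 nat) \<Rightarrow>\<^sub>0 'k::comm_ring_1"
  by (simp add: homog_of_iff grade_add add_monom)

lemma homog_of_sum: "(\<And>x. x \<in> A \<Longrightarrow> homog_of d (h x)) \<Longrightarrow> homog_of d (sum h A)"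
  for h :: "'a \<Rightarrow> ('v \<Rightarrow>\<^sub>0 nat) \<Rightarrow>\<^sub>0 'k::comm_ring_1"
  by (induction A rule: infinite_finite_induct) (auto intro: homog_of_add)

lemma homog_of_mconst: "homog_of 0 (mconst c)"
  by (auto simp: homog_of_def mconst_def)

lemma homog_of_one: "homog_of 0 (1 :: ('v \<Rightarrow>\<^sub>0 nat) \<Rightarrow>\<^sub>0 'k::comm_ring_1)"
  by (auto simp: homog_of_def)

lemma homog_of_pvar: "homog_of 1 (pvar i :: ('v \<Rightarrow>\<^sub>0 nat) \<Rightarrow>\<^sub>0 'k::comm_ring_1)"
  by (auto simp: homog_of_def pvar_def)

lemma homog_of_power: "homog_of d P \<Longrightarrow> homog_of (k * d) (P ^ k)"
  for P :: "('v \<Rightarrow>\<^sub>0 nat) \<Rightarrow>\<^sub>0 'k::comm_ring_1"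
  by (induction k) (auto intro: homog_of_one homog_of_mult)

lemma homog_of_prod: "(\<And>x. x \<in> A \<Longrightarrow> homog_of (d x) (h x)) \<Longrightarrow> homog_of (\<Sum>x\<in>A. d x) (prod h A)"
  for h :: "'a \<Rightarrow> ('v \<Rightarrow>\<^sub>0 nat) \<Rightarrow>\<^sub>0 'k::comm_ring_1"
  by (induction A rule: infinite_finite_induct) (auto intro: homog_of_mult homog_of_one)

lemma homog_of_mexp:
  assumes "\<And>x. homog_of 1 (h x :: ('v \<Rightarrow>\<^sub>0 nat) \<Rightarrow>\<^sub>0 'k::comm_ring_1)"
  shows "homog_of (mdeg \<mu>) (mexp h \<mu>)"
proof -
  have "homog_of (\<Sum>i\<in>Poly_Mapping.keys \<mu>. Poly_Mapping.lookup \<mu> i * 1) (mexp h \<mu>)"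
    unfolding mexp_def by (intro homog_of_prod homog_of_power assms)
  then show ?thesis by (simp add: mdeg_def)
qed

lemma homog_of_unique: "homog_of d P \<Longrightarrow> homog_of e P \<Longrightarrow> P \<noteq> 0 \<Longrightarrow> d = e"
  unfolding homog_of_def by (metis poly_mapping_eqI lookup_zero in_keys_iff)

lemma homog_of_0_const:
  assumes "homog_of 0 P" shows "P = mconst (Poly_Mapping.lookup P 0)"
proof (rule poly_mapping_eqI)
  fix \<mu>
  show "Poly_Mapping.lookup P \<mu> = Poly_Mapping.lookup (mconst (Poly_Mapping.lookup P 0)) \<mu>"
    using assms by (cases "\<mu> = 0")
      (auto simp: homog_of_def mconst_def lookup_single mdeg_eq_0_iff in_keys_iff)
qed

lemma mconst_dvd_1: "c \<noteq> 0 \<Longrightarrow> mconst (c::'k::field) dvd (1 :: ('v \<Rightarrow>\<^sub>0 nat) \<Rightarrow>\<^sub>0 'k)"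
  by (rule dvdI[of _ _ "mconst (inverse c)"]) (simp add: mconst_def mult_single)

lemma homog_of_0_dvd_1:
  fixes P :: "('v \<Rightarrow>\<^sub>0 nat) \<Rightarrow>\<^sub>0 'k::field"
  assumes "homog_of 0 P" "P \<noteq> 0" shows "P dvd 1"
proof -
  have *: "P = mconst (Poly_Mapping.lookup P 0)" using assms(1) by (rule homog_of_0_const)
  then have "Poly_Mapping.lookup P 0 \<noteq> 0" using assms(2) by (metis mconst_def single_zero)
  then show ?thesis by (subst *) (rule mconst_dvd_1)
qed

text \<open>For a monomial, the order at 0 equals the degree. Both are additive and the order never
  exceeds the degree, so equality holds for each factor, leaving only a constant beside the power of
  the variable.\<close>

lemma monom_factor:
  fixes p q :: "'a::idom poly"
  assumes pq: "p * q = monom c n" "c \<noteq> 0"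
  shows "p = monom (lead_coeff p) (degree p)"
proof -
  have nz: "p \<noteq> 0" "q \<noteq> 0" "p * q \<noteq> 0" using pq by auto
  have "order 0 p + order 0 q = order 0 (p * q)" using order_mult[OF nz(3)] by simp
  also have "\<dots> = n" using pq by (simp add: order_0_monom)
  also have "n = degree (p * q)" using pq by (simp add: degree_monom_eq)
  also have "\<dots> = degree p + degree q" using nz by (simp add: degree_mult_eq)
  finally have ord: "order 0 p = degree p"
    using order_degree[OF nz(1), of 0] order_degree[OF nz(2), of 0] by linarith
  obtain r where r: "p = [:0, 1:] ^ order 0 p * r" using order_1[of 0 p] by (auto elim: dvdE)
  then have "r \<noteq> 0" using nz by auto
  have "degree p = degree ([:0, 1:] ^ order 0 p * r)" using r by simp
  also have "\<dots> = order 0 p + degree r"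
    using \<open>r \<noteq> 0\<close> by (simp add: degree_mult_eq degree_power_eq)
  finally have "degree r = 0" using ord by simp
  then obtain b where "r = [:b:]" by (rule degree_eq_zeroE)
  then have p: "p = monom b (degree p)" using r ord by (simp add: monom_altdef)
  then have "lead_coeff p = b" by (metis lead_coeff_monom)
  with p show ?thesis by simp
qed

lemma homog_of_factor:
  fixes A B :: "('v::linorder \<Rightarrow>\<^sub>0 nat) \<Rightarrow>\<^sub>0 'k::idom"
  assumes "homog_of d (A * B)" "A * B \<noteq> 0"
  shows "\<exists>i. homog_of i A"
proof -
  have "grade A * grade B = monom (A * B) d" using assms by (simp add: homog_of_iff grade_mult)
  then have "grade A = monom (lead_coeff (grade A)) (degree (grade A))"
    using assms(2) by (rule monom_factor)
  then show ?thesis using homog_of_grade_monom by blast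
qed

lemma homog_of_quotient:
  fixes A B :: "('v::linorder \<Rightarrow>\<^sub>0 nat) \<Rightarrow>\<^sub>0 'k::idom"
  assumes "homog_of d (A * B)" "A * B \<noteq> 0" "homog_of e B"
  shows "e \<le> d \<and> homog_of (d - e) A"
proof -
  obtain i where i: "homog_of i A" using homog_of_factor assms by blast
  then have "homog_of (i + e) (A * B)" using assms by (intro homog_of_mult)
  then have "i + e = d" using assms homog_of_unique by blast
  with i show ?thesis by auto
qed

section \<open>Orders along prime divisors\<close>

lemma degree_grade_pos:
  fixes p :: "('v::linorder \<Rightarrow>\<^sub>0 nat) \<Rightarrow>\<^sub>0 'k::field"
  assumes "p \<noteq> 0" "\<not> p dvd 1" shows "degree (grade p) > 0"
proof (rule ccontr)
  assume "\<not> ?thesis"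
  then obtain c where "grade p = [:c:]" by (metis degree_eq_zeroE gr0I)
  then have "homog_of 0 p" by (intro homog_of_grade_monom[of _ c]) (simp add: monom_0)
  then show False using homog_of_0_dvd_1 assms by blast
qed

lemma degree_grade_mult:
  fixes P Q :: "('v::linorder \<Rightarrow>\<^sub>0 nat) \<Rightarrow>\<^sub>0 'k::idom"
  assumes "P \<noteq> 0" "Q \<noteq> 0"
  shows "degree (grade (P * Q)) = degree (grade P) + degree (grade Q)"
  using assms by (simp add: grade_mult degree_mult_eq grade_eq_0_iff)

text \<open>\<open>mult_of\<close> falls back to 0 when the set is infinite, so its value means
  something only after this: each power of a nonunit raises the degree by at least one, while
  divisors of \<open>x\<close> have bounded degree.\<close>

lemma finite_mult_of:
  fixes p :: "('v::linorder \<Rightarrow>\<^sub>0 nat) \<Rightarrow>\<^sub>0 'k::field"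
  assumes p: "prime_elem p" and x: "x \<noteq> 0"
  shows "finite {n. p ^ n dvd x}"
proof (rule finite_subset)
  have p0: "p \<noteq> 0" "\<not> p dvd 1" using p by (auto simp: prime_elem_def)
  have "degree (grade (p ^ n)) = n * degree (grade p)" for n
  proof (induction n)
    case 0
    show ?case by (simp add: homog_of_one[unfolded homog_of_iff monom_0])
  next
    case (Suc n)
    then show ?case using p0 by (simp add: degree_grade_mult)
  qed
  moreover have "n * 1 \<le> n * degree (grade p)" for n
    using degree_grade_pos[OF p0] by (intro mult_le_mono2) simp
  ultimately have "n \<le> degree (grade (p ^ n))" for n by simp
  moreover have "degree (grade (p ^ n)) \<le> degree (grade x)" if "p ^ n dvd x" for n
    using that x by (auto simp: dvd_def degree_grade_mult)
  ultimately show "{n. p ^ n dvd x} \<subseteq> {..degree (grade x)}"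
    by (auto intro: order_trans)
qed simp

lemma mult_of_eqI:
  fixes p :: "('v::linorder \<Rightarrow>\<^sub>0 nat) \<Rightarrow>\<^sub>0 'k::field"
  assumes p: "prime_elem p" and x: "x = p ^ k * y" "\<not> p dvd y"
  shows "mult_of p x = k"
proof -
  have "y \<noteq> 0" "p \<noteq> 0" using x p by (auto simp: prime_elem_def)
  have "p ^ j dvd x \<longleftrightarrow> j \<le> k" for j
  proof
    assume "p ^ j dvd x"
    show "j \<le> k"
    proof (rule ccontr)
      assume "\<not> j \<le> k"
      then have "p ^ k * p dvd p ^ j" by (metis le_imp_power_dvd not_less_eq_eq power_Suc2)
      then have "p ^ k * p dvd p ^ k * y" using \<open>p ^ j dvd x\<close> x by (metis dvd_trans)
      then show False using x(2) \<open>p \<noteq> 0\<close> by simp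
    qed
  next
    assume "j \<le> k"
    then show "p ^ j dvd x" unfolding x by (intro dvd_mult2 le_imp_power_dvd)
  qed
  then have "{j. p ^ j dvd x} = {..k}" by auto
  moreover have "Max {..k} = k" by (intro Max_eqI) auto
  ultimately show ?thesis by (simp add: mult_of_def)
qed

lemma mult_of_split:
  fixes p :: "('v::linorder \<Rightarrow>\<^sub>0 nat) \<Rightarrow>\<^sub>0 'k::field"
  assumes p: "prime_elem p" and x: "x \<noteq> 0"
  obtains y where "x = p ^ mult_of p x * y" "\<not> p dvd y"
proof -
  note fin = finite_mult_of[OF assms]
  have "mult_of p x \<in> {n. p ^ n dvd x}"
    unfolding mult_of_def using fin by (simp only: if_True) (rule Max_in, auto intro: exI[of _ 0])
  then obtain y where y: "x = p ^ mult_of p x * y" by (auto simp: dvd_def)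
  have "\<not> p dvd y"
  proof
    assume "p dvd y"
    then have "p ^ Suc (mult_of p x) dvd x"
      by (subst y) (simp add: mult.commute[of p] mult_dvd_mono)
    then have "Suc (mult_of p x) \<le> mult_of p x"
      unfolding mult_of_def using fin by (simp only: if_True) (rule Max_ge, auto)
    then show False by simp
  qed
  with y show ?thesis by (rule that)
qed

lemma mult_of_mult:
  fixes p :: "('v::linorder \<Rightarrow>\<^sub>0 nat) \<Rightarrow>\<^sub>0 'k::field"
  assumes p: "prime_elem p" and xy: "x \<noteq> 0" "y \<noteq> 0"
  shows "mult_of p (x * y) = mult_of p x + mult_of p y"
proof -
  obtain x' where x': "x = p ^ mult_of p x * x'" "\<not> p dvd x'" using mult_of_split p xy by blast
  obtain y' where y': "y = p ^ mult_of p y * y'" "\<not> p dvd y'" using mult_of_split p xy by blast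
  have "x * y = p ^ (mult_of p x + mult_of p y) * (x' * y')"
    by (subst x'(1), subst y'(1)) (simp only: power_add mult_ac)
  moreover have "\<not> p dvd x' * y'" using x' y' p by (simp add: prime_elem_dvd_mult_iff)
  ultimately show ?thesis using p by (rule_tac mult_of_eqI)
qed

lemma mult_of_not_dvd:
  fixes p :: "('v::linorder \<Rightarrow>\<^sub>0 nat) \<Rightarrow>\<^sub>0 'k::field"
  shows "prime_elem p \<Longrightarrow> \<not> p dvd y \<Longrightarrow> mult_of p y = 0"
  by (rule mult_of_eqI[where y = y]) auto

lemma dvd_mult_of_pos:
  fixes p :: "('v::linorder \<Rightarrow>\<^sub>0 nat) \<Rightarrow>\<^sub>0 'k::field"
  assumes "prime_elem p" "y \<noteq> 0" shows "p dvd y \<longleftrightarrow> mult_of p y > 0"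
proof
  assume "p dvd y"
  then obtain z where z: "y = p * z" ..
  have "p \<noteq> 0" using assms by (simp add: prime_elem_def)
  have "mult_of p p = 1" using assms by (intro mult_of_eqI[where y = 1]) (auto simp: prime_elem_def)
  then show "mult_of p y > 0" using z assms \<open>p \<noteq> 0\<close> by (simp add: mult_of_mult)
qed (use mult_of_not_dvd[OF assms(1)] in force)

text \<open>\<open>prime_div\<close> asks for irreducibility, but additivity of multiplicities needs
  primality; unique factorization enters here.\<close>

lemma prime_div_prime_elem: "prime_div h \<Longrightarrow> prime_elem h"
  unfolding prime_div_def by (blast intro: irreducible_imp_prime_elem_mpoly)

text \<open>The definite description in \<open>ord\<close> is well defined: two representations give
  \<open>P * Q' = P' * Q\<close>, and additivity of \<open>mult_of\<close> equates the
  differences.\<close>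

lemma ord_Fract:
  assumes h: "prime_elem h" and PQ: "P \<noteq> 0" "Q \<noteq> 0"
  shows "ord h (Fract P Q) = int (mult_of h P) - int (mult_of h Q)"
  unfolding ord_def
proof (rule the_equality)
  fix z assume "\<exists>P' Q'. P' \<noteq> 0 \<and> Q' \<noteq> 0 \<and> Fract P Q = Fract P' Q' \<and>
                         z = int (mult_of h P') - int (mult_of h Q')"
  then obtain P' Q' where *: "P' \<noteq> 0" "Q' \<noteq> 0" "Fract P Q = Fract P' Q'"
    "z = int (mult_of h P') - int (mult_of h Q')" by blast
  then have "P * Q' = P' * Q" using PQ by (simp add: eq_fract)
  then have "mult_of h (P * Q') = mult_of h (P' * Q)" by simp
  then show "z = int (mult_of h P) - int (mult_of h Q)" using * PQ h by (simp add: mult_of_mult)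
qed (use PQ in blast)

lemma Fract_nonzero_cases:
  assumes "g \<noteq> 0"
  obtains P Q where "g = Fract P Q" "P \<noteq> 0" "Q \<noteq> 0"
  using assms by (cases g rule: Fract_cases_nonzero) auto

lemma ord_mult:
  assumes h: "prime_elem h" and g: "g1 \<noteq> 0" "g2 \<noteq> 0"
  shows "ord h (g1 * g2) = ord h g1 + ord h g2"
proof -
  obtain P1 Q1 P2 Q2 where "g1 = Fract P1 Q1" "P1 \<noteq> 0" "Q1 \<noteq> 0" "g2 = Fract P2 Q2" "P2 \<noteq> 0" "Q2 \<noteq> 0"
    using g by (metis Fract_nonzero_cases)
  then show ?thesis using h by (simp add: ord_Fract mult_of_mult)
qed

lemma ord_one: "prime_elem h \<Longrightarrow> ord h 1 = 0"
  by (simp add: One_fract_def ord_Fract)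

lemma ord_power: "prime_elem h \<Longrightarrow> g \<noteq> 0 \<Longrightarrow> ord h (g ^ k) = int k * ord h g"
  by (induction k) (simp_all add: ord_one ord_mult algebra_simps)

lemma ord_inverse:
  assumes h: "prime_elem h" and g: "g \<noteq> 0"
  shows "ord h (inverse g) = - ord h g"
  using ord_mult[OF h g, of "inverse g"] g h by (simp add: ord_one)

lemma ord_power_int: "prime_elem h \<Longrightarrow> g \<noteq> 0 \<Longrightarrow> ord h (g powi k) = k * ord h g"
  by (cases "k \<ge> 0") (simp_all add: power_int_def ord_power ord_inverse)

lemma ord_prod:
  assumes h: "prime_elem h"
  shows "(\<And>x. x \<in> A \<Longrightarrow> w x \<noteq> 0) \<Longrightarrow> ord h (prod w A) = (\<Sum>x\<in>A. ord h (w x))"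
  by (induction A rule: infinite_finite_induct) (simp_all add: ord_one ord_mult h)

text \<open>Irreducible factors of \<open>Q\<close> are cancelled one at a time. Orders are
  controlled only along homogeneous primes, which suffices because every factor of the homogeneous
  \<open>Q\<close> is homogeneous.\<close>

lemma dvd_of_ord_nonneg:
  fixes P Q :: "('n::{finite,linorder} \<Rightarrow>\<^sub>0 nat) \<Rightarrow>\<^sub>0 'k::field"
  assumes "Q \<noteq> 0" "homog_of e Q" "P \<noteq> 0" "\<And>h. prime_div h \<Longrightarrow> ord h (Fract P Q) \<ge> 0"
  shows "Q dvd P"
  using assms
proof (induction "degree (grade Q)" arbitrary: P Q e rule: less_induct)
  case less
  show ?case
  proof (cases "Q dvd 1")
    case True
    then show ?thesis by (metis dvd_trans one_dvd)
  next
    case False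
    then obtain p where p: "irreducible p" "p dvd Q"
      using ex_irreducible_factor_mpoly less.prems by blast
    then obtain Q' where Q': "Q = p * Q'" by (auto elim: dvdE)
    have "\<exists>i. homog_of i p" using homog_of_factor less.prems Q' by blast
    then have pd: "prime_div p" using p by (auto simp: prime_div_def homogeneous_def)
    note pe = prime_div_prime_elem[OF pd]
    have "mult_of p Q > 0" using p(2) dvd_mult_of_pos[OF pe less.prems(1)] by simp
    then have "mult_of p P > 0"
      using less.prems(4)[OF pd] ord_Fract[OF pe less.prems(3,1)] by simp
    then obtain P' where P': "P = p * P'" using dvd_mult_of_pos[OF pe less.prems(3)] by (auto elim: dvdE)
    have nz: "p \<noteq> 0" "Q' \<noteq> 0" "P' \<noteq> 0" using Q' P' less.prems by auto
    have "\<not> p dvd 1" using p by (simp add: irreducible_def)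
    then have deg: "degree (grade Q') < degree (grade Q)"
      using Q' nz degree_grade_pos[of p] by (simp add: degree_grade_mult)
    obtain e' where e': "homog_of e' Q'"
      using homog_of_factor[of e Q' p] less.prems Q' by (auto simp: mult.commute)
    have "Fract P Q = Fract P' Q'" using nz unfolding P' Q' by (simp add: eq_fract)
    then have "Q' dvd P'" using less.hyps[OF deg nz(2) e' nz(3)] less.prems(4) by simp
    then show ?thesis unfolding P' Q' by (rule mult_dvd_mono[OF dvd_refl])
  qed
qed

section \<open>Linear changes of coordinates\<close>

lemma (in eval_hom) ev_ev:
  "ev \<kappa> \<eta> (ev mconst \<zeta> P) = ev \<kappa> (\<lambda>i. ev \<kappa> \<eta> (\<zeta> i)) P"
  by (simp add: ev_def[of mconst] ev_sum ev_mult ev_mconst ev_mexp)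
    (simp add: ev_def)

lemmas mc_mult = eval_hom.ev_mult[OF mconst_hom]
  and mc_diff = eval_hom.ev_diff[OF mconst_hom]
  and mc_sum = eval_hom.ev_sum[OF mconst_hom]
  and mc_mconst = eval_hom.ev_mconst[OF mconst_hom]
  and mc_pvar = eval_hom.ev_pvar[OF mconst_hom]

lemma homog_of_ev_mconst:
  fixes \<eta> :: "'v \<Rightarrow> ('w \<Rightarrow>\<^sub>0 nat) \<Rightarrow>\<^sub>0 'k::comm_ring_1"
  assumes "\<And>i. homog_of 1 (\<eta> i)" "homog_of d P"
  shows "homog_of d (ev mconst \<eta> P)"
  unfolding ev_def
proof (intro homog_of_sum)
  fix \<mu> assume \<mu>: "\<mu> \<in> Poly_Mapping.keys P"
  have "homog_of (0 + mdeg \<mu>) (mconst (Poly_Mapping.lookup P \<mu>) * mexp \<eta> \<mu>)"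
    by (intro homog_of_mult homog_of_mconst homog_of_mexp assms)
  then show "homog_of d (mconst (Poly_Mapping.lookup P \<mu>) * mexp \<eta> \<mu>)"
    using assms(2) \<mu> by (simp add: homog_of_def)
qed

lemma mdeg_1_imp_single:
  assumes "mdeg \<mu> = 1" shows "\<exists>y. \<mu> = Poly_Mapping.single y 1"
proof -
  have "\<exists>y\<in>Poly_Mapping.keys \<mu>. Poly_Mapping.lookup \<mu> y = 1 \<and>
      (\<forall>z\<in>Poly_Mapping.keys \<mu>. y \<noteq> z \<longrightarrow> Poly_Mapping.lookup \<mu> z = 0)"
    using assms sum_eq_1_iff[OF finite_keys[of \<mu>], of "Poly_Mapping.lookup \<mu>"]
    by (simp only: mdeg_def)
  then obtain y where "y \<in> Poly_Mapping.keys \<mu>" "Poly_Mapping.lookup \<mu> y = 1"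
    "\<forall>z\<in>Poly_Mapping.keys \<mu>. y \<noteq> z \<longrightarrow> Poly_Mapping.lookup \<mu> z = 0" by blast
  then have "\<mu> = Poly_Mapping.single y 1"
    by (intro poly_mapping_eqI) (auto simp: lookup_single when_def in_keys_iff)
  then show ?thesis ..
qed

lemma homog_of_1_expand:
  fixes P :: "('v::finite \<Rightarrow>\<^sub>0 nat) \<Rightarrow>\<^sub>0 'k::comm_ring_1"
  assumes "homog_of 1 P"
  shows "P = (\<Sum>y\<in>UNIV. mconst (Poly_Mapping.lookup P (Poly_Mapping.single y 1)) * pvar y)"
proof (rule poly_mapping_eqI)
  fix \<mu>
  have eq: "mconst c * pvar y = Poly_Mapping.single (Poly_Mapping.single y (1::nat)) c" for c :: 'k and y :: 'v
    by (simp add: mconst_def pvar_def mult_single)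
  show "Poly_Mapping.lookup P \<mu> = Poly_Mapping.lookup (\<Sum>y\<in>UNIV. mconst (Poly_Mapping.lookup P (Poly_Mapping.single y 1)) * pvar y) \<mu>"
  proof (cases "\<exists>z. \<mu> = Poly_Mapping.single z 1")
    case True
    then obtain z where z: "\<mu> = Poly_Mapping.single z 1" ..
    have "Poly_Mapping.single y (1::nat) = Poly_Mapping.single z 1 \<longleftrightarrow> y = z" for y
      by (metis lookup_single_eq lookup_single_not_eq zero_neq_one)
    then show ?thesis by (simp add: eq lookup_sum lookup_single when_def z)
  next
    case False
    then have "\<mu> \<notin> Poly_Mapping.keys P"
      using mdeg_1_imp_single assms by (auto simp: homog_of_def)
    moreover have "Poly_Mapping.single y 1 \<noteq> \<mu>" for y using False by metis
    ultimately show ?thesis by (simp add: eq lookup_sum lookup_single when_def in_keys_iff)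
  qed
qed

lemma vector_space_mconst:
  "vector_space (\<lambda>(c::'k::field) P :: ('v::linorder \<Rightarrow>\<^sub>0 nat) \<Rightarrow>\<^sub>0 'k. mconst c * P)"
  by unfold_locales (simp_all add: mconst_def single_add mult_single algebra_simps)

text \<open>A dimension count: the forms lie in the span of the variables and are as many as these,
  so a variable outside their span would yield an independent set that is too large.\<close>

lemma linear_forms_span:
  fixes l :: "'v::{finite,linorder} \<Rightarrow> ('v \<Rightarrow>\<^sub>0 nat) \<Rightarrow>\<^sub>0 'k::field"
  assumes hom: "\<And>x. homog_of 1 (l x)"
    and indep: "\<And>c. (\<Sum>x\<in>UNIV. mconst (c x) * l x) = 0 \<Longrightarrow> c = (\<lambda>_. 0)"
  shows "\<exists>c. pvar y = (\<Sum>x\<in>UNIV. mconst (c x) * l x)"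
proof -
  interpret V: vector_space "\<lambda>(c::'k) P :: ('v \<Rightarrow>\<^sub>0 nat) \<Rightarrow>\<^sub>0 'k. mconst c * P"
    by (rule vector_space_mconst)
  have inj: "inj l"
  proof (rule injI, rule ccontr)
    fix x z assume xz: "l x = l z" "x \<noteq> z"
    let ?c = "\<lambda>w. if w = x then 1 else if w = z then -1 else (0::'k)"
    have "(\<Sum>w\<in>UNIV. mconst (?c w) * l w) = (\<Sum>w\<in>{x, z}. mconst (?c w) * l w)"
      by (intro sum.mono_neutral_right) (auto simp: mconst_def)
    also have "\<dots> = 0" using xz by (simp add: mconst_def single_uminus)
    finally have "?c = (\<lambda>_. 0)" by (rule indep)
    then have "?c x = 0" by metis
    then show False by simp
  qed
  have "V.independent (range l)"
  proof
    assume "V.dependent (range l)"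
    then obtain u where u: "\<exists>v\<in>range l. u v \<noteq> 0" "(\<Sum>v\<in>range l. mconst (u v) * v) = 0"
      using V.dependent_finite[of "range l"] by auto
    have "(\<Sum>x\<in>UNIV. mconst (u (l x)) * l x) = 0" using u(2) by (simp add: sum.reindex[OF inj] comp_def)
    then have "(\<lambda>x. u (l x)) = (\<lambda>_. 0)" by (rule indep)
    with u(1) show False by (metis rangeE)
  qed
  have l_span: "l x \<in> V.span (range pvar)" for x
    by (subst homog_of_1_expand[OF hom], rule V.span_sum, rule V.span_scale, rule V.span_base) simp
  have "pvar y \<in> V.span (range l)"
  proof (rule ccontr)
    assume y: "pvar y \<notin> V.span (range l)"
    then have ind: "V.independent (insert (pvar y) (range l))"
      using \<open>V.independent (range l)\<close> by (simp add: V.independent_insert)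
    have sub: "insert (pvar y) (range l) \<subseteq> V.span (range pvar)"
      using l_span by (auto intro: V.span_base)
    have "card (insert (pvar y) (range l)) \<le> card (range (pvar :: 'v \<Rightarrow> ('v \<Rightarrow>\<^sub>0 nat) \<Rightarrow>\<^sub>0 'k))"
      by (rule conjunct2[OF V.independent_span_bound[OF _ ind sub]]) simp
    also have "\<dots> \<le> card (UNIV :: 'v set)" by (rule card_image_le) simp
    also have "card (UNIV :: 'v set) = card (range l)" using inj by (simp add: card_image)
    finally have "card (insert (pvar y) (range l)) \<le> card (range l)" .
    moreover have "pvar y \<notin> range l" using y V.span_base by blast
    ultimately show False by simp
  qed
  then obtain u where "pvar y = (\<Sum>v\<in>range l. mconst (u v) * v)"
    using V.span_finite[of "range l"] by auto
  then have "pvar y = (\<Sum>x\<in>UNIV. mconst (u (l x)) * l x)"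
    by (simp add: sum.reindex[OF inj] comp_def)
  then show ?thesis by (intro exI[of _ "\<lambda>x. u (l x)"])
qed

lemma linear_forms_coordinates:
  fixes l :: "'v::{finite,linorder} \<Rightarrow> ('v \<Rightarrow>\<^sub>0 nat) \<Rightarrow>\<^sub>0 'k::field"
  assumes hom: "\<And>x. homog_of 1 (l x)"
    and indep: "\<And>c. (\<Sum>x\<in>UNIV. mconst (c x) * l x) = 0 \<Longrightarrow> c = (\<lambda>_. 0)"
  obtains \<zeta> where "\<And>x. homog_of 1 (\<zeta> x)" "\<And>P. ev mconst l (ev mconst \<zeta> P) = P"
    "\<And>P. ev mconst \<zeta> (ev mconst l P) = P"
proof -
  have "\<forall>y. \<exists>c. pvar y = (\<Sum>x\<in>UNIV. mconst (c x) * l x)"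
    by (intro allI linear_forms_span hom indep)
  from choice[OF this] obtain c where c: "\<And>y. pvar y = (\<Sum>x\<in>UNIV. mconst (c y x) * l x)" by blast
  define \<zeta> where "\<zeta> = (\<lambda>y. \<Sum>x\<in>UNIV. mconst (c y x) * pvar x)"
  have hom\<zeta>: "homog_of 1 (\<zeta> y)" for y unfolding \<zeta>_def
    using homog_of_mult[OF homog_of_mconst homog_of_pvar] by (intro homog_of_sum) simp
  have "ev mconst l (\<zeta> y) = pvar y" for y
    unfolding \<zeta>_def by (simp add: mc_sum mc_mult mc_mconst mc_pvar flip: c)
  then have lz: "ev mconst l (ev mconst \<zeta> P) = P" for P
    by (simp add: eval_hom.ev_ev[OF mconst_hom] ev_mconst_pvar)
  have "ev mconst \<zeta> (l x) = pvar x" for x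
  proof -
    \<comment> \<open>\<open>\<zeta>\<close> is a right inverse by construction only. For the other
      composite, the difference \<open>w\<close> is a linear form that vanishes after substituting
      \<open>l\<close>, so independence kills its coefficients.\<close>
    define w where "w = ev mconst \<zeta> (l x) - pvar x"
    have "homog_of 1 (ev mconst \<zeta> (l x))" by (intro homog_of_ev_mconst hom hom\<zeta>)
    moreover have "homog_of 1 (- pvar x :: ('v \<Rightarrow>\<^sub>0 nat) \<Rightarrow>\<^sub>0 'k)"
      using homog_of_pvar by (simp add: homog_of_def)
    ultimately have "homog_of 1 (ev mconst \<zeta> (l x) + - pvar x)" by (rule homog_of_add)
    then have "homog_of 1 w" by (simp add: w_def)
    note w = homog_of_1_expand[OF this]
    have "ev mconst l w = 0" unfolding w_def by (simp add: mc_diff lz mc_pvar)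
    then have "(\<Sum>y\<in>UNIV. mconst (Poly_Mapping.lookup w (Poly_Mapping.single y 1)) * l y) = 0"
      by (subst (asm) w) (simp add: mc_sum mc_mult mc_mconst mc_pvar)
    then have "(\<lambda>y. Poly_Mapping.lookup w (Poly_Mapping.single y 1)) = (\<lambda>_. 0)" by (rule indep)
    then have "w = 0" by (subst w) (simp add: fun_eq_iff mconst_def)
    then show ?thesis by (simp add: w_def)
  qed
  then have "ev mconst \<zeta> (ev mconst l P) = P" for P
    by (simp add: eval_hom.ev_ev[OF mconst_hom] ev_mconst_pvar)
  with hom\<zeta> lz show ?thesis by (rule that)
qed

section \<open>Global sections\<close>

text \<open>\<open>\<sigma>\<close> indexes the chosen linear forms by the variable type itself, so
  that they can be substituted for the variables.\<close>

locale qdivisor =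
  fixes f :: "nat \<Rightarrow> ('n::{finite,linorder} \<Rightarrow>\<^sub>0 nat) \<Rightarrow>\<^sub>0 'k::field"
    and \<alpha> :: "nat \<Rightarrow> rat" and a :: "nat \<Rightarrow> nat" and n :: nat and \<sigma> :: "'n \<Rightarrow> nat"
  assumes f_irred: "i \<le> n \<Longrightarrow> irreducible (f i)"
    and f_homog: "i \<le> n \<Longrightarrow> homog_of (a i) (f i)"
    and f_distinct: "i \<le> n \<Longrightarrow> j \<le> n \<Longrightarrow> i \<noteq> j \<Longrightarrow> \<not> (f i dvd f j \<and> f j dvd f i)"
    and degD_pos: "(\<Sum>i\<le>n. \<alpha> i * of_nat (a i)) > 0"
    and \<sigma>_inj: "inj \<sigma>" and \<sigma>_le: "\<sigma> x \<le> n" and a_\<sigma>: "a (\<sigma> x) = 1"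
    and \<sigma>_indep: "(\<Sum>x\<in>UNIV. mconst (c x) * f (\<sigma> x)) = 0 \<Longrightarrow> c = (\<lambda>_. 0)"
begin

lemma f_nz: "i \<le> n \<Longrightarrow> f i \<noteq> 0"
  using f_irred by (auto simp: irreducible_def)

lemma a_pos: assumes i: "i \<le> n" shows "a i > 0"
proof (rule ccontr)
  assume "\<not> ?thesis"
  then have "f i dvd 1" using homog_of_0_dvd_1 f_homog[OF i] f_nz[OF i] by simp
  then show False using f_irred[OF i] by (simp add: irreducible_def)
qed

definition f_frac :: "nat \<Rightarrow> (('n \<Rightarrow>\<^sub>0 nat) \<Rightarrow>\<^sub>0 'k) fract" where
  "f_frac i = Fract (f i) 1"

definition mon :: "(nat \<Rightarrow> int) \<Rightarrow> (('n \<Rightarrow>\<^sub>0 nat) \<Rightarrow>\<^sub>0 'k) fract" where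
  "mon c = (\<Prod>i\<le>n. f_frac i powi c i)"

definition floor_coeff :: "nat \<Rightarrow> nat \<Rightarrow> int" where
  "floor_coeff d i = \<lfloor>of_nat d * \<alpha> i\<rfloor>"

definition floor_div :: "nat \<Rightarrow> (('n \<Rightarrow>\<^sub>0 nat) \<Rightarrow>\<^sub>0 'k) \<Rightarrow> int" where
  "floor_div d h = \<lfloor>of_nat d * Qdiv n f \<alpha> h\<rfloor>"

lemma f_frac_nz: "i \<le> n \<Longrightarrow> f_frac i \<noteq> 0"
  using f_nz by (simp add: f_frac_def Zero_fract_def eq_fract)

lemma mon_nz: "mon c \<noteq> 0"
  by (simp add: mon_def f_frac_nz)

lemma mon_add: "mon (\<lambda>i. c i + c' i) = mon c * mon c'"
  unfolding mon_def by (simp add: power_int_add f_frac_nz flip: prod.distrib)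

lemma mon_zero: "mon (\<lambda>_. 0) = 1"
  by (simp add: mon_def)

lemma mon_uminus_mult: "mon c * mon (\<lambda>i. - c i) = 1"
  by (simp add: mon_zero flip: mon_add)

lemma mon_cong: "(\<And>i. i \<le> n \<Longrightarrow> c i = c' i) \<Longrightarrow> mon c = mon c'"
  unfolding mon_def by (intro prod.cong) auto

lemma ord_f_frac:
  assumes h: "prime_div h" and i: "i \<le> n"
  shows "ord h (f_frac i) = (if h dvd f i \<and> f i dvd h then 1 else 0)"
proof -
  note pe = prime_div_prime_elem[OF h]
  have nu: "\<not> h dvd 1" "h \<noteq> 0" using pe by (auto simp: prime_elem_def)
  have ord: "ord h (f_frac i) = int (mult_of h (f i))"
    using nu f_nz[OF i] mult_of_not_dvd[OF pe nu(1)] by (simp add: f_frac_def ord_Fract[OF pe])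
  show ?thesis
  proof (cases "h dvd f i \<and> f i dvd h")
    case True
    then obtain u w where uw: "f i = h * u" "h = f i * w" by (auto elim!: dvdE)
    then have "h * (u * w) = h * 1" by (simp add: mult_ac)
    then have "u * w = 1" using nu by (simp only: mult_left_cancel simp_thms)
    then have "u dvd 1" by (metis dvd_triv_left)
    then have "\<not> h dvd u" using nu by (metis dvd_trans)
    then have "mult_of h (f i) = 1" using uw(1) pe by (intro mult_of_eqI[where y = u]) auto
    then show ?thesis using True ord by simp
  next
    case False
    have "\<not> h dvd f i"
    proof
      assume "h dvd f i"
      then obtain w where w: "f i = h * w" ..
      then have "w dvd 1" using f_irred[OF i] nu by (auto simp: irreducible_def)
      then have "f i dvd h" unfolding w by (metis dvd_refl mult.right_neutral mult_dvd_mono)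
      with \<open>h dvd f i\<close> False show False by simp
    qed
    then show ?thesis using ord mult_of_not_dvd[OF pe] by auto
  qed
qed

lemma ord_mon:
  assumes h: "prime_div h"
  shows "ord h (mon c) = (\<Sum>i\<in>{i. i \<le> n \<and> h dvd f i \<and> f i dvd h}. c i)"
proof -
  note pe = prime_div_prime_elem[OF h]
  have "ord h (mon c) = (\<Sum>i\<le>n. if h dvd f i \<and> f i dvd h then c i else 0)"
    unfolding mon_def by (subst ord_prod[OF pe])
      (auto intro!: sum.cong simp: f_frac_nz ord_power_int[OF pe] ord_f_frac[OF h])
  also have "\<dots> = (\<Sum>i\<in>{i\<in>{..n}. h dvd f i \<and> f i dvd h}. c i)"
    by (rule sum.inter_filter[symmetric]) simp
  also have "{i\<in>{..n}. h dvd f i \<and> f i dvd h} = {i. i \<le> n \<and> h dvd f i \<and> f i dvd h}" by auto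
  finally show ?thesis .
qed

text \<open>Rounding does not commute with sums in general; here distinctness of the divisors leaves
  at most one index in the sum.\<close>

lemma floor_div_eq: "floor_div d h = (\<Sum>i\<in>{i. i \<le> n \<and> h dvd f i \<and> f i dvd h}. floor_coeff d i)"
proof (cases "{i. i \<le> n \<and> h dvd f i \<and> f i dvd h} = {}")
  case True
  then show ?thesis unfolding floor_div_def Qdiv_def True by simp
next
  case False
  then obtain i where i: "i \<le> n" "h dvd f i" "f i dvd h" by blast
  have "j = i" if "j \<le> n" "h dvd f j" "f j dvd h" for j
    using f_distinct[of i j] i that dvd_trans by blast
  then have "{i. i \<le> n \<and> h dvd f i \<and> f i dvd h} = {i}" using i by blast
  then show ?thesis unfolding floor_div_def Qdiv_def by (simp add: floor_coeff_def)
qed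

lemma mon_Fract:
  "\<exists>A B p q. A \<noteq> 0 \<and> B \<noteq> 0 \<and> homog_of p A \<and> homog_of q B \<and> mon c = Fract A B \<and>
     int p - int q = (\<Sum>i\<le>n. int (a i) * c i)"
proof -
  \<comment> \<open>Since \<open>nat\<close> truncates at 0, \<open>A\<close> collects the positive
    exponents and \<open>B\<close> the negative ones.\<close>
  define A where "A = (\<Prod>i\<le>n. f i ^ nat (c i))"
  define B where "B = (\<Prod>i\<le>n. f i ^ nat (- c i))"
  have nz: "A \<noteq> 0" "B \<noteq> 0" using f_nz by (simp_all add: A_def B_def)
  have fr_mult: "Fract (x * y) 1 = Fract x 1 * Fract y 1" for x y :: "('n \<Rightarrow>\<^sub>0 nat) \<Rightarrow>\<^sub>0 'k"
    by simp
  have to: "Fract (\<Prod>i\<in>S. h i) 1 = (\<Prod>i\<in>S. Fract (h i) 1)" for S and h :: "nat \<Rightarrow> ('n \<Rightarrow>\<^sub>0 nat) \<Rightarrow>\<^sub>0 'k"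
    by (induction S rule: infinite_finite_induct) (simp_all add: One_fract_def fr_mult del: mult_fract)
  have pow: "Fract (h ^ k) 1 = Fract h 1 ^ k" for h :: "('n \<Rightarrow>\<^sub>0 nat) \<Rightarrow>\<^sub>0 'k" and k
    by (induction k) (simp_all add: One_fract_def fr_mult del: mult_fract)
  have "f_frac i powi c i = f_frac i ^ nat (c i) / f_frac i ^ nat (- c i)" for i
    by (cases "c i \<ge> 0") (simp_all add: power_int_def divide_inverse power_inverse)
  then have "mon c = (\<Prod>i\<le>n. f_frac i ^ nat (c i)) / (\<Prod>i\<le>n. f_frac i ^ nat (- c i))"
    by (simp add: mon_def prod_dividef)
  also have "\<dots> = Fract A 1 / Fract B 1" by (simp add: A_def B_def to pow f_frac_def)
  finally have mon: "mon c = Fract A B" by simp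
  have hA: "homog_of (\<Sum>i\<le>n. nat (c i) * a i) A" unfolding A_def
    by (intro homog_of_prod homog_of_power f_homog) simp
  have hB: "homog_of (\<Sum>i\<le>n. nat (- c i) * a i) B" unfolding B_def
    by (intro homog_of_prod homog_of_power f_homog) simp
  have "int (\<Sum>i\<le>n. nat (c i) * a i) - int (\<Sum>i\<le>n. nat (- c i) * a i) =
    (\<Sum>i\<le>n. (int (nat (c i)) - int (nat (- c i))) * int (a i))"
    by (simp add: left_diff_distrib sum_subtractf)
  also have "\<dots> = (\<Sum>i\<le>n. int (a i) * c i)" by (intro sum.cong) auto
  finally show ?thesis using nz mon hA hB by blast
qed

text \<open>Multiplying a section by the product of the \<open>f i\<close> to the powers
  \<open>floor_coeff d i\<close> clears every permitted pole, which leaves a form of the degree of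
  the rounded divisor. The alternative \<open>G = 0\<close> is separate because the zero polynomial
  is homogeneous of every degree.\<close>

lemma H0_eq:
  "H0 (floor_div d) = {Fract G 1 * mon (\<lambda>i. - floor_coeff d i) | G e. homog_of e G \<and>
     (G = 0 \<or> int e = (\<Sum>i\<le>n. int (a i) * floor_coeff d i))}"
proof (intro equalityI subsetI)
  fix g assume g: "g \<in> H0 (floor_div d)"
  show "g \<in> {Fract G 1 * mon (\<lambda>i. - floor_coeff d i) | G e. homog_of e G \<and>
     (G = 0 \<or> int e = (\<Sum>i\<le>n. int (a i) * floor_coeff d i))}"
  proof (cases "g = 0")
    case True
    then show ?thesis by (auto simp: Zero_fract_def[symmetric] intro!: exI[of _ 0])
  next
    case False
    with g have rat: "rat_fun g" and ord: "\<And>h. prime_div h \<Longrightarrow> ord h g + floor_div d h \<ge> 0"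
      by (auto simp: H0_def)
    obtain P Q e where PQ: "Q \<noteq> 0" "homog_of e P" "homog_of e Q" "g = Fract P Q"
      using rat by (auto simp: rat_fun_def)
    then have P: "P \<noteq> 0" using False by (auto simp: Zero_fract_def eq_fract)
    obtain A B p q where AB: "A \<noteq> 0" "B \<noteq> 0" "homog_of p A" "homog_of q B" "mon (floor_coeff d) = Fract A B"
      "int p - int q = (\<Sum>i\<le>n. int (a i) * floor_coeff d i)" using mon_Fract by blast
    have Y: "g * mon (floor_coeff d) = Fract (P * A) (Q * B)" using PQ AB by simp
    \<comment> \<open>\<open>mon (floor_coeff d)\<close> has order exactly
      \<open>floor_div d h\<close> along each \<open>h\<close>.\<close>
    have "ord h (Fract (P * A) (Q * B)) \<ge> 0" if h: "prime_div h" for h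
      using ord[OF h] ord_mult[OF prime_div_prime_elem[OF h] False mon_nz[of "floor_coeff d"]]
        ord_mon[OF h, of "floor_coeff d"] floor_div_eq[of d h] Y by simp
    then have "Q * B dvd P * A"
      using PQ AB P homog_of_mult[OF PQ(3) AB(4)] by (intro dvd_of_ord_nonneg) auto
    then obtain G where G: "P * A = G * (Q * B)" by (metis dvdE mult.commute)
    have hom: "homog_of (e + p) (G * (Q * B))" using homog_of_mult[OF PQ(2) AB(3)] G by simp
    moreover have "G * (Q * B) \<noteq> 0" using G P AB by (metis mult_eq_0_iff)
    ultimately have Gh: "e + q \<le> e + p" "homog_of (e + p - (e + q)) G"
      using homog_of_quotient[OF _ _ homog_of_mult[OF PQ(3) AB(4)]] by blast+
    have "g * mon (floor_coeff d) = Fract G 1" unfolding Y G using PQ AB by (simp add: eq_fract)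
    then have "Fract G 1 * mon (\<lambda>i. - floor_coeff d i) = g * (mon (floor_coeff d) * mon (\<lambda>i. - floor_coeff d i))"
      by (simp add: mult.assoc)
    then have "g = Fract G 1 * mon (\<lambda>i. - floor_coeff d i)" by (simp only: mon_uminus_mult mult_1_right)
    then show ?thesis using Gh AB(6) by force
  qed
next
  fix g assume "g \<in> {Fract G 1 * mon (\<lambda>i. - floor_coeff d i) | G e. homog_of e G \<and>
     (G = 0 \<or> int e = (\<Sum>i\<le>n. int (a i) * floor_coeff d i))}"
  then obtain G e where G: "g = Fract G 1 * mon (\<lambda>i. - floor_coeff d i)" "homog_of e G"
    "G = 0 \<or> int e = (\<Sum>i\<le>n. int (a i) * floor_coeff d i)" by blast
  show "g \<in> H0 (floor_div d)"
  proof (cases "G = 0")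
    case True
    then show ?thesis using G by (simp add: H0_def Zero_fract_def[symmetric])
  next
    case False
    obtain A B p q where AB: "A \<noteq> 0" "B \<noteq> 0" "homog_of p A" "homog_of q B" "mon (\<lambda>i. - floor_coeff d i) = Fract A B"
      "int p - int q = (\<Sum>i\<le>n. int (a i) * - floor_coeff d i)" using mon_Fract by blast
    have "int e + int p = int q" using G(3) False AB(6) by (simp add: sum_negf)
    then have "homog_of q (G * A)" using homog_of_mult[OF G(2) AB(3)] by (simp flip: of_nat_add)
    moreover have "g = Fract (G * A) B" using G AB by simp
    ultimately have rat: "rat_fun g" unfolding rat_fun_def using AB by blast
    have "ord h g + floor_div d h \<ge> 0" if h: "prime_div h" for h
    proof -
      note pe = prime_div_prime_elem[OF h]
      have "\<not> h dvd 1" using pe by (simp add: prime_elem_def)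
      then have "ord h (Fract G 1) \<ge> 0" using False mult_of_not_dvd[OF pe] by (simp add: ord_Fract[OF pe])
      moreover have "Fract G 1 \<noteq> 0" using False by (simp add: Zero_fract_def eq_fract)
      ultimately show ?thesis
        using G(1) ord_mult[OF pe _ mon_nz[of "\<lambda>i. - floor_coeff d i"]] ord_mon[OF h, of "\<lambda>i. - floor_coeff d i"] floor_div_eq[of d h]
        by (simp add: sum_negf)
    qed
    then show ?thesis using rat by (simp add: H0_def)
  qed
qed

end

section \<open>The semigroup of exponents\<close>

context qdivisor
begin

definition degD :: rat where
  "degD = (\<Sum>i\<le>n. \<alpha> i * of_nat (a i))"

lemma degD_gt_0: "degD > 0"
  using degD_pos by (simp add: degD_def)

abbreviation el :: "nat \<Rightarrow> int" where
  "el j \<equiv> ell n \<alpha> j"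

lemma den_pos: "den \<alpha> i > 0"
  unfolding den_def by (rule quotient_of_denom_pos'[unfolded])

lemma el_pos: "el j > 0"
proof -
  have "den \<alpha> i \<noteq> 0" for i using den_pos[of i] by simp
  then have "el j \<noteq> 0" unfolding ell_def by (subst Lcm_0_iff) auto
  moreover have "el j \<ge> 0" unfolding ell_def by simp
  ultimately show ?thesis by simp
qed

lemma el_integral:
  assumes "i \<le> n" "i \<noteq> j" shows "of_int (el j) * \<alpha> i \<in> \<int>"
proof -
  obtain p q where pq: "quotient_of (\<alpha> i) = (p, q)" by fastforce
  have q: "den \<alpha> i = q" using pq by (simp add: den_def)
  have "den \<alpha> i dvd el j" unfolding ell_def using assms by (intro dvd_Lcm) auto
  then obtain k where k: "el j = q * k" using q by (auto elim: dvdE)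
  have "q \<noteq> 0" using den_pos[of i] q by simp
  then have "of_int (el j) * \<alpha> i = of_int (k * p)"
    using quotient_of_div[OF pq] k by simp
  then show ?thesis by simp
qed

definition ray_sum :: int where
  "ray_sum = (\<Sum>i\<le>n. el i * int (a i))"

definition ray_deg :: "nat \<Rightarrow> nat" where
  "ray_deg j = nat (el j) * a j"

text \<open>Zero slack in degree \<open>ray_deg j\<close> forces the entries with \<open>i\<close>
  different from \<open>j\<close>, and the vanishing weighted sum forces the entry at
  \<open>j\<close>. The floors merely convert to type \<open>int\<close>; for
  \<open>j \<le> n\<close> the rationals inside are integers.\<close>

definition ray_exp :: "nat \<Rightarrow> nat \<Rightarrow> int" where
  "ray_exp j i = (if i \<le> n then
     if i = j then \<lfloor>of_int (el j) * (degD - \<alpha> j * of_nat (a j))\<rfloor> else \<lfloor>- (of_nat (ray_deg j) * \<alpha> i)\<rfloor> else 0)"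

definition slack :: "nat \<times> (nat \<Rightarrow> int) \<Rightarrow> nat \<Rightarrow> rat" where
  "slack s i = of_int (snd s i) + of_nat (fst s) * \<alpha> i"

text \<open>For \<open>q = 0\<close> these are the exponents of the monomials spanning the section ring; the sets with
  \<open>q = a i\<close> index the relations that eliminate \<open>f i\<close>.\<close>

definition expo :: "nat \<Rightarrow> (nat \<times> (nat \<Rightarrow> int)) set" where
  "expo q = {s. (\<forall>i>n. snd s i = 0) \<and> (\<Sum>i\<le>n. int (a i) * snd s i) = - int q \<and> (\<forall>i\<le>n. slack s i \<ge> 0)}"

definition sadd :: "nat \<times> (nat \<Rightarrow> int) \<Rightarrow> nat \<times> (nat \<Rightarrow> int) \<Rightarrow> nat \<times> (nat \<Rightarrow> int)" where
  "sadd s t = (fst s + fst t, \<lambda>i. snd s i + snd t i)"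

definition ray_red_comb :: "(nat \<Rightarrow> nat) \<Rightarrow> nat \<times> (nat \<Rightarrow> int)" where
  "ray_red_comb m = (\<Sum>j\<le>n. m j * ray_deg j, \<lambda>i. \<Sum>j\<le>n. int (m j) * ray_exp j i)"

text \<open>The j-th ray has slack \<open>el j * degD\<close> at \<open>j\<close> and 0 elsewhere,
  so the quotient is the coordinate of \<open>s\<close> along that ray and its floor counts the
  whole rays that can be removed.\<close>

definition ray_mult :: "nat \<times> (nat \<Rightarrow> int) \<Rightarrow> nat \<Rightarrow> nat" where
  "ray_mult s j = nat \<lfloor>slack s j / (of_int (el j) * degD)\<rfloor>"

definition box_part :: "nat \<times> (nat \<Rightarrow> int) \<Rightarrow> nat \<times> (nat \<Rightarrow> int)" where
  "box_part s = (fst s - fst (ray_red_comb (ray_mult s)), \<lambda>i. snd s i - snd (ray_red_comb (ray_mult s)) i)"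

lemma ray_sum_pos: "ray_sum > 0"
  unfolding ray_sum_def using el_pos a_pos by (intro sum_pos) auto

lemma ray_deg_le: assumes j: "j \<le> n" shows "int (ray_deg j) \<le> ray_sum"
proof -
  have "int (ray_deg j) = el j * int (a j)" using el_pos[of j] by (simp add: ray_deg_def)
  also have "\<dots> \<le> ray_sum" unfolding ray_sum_def using j el_pos[THEN less_imp_le]
    by (intro member_le_sum) auto
  finally show ?thesis .
qed

lemma of_nat_ray_deg: "of_nat (ray_deg j) = (of_int (el j) * of_nat (a j) :: rat)"
  using el_pos[of j] by (simp add: ray_deg_def)

text \<open>The floors are exact because \<open>el j\<close> clears the denominators of all
  \<alpha>_i with \<open>i\<close> different from \<open>j\<close>; the entry at \<open>j\<close> is
  \<open>el j\<close> times a sum over those same indices.\<close>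

lemma of_int_ray_exp:
  assumes "i \<le> n" "j \<le> n"
  shows "of_int (ray_exp j i) = (if i = j then of_int (el j) * (degD - \<alpha> j * of_nat (a j)) else - (of_nat (ray_deg j) * \<alpha> i))"
proof (cases "i = j")
  case True
  have "degD - \<alpha> j * of_nat (a j) = (\<Sum>i\<in>{..n} - {j}. \<alpha> i * of_nat (a i))"
    unfolding degD_def using assms by (subst sum.remove[of _ j]) auto
  then have "of_int (el j) * (degD - \<alpha> j * of_nat (a j)) = (\<Sum>i\<in>{..n} - {j}. (of_int (el j) * \<alpha> i) * of_nat (a i))"
    by (simp add: sum_distrib_left mult.assoc)
  also have "\<dots> \<in> \<int>" by (intro Ints_sum Ints_mult el_integral) auto
  finally show ?thesis using True assms by (auto simp: ray_exp_def elim!: Ints_cases)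
next
  case False
  have "of_nat (ray_deg j) * \<alpha> i = of_nat (a j) * (of_int (el j) * \<alpha> i)" by (simp add: of_nat_ray_deg)
  also have "\<dots> \<in> \<int>" using assms False by (intro Ints_mult el_integral) auto
  finally have "- (of_nat (ray_deg j) * \<alpha> i) \<in> \<int>" by simp
  then show ?thesis using False assms by (auto simp: ray_exp_def elim!: Ints_cases)
qed

lemma slack_ray_exp:
  assumes "i \<le> n" "j \<le> n"
  shows "slack (ray_deg j, ray_exp j) i = (if i = j then of_int (el j) * degD else 0)"
  using assms by (simp add: slack_def of_int_ray_exp) (simp add: of_nat_ray_deg algebra_simps)

text \<open>The weighted sum of the exponents is fixed at \<open>- q\<close>, so summing the slacks
  with weights \<open>a i\<close> leaves the degree alone. Bounds on slacks become bounds on degrees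
  through this identity.\<close>

lemma degree_slack:
  "s \<in> expo q \<Longrightarrow> of_nat (fst s) * degD = of_nat q + (\<Sum>i\<le>n. of_nat (a i) * slack s i)"
proof -
  assume s: "s \<in> expo q"
  have "(\<Sum>i\<le>n. of_nat (a i) * slack s i) = of_int (\<Sum>i\<le>n. int (a i) * snd s i) + of_nat (fst s) * degD"
    by (simp add: slack_def degD_def distrib_left sum.distrib sum_distrib_left mult_ac)
  moreover have "(\<Sum>i\<le>n. int (a i) * snd s i) = - int q" using s by (simp add: expo_def)
  ultimately show ?thesis by (simp only: of_int_minus of_int_of_nat_eq)
qed

lemma ray_exp_sum: assumes j: "j \<le> n" shows "(\<Sum>i\<le>n. int (a i) * ray_exp j i) = 0"
proof -
  \<comment> \<open>The weighted slack sum is computed twice: from its definition, and from the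
    single nonzero slack, which contributes \<open>a j * el j * degD\<close>, the degree term
    itself.\<close>
  have "(of_int (\<Sum>i\<le>n. int (a i) * ray_exp j i) :: rat) + of_nat (ray_deg j) * degD = (\<Sum>i\<le>n. of_nat (a i) * slack (ray_deg j, ray_exp j) i)"
    by (simp add: slack_def degD_def distrib_left sum.distrib sum_distrib_left mult_ac)
  also have "\<dots> = (\<Sum>i\<le>n. if i = j then of_nat (a j) * (of_int (el j) * degD) else 0)"
    using j by (intro sum.cong) (auto simp: slack_ray_exp)
  also have "\<dots> = of_nat (ray_deg j) * degD" using j by (simp add: of_nat_ray_deg)
  finally have "(of_int (\<Sum>i\<le>n. int (a i) * ray_exp j i) :: rat) = 0" by simp
  then show ?thesis by (simp only: of_int_eq_0_iff)
qed

lemma ray_exp_expo: assumes j: "j \<le> n" shows "(ray_deg j, ray_exp j) \<in> expo 0"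
  using ray_exp_sum[OF j] slack_ray_exp[OF _ j] el_pos[of j] degD_gt_0
  by (auto simp: expo_def ray_exp_def)

lemma slack_sadd: "slack (sadd s t) i = slack s i + slack t i"
  by (simp add: slack_def sadd_def distrib_right)

lemma expo_sadd: "s \<in> expo q \<Longrightarrow> t \<in> expo r \<Longrightarrow> sadd s t \<in> expo (q + r)"
  by (auto simp: expo_def slack_sadd) (auto simp: sadd_def distrib_left sum.distrib)

lemma slack_ray_red_comb: assumes i: "i \<le> n" shows "slack (ray_red_comb m) i = of_nat (m i) * (of_int (el i) * degD)"
proof -
  have "slack (ray_red_comb m) i = (\<Sum>j\<le>n. of_nat (m j) * slack (ray_deg j, ray_exp j) i)"
    by (simp add: slack_def ray_red_comb_def sum.distrib distrib_left sum_distrib_left sum_distrib_right mult_ac)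
  also have "\<dots> = (\<Sum>j\<le>n. if j = i then of_nat (m i) * (of_int (el i) * degD) else 0)"
    using i by (intro sum.cong) (auto simp: slack_ray_exp)
  finally show ?thesis using i by simp
qed

lemma ray_red_comb_expo: "ray_red_comb m \<in> expo 0"
proof -
  have "(\<Sum>i\<le>n. int (a i) * snd (ray_red_comb m) i) = (\<Sum>i\<le>n. \<Sum>j\<le>n. int (m j) * (int (a i) * ray_exp j i))"
    by (simp add: ray_red_comb_def sum_distrib_left mult_ac)
  also have "\<dots> = (\<Sum>j\<le>n. int (m j) * (\<Sum>i\<le>n. int (a i) * ray_exp j i))"
    by (subst sum.swap) (simp add: sum_distrib_left)
  also have "\<dots> = 0" by (simp add: ray_exp_sum)
  finally show ?thesis
    using slack_ray_red_comb el_pos degD_gt_0 by (auto simp: expo_def less_imp_le) (simp add: ray_red_comb_def ray_exp_def)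
qed

lemma ray_red_comb_add: "ray_red_comb (\<lambda>j. m j + m' j) = sadd (ray_red_comb m) (ray_red_comb m')"
  by (simp add: ray_red_comb_def sadd_def distrib_right sum.distrib)

lemma el_degD_pos: "of_int (el j) * degD > 0"
  using el_pos degD_gt_0 by simp

lemma ray_mult_le_slack:
  assumes "s \<in> expo q" "i \<le> n"
  shows "of_nat (ray_mult s i) * (of_int (el i) * degD) \<le> slack s i"
    "slack s i < (of_nat (ray_mult s i) + 1) * (of_int (el i) * degD)"
proof -
  let ?x = "slack s i / (of_int (el i) * degD)"
  have "slack s i \<ge> 0" using assms by (simp add: expo_def)
  then have "?x \<ge> 0" using el_degD_pos[of i] by (intro divide_nonneg_pos)
  then have "of_nat (ray_mult s i) = (of_int \<lfloor>?x\<rfloor> :: rat)" by (simp add: ray_mult_def)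
  then have "of_nat (ray_mult s i) \<le> ?x" "?x < of_nat (ray_mult s i) + 1" by linarith+
  then show "of_nat (ray_mult s i) * (of_int (el i) * degD) \<le> slack s i"
    "slack s i < (of_nat (ray_mult s i) + 1) * (of_int (el i) * degD)"
    using el_degD_pos[of i] by (simp_all only: pos_le_divide_eq pos_divide_less_eq)
qed

text \<open>Guarantees that the natural subtraction in \<open>box_part\<close> is not truncated:
  slackwise comparison implies comparison of degrees.\<close>

lemma fst_ray_red_comb_ray_mult_le: assumes s: "s \<in> expo q" shows "fst (ray_red_comb (ray_mult s)) \<le> fst s"
proof -
  have "of_nat (fst (ray_red_comb (ray_mult s))) * degD = (\<Sum>i\<le>n. of_nat (a i) * slack (ray_red_comb (ray_mult s)) i)"
    using degree_slack[OF ray_red_comb_expo] by simp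
  also have "\<dots> \<le> (\<Sum>i\<le>n. of_nat (a i) * slack s i)"
    using ray_mult_le_slack(1)[OF s] by (intro sum_mono mult_left_mono) (auto simp: slack_ray_red_comb)
  also have "\<dots> \<le> of_nat (fst s) * degD" using degree_slack[OF s] by simp
  finally show ?thesis using degD_gt_0 by (simp only: mult_le_cancel_right_pos of_nat_le_iff)
qed

lemma box_part_decomp: assumes s: "s \<in> expo q" shows "s = sadd (box_part s) (ray_red_comb (ray_mult s))"
  using fst_ray_red_comb_ray_mult_le[OF s] by (simp add: sadd_def box_part_def prod_eq_iff)

lemma slack_box_part: assumes s: "s \<in> expo q" and i: "i \<le> n"
  shows "slack (box_part s) i = slack s i - of_nat (ray_mult s i) * (of_int (el i) * degD)"
proof -
  have "slack s i = slack (box_part s) i + slack (ray_red_comb (ray_mult s)) i"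
    by (subst box_part_decomp[OF s]) (rule slack_sadd)
  then show ?thesis using slack_ray_red_comb[OF i] by simp
qed

lemma box_part_expo: assumes s: "s \<in> expo q" shows "box_part s \<in> expo q"
proof -
  have v: "ray_red_comb (ray_mult s) \<in> expo 0" by (rule ray_red_comb_expo)
  have "(\<Sum>i\<le>n. int (a i) * snd (box_part s) i) = - int q"
    using s v by (simp add: expo_def box_part_def right_diff_distrib sum_subtractf)
  moreover have "\<forall>i\<le>n. slack (box_part s) i \<ge> 0" using slack_box_part[OF s] ray_mult_le_slack(1)[OF s] by simp
  moreover have "\<forall>i>n. snd (box_part s) i = 0" using s v by (simp add: expo_def box_part_def)
  ultimately show ?thesis by (simp add: expo_def)
qed

text \<open>Each slack of a box point is below \<open>el i * degD\<close>; weighted by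
  \<open>a i\<close> these bounds add up to \<open>ray_sum * degD\<close>. The shift
  \<open>q\<close> moves the apex of the cone up to degree \<open>q / degD\<close>.\<close>

lemma fst_box_part_less: assumes s: "s \<in> expo q"
  shows "of_nat (fst (box_part s)) < of_nat q / degD + of_int ray_sum"
proof -
  have "of_nat (fst (box_part s)) * degD = of_nat q + (\<Sum>i\<le>n. of_nat (a i) * slack (box_part s) i)"
    by (rule degree_slack[OF box_part_expo[OF s]])
  also have "(\<Sum>i\<le>n. of_nat (a i) * slack (box_part s) i) < (\<Sum>i\<le>n. of_nat (a i) * (of_int (el i) * degD))"
  proof (intro sum_strict_mono mult_strict_left_mono)
    fix i assume "i \<in> {..n}"
    then have i: "i \<le> n" by simp
    show "slack (box_part s) i < of_int (el i) * degD"
      using slack_box_part[OF s i] ray_mult_le_slack(2)[OF s i] by (simp only: distrib_right mult_1_left)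
    show "(0::rat) < of_nat (a i)" using a_pos[OF i] by simp
  qed auto
  also have "\<dots> = of_int ray_sum * degD"
    by (simp add: ray_sum_def sum_distrib_left sum_distrib_right mult_ac)
  finally have "of_nat (fst (box_part s)) * degD < (of_nat q / degD + of_int ray_sum) * degD"
    using degD_gt_0 by (simp add: distrib_right)
  then show ?thesis using degD_gt_0 by (simp only: mult_less_cancel_right_pos)
qed

lemma fst_box_part_less_0: assumes s: "s \<in> expo 0" shows "int (fst (box_part s)) < ray_sum"
proof -
  have "(of_int (int (fst (box_part s))) :: rat) < of_int ray_sum" using fst_box_part_less[OF s] by simp
  then show ?thesis by (simp only: of_int_less_iff)
qed

lemma ray_mult_sadd_ray_red_comb:
  assumes s: "s \<in> expo q" and j: "j \<le> n"
  shows "ray_mult (sadd s (ray_red_comb m)) j = ray_mult s j + m j"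
proof -
  let ?y = "of_int (el j) * degD"
  have "slack s j \<ge> 0" using s j by (simp add: expo_def)
  then have "slack s j / ?y \<ge> 0" using el_degD_pos[of j] by (intro divide_nonneg_pos)
  then have nn: "\<lfloor>slack s j / ?y\<rfloor> \<ge> 0" by simp
  have "slack (sadd s (ray_red_comb m)) j / ?y = slack s j / ?y + of_nat (m j)"
    using el_degD_pos[of j] unfolding slack_sadd slack_ray_red_comb[OF j] add_divide_distrib
    by (subst nonzero_mult_div_cancel_right) auto
  then have "\<lfloor>slack (sadd s (ray_red_comb m)) j / ?y\<rfloor> = \<lfloor>slack s j / ?y\<rfloor> + int (m j)"
    by simp
  then show ?thesis using nn unfolding ray_mult_def by (simp only: nat_add_distrib of_nat_0_le_iff nat_int)
qed

lemma ray_red_comb_cong: "(\<And>j. j \<le> n \<Longrightarrow> m j = m' j) \<Longrightarrow> ray_red_comb m = ray_red_comb m'"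
  by (simp add: ray_red_comb_def)

text \<open>Adding whole rays shifts each ray coordinate by a natural number, hence its floor by the
  same number. This invariance is what lets a lift depend on the box part and the ray multiplicities
  separately.\<close>

lemma box_part_sadd_ray_red_comb:
  assumes s: "s \<in> expo q" shows "box_part (sadd s (ray_red_comb m)) = box_part s"
proof -
  have "ray_red_comb (ray_mult (sadd s (ray_red_comb m))) = sadd (ray_red_comb (ray_mult s)) (ray_red_comb m)"
    unfolding ray_red_comb_add[symmetric] by (intro ray_red_comb_cong) (simp add: ray_mult_sadd_ray_red_comb[OF s])
  then show ?thesis by (simp add: box_part_def sadd_def)
qed

end

section \<open>Generators of the section ring\<close>

context qdivisor
begin

definition sec_ring :: "(('n \<Rightarrow>\<^sub>0 nat) \<Rightarrow>\<^sub>0 'k) fract poly set" where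
  "sec_ring = section_ring n f \<alpha>"

definition const_frac :: "'k \<Rightarrow> (('n \<Rightarrow>\<^sub>0 nat) \<Rightarrow>\<^sub>0 'k) fract" where
  "const_frac c = Fract (mconst c) 1"

definition mon_u :: "nat \<times> (nat \<Rightarrow> int) \<Rightarrow> (('n \<Rightarrow>\<^sub>0 nat) \<Rightarrow>\<^sub>0 'k) fract poly" where
  "mon_u s = monom (mon (snd s)) (fst s)"

definition lin_exp :: "('n \<Rightarrow>\<^sub>0 nat) \<Rightarrow> nat \<Rightarrow> int" where
  "lin_exp \<mu> i = (if i \<in> range \<sigma> then int (Poly_Mapping.lookup \<mu> (inv \<sigma> i)) else 0)"

text \<open>Exponents in which every \<open>f i\<close> that is not a coordinate has the least multiplicity allowed in
  degree \<open>d\<close>.\<close>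

definition red_exp :: "nat \<Rightarrow> ('n \<Rightarrow>\<^sub>0 nat) \<Rightarrow> nat \<times> (nat \<Rightarrow> int)" where
  "red_exp d \<mu> = (d, \<lambda>i. if i \<le> n then lin_exp \<mu> i - floor_coeff d i else 0)"

lemma sec_ring_iff: "p \<in> sec_ring \<longleftrightarrow> (\<forall>d. coeff p d \<in> H0 (floor_div d))"
  by (simp add: sec_ring_def section_ring_def floor_div_def[abs_def])

lemma mon_u_sadd: "mon_u (sadd s t) = mon_u s * mon_u t"
  by (simp add: mon_u_def sadd_def mon_add mult_monom)

lemma Fract_prod: "Fract (\<Prod>i\<in>S. h i) 1 = (\<Prod>i\<in>S. Fract (h i) 1)"
  for h :: "'x \<Rightarrow> ('n \<Rightarrow>\<^sub>0 nat) \<Rightarrow>\<^sub>0 'k"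
proof -
  have fr_mult: "Fract (x * y) 1 = Fract x 1 * Fract y 1" for x y :: "('n \<Rightarrow>\<^sub>0 nat) \<Rightarrow>\<^sub>0 'k"
    by simp
  show ?thesis
    by (induction S rule: infinite_finite_induct) (simp_all add: One_fract_def fr_mult del: mult_fract)
qed

lemma Fract_power: "Fract (h ^ k) 1 = Fract h 1 ^ k" for h :: "('n \<Rightarrow>\<^sub>0 nat) \<Rightarrow>\<^sub>0 'k"
  using Fract_prod[of "\<lambda>_. h" "{..<k}"] by simp

lemma Fract_add: "Fract (x + y) 1 = Fract x 1 + Fract y 1" for x :: "('n \<Rightarrow>\<^sub>0 nat) \<Rightarrow>\<^sub>0 'k"
  by simp

lemma Fract_mult: "Fract (x * y) 1 = Fract x 1 * Fract y 1" for x :: "('n \<Rightarrow>\<^sub>0 nat) \<Rightarrow>\<^sub>0 'k"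
  by simp

lemma Fract_sum: "Fract (\<Sum>i\<in>S. h i) 1 = (\<Sum>i\<in>S. Fract (h i) 1)"
  for h :: "'x \<Rightarrow> ('n \<Rightarrow>\<^sub>0 nat) \<Rightarrow>\<^sub>0 'k"
  by (induction S rule: infinite_finite_induct) (simp_all add: Zero_fract_def Fract_add del: add_fract)

lemma Fract_eq_0_iff: "Fract x 1 = 0 \<longleftrightarrow> x = 0" for x :: "('n \<Rightarrow>\<^sub>0 nat) \<Rightarrow>\<^sub>0 'k"
  by (simp add: Zero_fract_def eq_fract)

lemma const_frac_hom: "const_frac (x + y) = const_frac x + const_frac y" "const_frac (x * y) = const_frac x * const_frac y" "const_frac 1 = 1" "const_frac 0 = 0"
  by (simp_all add: const_frac_def mconst_def single_add mult_single One_fract_def Zero_fract_def)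

lemma kconst_const_frac: "kconst c = [:const_frac c:]"
  by (simp add: kconst_def const_frac_def)

lemma mon_poly:
  assumes "\<And>i. i \<le> n \<Longrightarrow> b i \<ge> 0"
  shows "mon b = Fract (\<Prod>i\<le>n. f i ^ nat (b i)) 1"
  unfolding mon_def Fract_prod Fract_power f_frac_def using assms
  by (intro prod.cong) (auto simp: power_int_def)

lemma H0_add: "x \<in> H0 (floor_div d) \<Longrightarrow> y \<in> H0 (floor_div d) \<Longrightarrow> x + y \<in> H0 (floor_div d)"
proof -
  assume "x \<in> H0 (floor_div d)" "y \<in> H0 (floor_div d)"
  then obtain G e G' e' where *: "x = Fract G 1 * mon (\<lambda>i. - floor_coeff d i)" "homog_of e G"
    "G = 0 \<or> int e = (\<Sum>i\<le>n. int (a i) * floor_coeff d i)" "y = Fract G' 1 * mon (\<lambda>i. - floor_coeff d i)" "homog_of e' G'"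
    "G' = 0 \<or> int e' = (\<Sum>i\<le>n. int (a i) * floor_coeff d i)" unfolding H0_eq by blast
  have eq: "x + y = Fract (G + G') 1 * mon (\<lambda>i. - floor_coeff d i)"
    unfolding *(1,4) Fract_add by (simp only: distrib_right)
  show "x + y \<in> H0 (floor_div d)"
  proof (cases "G = 0 \<or> G' = 0")
    case True
    then have "x = 0 \<or> y = 0" using *(1,4) by (auto simp: Zero_fract_def[symmetric])
    then show ?thesis using \<open>x \<in> H0 (floor_div d)\<close> \<open>y \<in> H0 (floor_div d)\<close> by auto
  next
    case False
    then have ee: "e = e'" "int e = (\<Sum>i\<le>n. int (a i) * floor_coeff d i)" using * by auto
    then have "homog_of e (G + G')" using * by (auto intro: homog_of_add)
    then show ?thesis unfolding H0_eq using eq ee by blast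
  qed
qed

lemma H0_zero: "0 \<in> H0 E"
  by (simp add: H0_def)

lemma H0_sum: "(\<And>x. x \<in> A \<Longrightarrow> h x \<in> H0 (floor_div d)) \<Longrightarrow> sum h A \<in> H0 (floor_div d)"
  by (induction A rule: infinite_finite_induct) (auto intro: H0_add H0_zero)

lemma H0_const_frac: assumes "x \<in> H0 (floor_div d)" shows "const_frac c * x \<in> H0 (floor_div d)"
proof -
  obtain G e where *: "x = Fract G 1 * mon (\<lambda>i. - floor_coeff d i)" "homog_of e G"
    "G = 0 \<or> int e = (\<Sum>i\<le>n. int (a i) * floor_coeff d i)" using assms unfolding H0_eq by blast
  have "const_frac c * x = Fract (mconst c * G) 1 * mon (\<lambda>i. - floor_coeff d i)"
    unfolding const_frac_def *(1) Fract_mult by (simp only: mult.assoc)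
  moreover have "homog_of e (mconst c * G)" using homog_of_mult[OF homog_of_mconst *(2)] by simp
  moreover have "mconst c * G = 0 \<or> int e = (\<Sum>i\<le>n. int (a i) * floor_coeff d i)" using *(3) by auto
  ultimately show ?thesis unfolding H0_eq by blast
qed

text \<open>The bridge between the rounded divisor and the rational cone: an integer lies below the
  floor exactly when it lies below the rational itself.\<close>

lemma neg_le_floor_coeff_iff: "- x \<le> floor_coeff d i \<longleftrightarrow> of_int x + of_nat d * \<alpha> i \<ge> 0"
  unfolding floor_coeff_def le_floor_iff by auto

lemma mon_in_H0:
  assumes s: "s \<in> expo 0" shows "mon (snd s) \<in> H0 (floor_div (fst s))"
proof -
  let ?d = "fst s"
  let ?b = "\<lambda>i. snd s i + floor_coeff ?d i"
  have nn: "?b i \<ge> 0" if "i \<le> n" for i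
    using s that neg_le_floor_coeff_iff[of "snd s i" ?d i] by (auto simp: expo_def slack_def)
  define G where "G = (\<Prod>i\<le>n. f i ^ nat (?b i))"
  have hom: "homog_of (\<Sum>i\<le>n. nat (?b i) * a i) G" unfolding G_def
    by (intro homog_of_prod homog_of_power f_homog) simp
  have "int (\<Sum>i\<le>n. nat (?b i) * a i) = (\<Sum>i\<le>n. ?b i * int (a i))"
    using nn by (simp add: int_sum) 
  also have "\<dots> = (\<Sum>i\<le>n. int (a i) * snd s i) + (\<Sum>i\<le>n. int (a i) * floor_coeff ?d i)"
    by (simp add: sum.distrib distrib_left mult.commute)
  also have "\<dots> = (\<Sum>i\<le>n. int (a i) * floor_coeff ?d i)" using s by (simp add: expo_def)
  finally have deg: "int (\<Sum>i\<le>n. nat (?b i) * a i) = (\<Sum>i\<le>n. int (a i) * floor_coeff ?d i)" .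
  have "mon (snd s) = mon (\<lambda>i. ?b i + - floor_coeff ?d i)" by (intro mon_cong) simp
  also have "\<dots> = mon ?b * mon (\<lambda>i. - floor_coeff ?d i)" by (rule mon_add)
  also have "mon ?b = Fract G 1" unfolding G_def using nn by (intro mon_poly)
  finally show ?thesis unfolding H0_eq using hom deg by blast
qed

lemma mon_u_in_sec_ring: "s \<in> expo 0 \<Longrightarrow> mon_u s \<in> sec_ring"
  unfolding sec_ring_iff mon_u_def using mon_in_H0 H0_zero by auto

section \<open>The coordinate forms and reduced exponents\<close>

lemma lin_exp_\<sigma>: "lin_exp \<mu> (\<sigma> x) = int (Poly_Mapping.lookup \<mu> x)"
  using \<sigma>_inj by (simp add: lin_exp_def)

lemma lin_exp_nonneg: "lin_exp \<mu> i \<ge> 0"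
  by (simp add: lin_exp_def)

lemma sum_\<sigma>:
  assumes "\<And>i. i \<notin> range \<sigma> \<Longrightarrow> h i = 0"
  shows "(\<Sum>i\<le>n. h i) = (\<Sum>x\<in>UNIV. h (\<sigma> x))"
proof -
  have "(\<Sum>i\<le>n. h i) = (\<Sum>i\<in>range \<sigma>. h i)"
    using assms \<sigma>_le by (intro sum.mono_neutral_right) auto
  then show ?thesis by (simp add: sum.reindex[OF \<sigma>_inj])
qed

lemma prod_\<sigma>:
  assumes "\<And>i. i \<notin> range \<sigma> \<Longrightarrow> h i = 1"
  shows "(\<Prod>i\<le>n. h i) = (\<Prod>x\<in>UNIV. h (\<sigma> x))"
proof -
  have "(\<Prod>i\<le>n. h i) = (\<Prod>i\<in>range \<sigma>. h i)"
    using assms \<sigma>_le by (intro prod.mono_neutral_right) auto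
  then show ?thesis by (simp add: prod.reindex[OF \<sigma>_inj])
qed

lemma sum_a_lin_exp: "(\<Sum>i\<le>n. int (a i) * lin_exp \<mu> i) = int (mdeg \<mu>)"
proof -
  have "(\<Sum>i\<le>n. int (a i) * lin_exp \<mu> i) = (\<Sum>x\<in>UNIV. int (a (\<sigma> x)) * lin_exp \<mu> (\<sigma> x))"
    by (rule sum_\<sigma>) (simp add: lin_exp_def)
  also have "\<dots> = int (mdeg \<mu>)" by (simp add: a_\<sigma> lin_exp_\<sigma> mdeg_superset[of UNIV])
  finally show ?thesis .
qed

lemma mon_lin_exp: "mon (lin_exp \<mu>) = Fract (mexp (\<lambda>x. f (\<sigma> x)) \<mu>) 1"
proof -
  have "mon (lin_exp \<mu>) = Fract (\<Prod>i\<le>n. f i ^ nat (lin_exp \<mu> i)) 1" by (rule mon_poly) (rule lin_exp_nonneg)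
  also have "(\<Prod>i\<le>n. f i ^ nat (lin_exp \<mu> i)) = (\<Prod>x\<in>UNIV. f (\<sigma> x) ^ nat (lin_exp \<mu> (\<sigma> x)))"
    by (rule prod_\<sigma>) (simp add: lin_exp_def)
  also have "\<dots> = mexp (\<lambda>x. f (\<sigma> x)) \<mu>" by (simp add: lin_exp_\<sigma> mexp_superset[of UNIV])
  finally show ?thesis .
qed

lemma mon_red_exp: "mon (snd (red_exp d \<mu>)) = mon (lin_exp \<mu>) * mon (\<lambda>i. - floor_coeff d i)"
  by (subst mon_add[symmetric]) (intro mon_cong, simp add: red_exp_def)

lemma red_exp_expo: 
  assumes "int (mdeg \<mu>) = (\<Sum>i\<le>n. int (a i) * floor_coeff d i)" shows "red_exp d \<mu> \<in> expo 0"
proof -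
  have "(\<Sum>i\<le>n. int (a i) * snd (red_exp d \<mu>) i) = (\<Sum>i\<le>n. int (a i) * lin_exp \<mu> i) - (\<Sum>i\<le>n. int (a i) * floor_coeff d i)"
    by (simp add: red_exp_def right_diff_distrib sum_subtractf)
  moreover have "slack (red_exp d \<mu>) i \<ge> 0" if i: "i \<le> n" for i
  proof -
    have "- (snd (red_exp d \<mu>) i) \<le> floor_coeff d i" using i lin_exp_nonneg by (simp add: red_exp_def)
    then show ?thesis unfolding neg_le_floor_coeff_iff by (simp add: slack_def red_exp_def)
  qed
  ultimately show ?thesis using assms by (simp add: expo_def sum_a_lin_exp) (simp add: red_exp_def)
qed

lemma \<sigma>_homog: "homog_of 1 (f (\<sigma> x))"
  using f_homog[OF \<sigma>_le, of x] by (simp add: a_\<sigma>)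

lemma \<sigma>_expand:
  assumes "homog_of e G"
  obtains W where "homog_of e W" "ev mconst (\<lambda>x. f (\<sigma> x)) W = G"
proof (rule linear_forms_coordinates[of "\<lambda>x. f (\<sigma> x)"])
  fix \<zeta> :: "'n \<Rightarrow> ('n \<Rightarrow>\<^sub>0 nat) \<Rightarrow>\<^sub>0 'k"
  assume "\<And>x. homog_of 1 (\<zeta> x)" "\<And>P. ev mconst (\<lambda>x. f (\<sigma> x)) (ev mconst \<zeta> P) = P"
  with assms show thesis by (intro that[of "ev mconst \<zeta> G"] homog_of_ev_mconst)
qed (rule \<sigma>_homog, rule \<sigma>_indep)

text \<open>Independent linear forms come from the variables by an invertible substitution, and
  applying its inverse to the relation returns \<open>W\<close>.\<close>

lemma \<sigma>_alg_indep:
  assumes "ev mconst (\<lambda>x. f (\<sigma> x)) W = 0" shows "W = 0"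
proof (rule linear_forms_coordinates[of "\<lambda>x. f (\<sigma> x)"])
  fix \<zeta> :: "'n \<Rightarrow> ('n \<Rightarrow>\<^sub>0 nat) \<Rightarrow>\<^sub>0 'k"
  assume "\<And>P. ev mconst \<zeta> (ev mconst (\<lambda>x. f (\<sigma> x)) P) = P"
  from this[of W] show "W = 0" unfolding assms by (simp add: eval_hom.ev_zero[OF mconst_hom])
qed (rule \<sigma>_homog, rule \<sigma>_indep)

text \<open>The form \<open>G\<close> of a section is rewritten in the coordinate forms; each of its
  monomials, times the common denominator, is a reduced exponent.\<close>

lemma H0_red_comb:
  assumes "x \<in> H0 (floor_div d)"
  obtains W where "x = (\<Sum>\<mu>\<in>Poly_Mapping.keys W. const_frac (Poly_Mapping.lookup W \<mu>) * mon (snd (red_exp d \<mu>)))"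
    "\<And>\<mu>. \<mu> \<in> Poly_Mapping.keys W \<Longrightarrow> red_exp d \<mu> \<in> expo 0"
proof -
  obtain G e where G: "x = Fract G 1 * mon (\<lambda>i. - floor_coeff d i)" "homog_of e G"
    "G = 0 \<or> int e = (\<Sum>i\<le>n. int (a i) * floor_coeff d i)" using assms unfolding H0_eq by blast
  obtain W where W: "homog_of e W" "ev mconst (\<lambda>x. f (\<sigma> x)) W = G" by (rule \<sigma>_expand[OF G(2)])
  have "x = (\<Sum>\<mu>\<in>Poly_Mapping.keys W. Fract (mconst (Poly_Mapping.lookup W \<mu>) * mexp (\<lambda>x. f (\<sigma> x)) \<mu>) 1) * mon (\<lambda>i. - floor_coeff d i)"
    unfolding G(1) W(2)[symmetric] ev_def Fract_sum ..
  also have "\<dots> = (\<Sum>\<mu>\<in>Poly_Mapping.keys W. const_frac (Poly_Mapping.lookup W \<mu>) * mon (snd (red_exp d \<mu>)))"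
    unfolding Fract_mult mon_lin_exp[symmetric] const_frac_def[symmetric] mon_red_exp by (simp add: sum_distrib_right mult.assoc)
  finally have x: "x = (\<Sum>\<mu>\<in>Poly_Mapping.keys W. const_frac (Poly_Mapping.lookup W \<mu>) * mon (snd (red_exp d \<mu>)))" .
  show ?thesis
  proof (cases "G = 0")
    \<comment> \<open>For \<open>G = 0\<close> the degree \<open>e\<close> is arbitrary, so
      membership in \<open>expo 0\<close> has to come from \<open>W\<close> having no terms at
      all.\<close>
    case True
    then have "W = 0" using W(2) \<sigma>_alg_indep by blast
    with x show ?thesis by (intro that[of W]) auto
  next
    case False
    with W(1) G(3) x show ?thesis by (intro that[of W]) (auto intro!: red_exp_expo simp: homog_of_def)
  qed
qed

text \<open>In one power of \<open>u\<close> all terms share the factor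
  \<open>mon (\<lambda>i. - floor_coeff d i)\<close>. Cancelling it leaves a polynomial in the
  coordinate forms, and algebraic independence applies.\<close>

lemma red_exp_indep:
  fixes C :: "(nat \<times> ('n \<Rightarrow>\<^sub>0 nat)) \<Rightarrow>\<^sub>0 'k"
  assumes zero: "(\<Sum>p\<in>Poly_Mapping.keys C. kconst (Poly_Mapping.lookup C p) * mon_u (red_exp (fst p) (snd p))) = 0"
  shows "C = 0"
proof (rule poly_mapping_eqI)
  fix p0 :: "nat \<times> ('n \<Rightarrow>\<^sub>0 nat)"
  obtain d \<nu> where p0: "p0 = (d, \<nu>)" by fastforce
  let ?K = "{p\<in>Poly_Mapping.keys C. fst p = d}"
  define W where "W = (\<Sum>p\<in>?K. Poly_Mapping.single (snd p) (Poly_Mapping.lookup C p))"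
  have "0 = coeff (\<Sum>p\<in>Poly_Mapping.keys C. kconst (Poly_Mapping.lookup C p) * mon_u (red_exp (fst p) (snd p))) d"
    using zero by simp
  also have "\<dots> = (\<Sum>p\<in>Poly_Mapping.keys C. if fst p = d then const_frac (Poly_Mapping.lookup C p) * mon (snd (red_exp d (snd p))) else 0)"
    unfolding coeff_sum by (intro sum.cong) (auto simp: kconst_const_frac mon_u_def red_exp_def)
  also have "\<dots> = (\<Sum>p\<in>?K. const_frac (Poly_Mapping.lookup C p) * mon (snd (red_exp d (snd p))))"
    by (rule sum.inter_filter[symmetric]) simp
  also have "\<dots> = (\<Sum>p\<in>?K. const_frac (Poly_Mapping.lookup C p) * mon (lin_exp (snd p))) * mon (\<lambda>i. - floor_coeff d i)"
    by (simp add: mon_red_exp sum_distrib_right mult.assoc)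
  finally have "(\<Sum>p\<in>?K. const_frac (Poly_Mapping.lookup C p) * mon (lin_exp (snd p))) = 0" using mon_nz by simp
  also have "(\<Sum>p\<in>?K. const_frac (Poly_Mapping.lookup C p) * mon (lin_exp (snd p))) =
    Fract (ev mconst (\<lambda>x. f (\<sigma> x)) W) 1"
    unfolding W_def mc_sum eval_hom.ev_single[OF mconst_hom] Fract_sum Fract_mult mon_lin_exp const_frac_def ..
  finally have "ev mconst (\<lambda>x. f (\<sigma> x)) W = 0" by (simp only: Fract_eq_0_iff)
  then have W: "W = 0" by (rule \<sigma>_alg_indep)
  have "Poly_Mapping.lookup W \<nu> = (\<Sum>p\<in>?K. if p = p0 then Poly_Mapping.lookup C p0 else 0)"
    unfolding W_def lookup_sum by (intro sum.cong) (auto simp: lookup_single when_def p0)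
  also have "\<dots> = Poly_Mapping.lookup C p0" by (simp add: in_keys_iff p0)
  finally show "Poly_Mapping.lookup C p0 = Poly_Mapping.lookup 0 p0" using W by simp
qed

text \<open>Floors are only superadditive, so the forms of two sections do not simply multiply.
  Passing to monomials avoids this, because slacks add exactly and \<open>expo 0\<close> is closed
  under addition.\<close>

lemma H0_mult:
  assumes "x \<in> H0 (floor_div d)" "y \<in> H0 (floor_div e)" shows "x * y \<in> H0 (floor_div (d + e))"
proof -
  obtain W where W: "x = (\<Sum>\<mu>\<in>Poly_Mapping.keys W. const_frac (Poly_Mapping.lookup W \<mu>) * mon (snd (red_exp d \<mu>)))"
    "\<And>\<mu>. \<mu> \<in> Poly_Mapping.keys W \<Longrightarrow> red_exp d \<mu> \<in> expo 0" using H0_red_comb[OF assms(1)] by blast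
  obtain U where U: "y = (\<Sum>\<mu>\<in>Poly_Mapping.keys U. const_frac (Poly_Mapping.lookup U \<mu>) * mon (snd (red_exp e \<mu>)))"
    "\<And>\<mu>. \<mu> \<in> Poly_Mapping.keys U \<Longrightarrow> red_exp e \<mu> \<in> expo 0" using H0_red_comb[OF assms(2)] by blast
  have *: "mon (snd (red_exp d \<mu>)) * mon (snd (red_exp e \<nu>)) \<in> H0 (floor_div (d + e))"
    if "\<mu> \<in> Poly_Mapping.keys W" "\<nu> \<in> Poly_Mapping.keys U" for \<mu> \<nu>
    using mon_in_H0[OF expo_sadd[OF W(2)[OF that(1)] U(2)[OF that(2)], simplified]]
    by (simp add: sadd_def mon_add red_exp_def)
  have "x * y = (\<Sum>\<mu>\<in>Poly_Mapping.keys W. \<Sum>\<nu>\<in>Poly_Mapping.keys U.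
     const_frac (Poly_Mapping.lookup W \<mu>) * (const_frac (Poly_Mapping.lookup U \<nu>) * (mon (snd (red_exp d \<mu>)) * mon (snd (red_exp e \<nu>)))))"
    unfolding W(1) U(1) sum_product by (simp add: mult_ac)
  then show ?thesis using * by (auto intro!: H0_sum H0_const_frac)
qed

lemma kconst_in_sec_ring: "kconst c \<in> sec_ring"
proof -
  have "(0, \<lambda>_. 0) \<in> expo 0" by (simp add: expo_def slack_def)
  then have "1 \<in> H0 (floor_div 0)" using mon_in_H0 mon_zero by fastforce
  then have "const_frac c \<in> H0 (floor_div 0)" using H0_const_frac[of 1] by simp
  then show ?thesis by (auto simp: sec_ring_iff kconst_const_frac coeff_pCons H0_zero split: nat.split)
qed

lemma sec_ring_add: "p \<in> sec_ring \<Longrightarrow> q \<in> sec_ring \<Longrightarrow> p + q \<in> sec_ring"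
  by (auto simp: sec_ring_iff intro: H0_add)

lemma sec_ring_mult: "p \<in> sec_ring \<Longrightarrow> q \<in> sec_ring \<Longrightarrow> p * q \<in> sec_ring"
  unfolding sec_ring_iff coeff_mult
proof (intro allI H0_sum)
  fix d i :: nat
  assume "\<forall>d. coeff p d \<in> H0 (floor_div d)" "\<forall>d. coeff q d \<in> H0 (floor_div d)" "i \<in> {..d}"
  then show "coeff p i * coeff q (d - i) \<in> H0 (floor_div d)" using H0_mult[of "coeff p i" i "coeff q (d - i)" "d - i"] by simp
qed

section \<open>Generation in bounded degree\<close>

lemma alg_gen_subset_sec_ring:
  assumes "A \<subseteq> sec_ring" shows "alg_gen A \<subseteq> sec_ring"
proof
  fix p assume "p \<in> alg_gen A"
  then show "p \<in> sec_ring" by induction (use assms in \<open>auto intro: kconst_in_sec_ring sec_ring_add sec_ring_mult\<close>)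
qed

lemma alg_gen_zero: "0 \<in> alg_gen A" for A :: "(('n \<Rightarrow>\<^sub>0 nat) \<Rightarrow>\<^sub>0 'k) fract poly set"
  using alg_gen.const[of 0 A] by (simp add: kconst_const_frac const_frac_hom)

lemma alg_gen_one: "1 \<in> alg_gen A" for A :: "(('n \<Rightarrow>\<^sub>0 nat) \<Rightarrow>\<^sub>0 'k) fract poly set"
  using alg_gen.const[of 1 A] by (simp add: kconst_const_frac const_frac_hom one_pCons)

lemma alg_gen_sum: "(\<And>x. x \<in> X \<Longrightarrow> h x \<in> alg_gen A) \<Longrightarrow> sum h X \<in> alg_gen A"
  for A :: "(('n \<Rightarrow>\<^sub>0 nat) \<Rightarrow>\<^sub>0 'k) fract poly set"
  by (induction X rule: infinite_finite_induct) (auto intro: alg_gen.add alg_gen_zero)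

lemma alg_gen_power: "p \<in> alg_gen A \<Longrightarrow> p ^ k \<in> alg_gen A"
  for A :: "(('n \<Rightarrow>\<^sub>0 nat) \<Rightarrow>\<^sub>0 'k) fract poly set"
  by (induction k) (auto intro: alg_gen.mult alg_gen_one)

lemma alg_gen_prod: "(\<And>x. x \<in> X \<Longrightarrow> h x \<in> alg_gen A) \<Longrightarrow> prod h X \<in> alg_gen A"
  for A :: "(('n \<Rightarrow>\<^sub>0 nat) \<Rightarrow>\<^sub>0 'k) fract poly set"
  by (induction X rule: infinite_finite_induct) (auto intro: alg_gen.mult alg_gen_one)

lemma alg_gen_trans:
  assumes "A \<subseteq> alg_gen B" "p \<in> alg_gen A" shows "p \<in> alg_gen B"
  using assms(2) by induction (use assms(1) in \<open>auto intro: alg_gen.const alg_gen.add alg_gen.mult\<close>)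

lemma mon_u_ray_red_comb: "mon_u (ray_red_comb m) = (\<Prod>j\<le>n. mon_u (ray_deg j, ray_exp j) ^ m j)"
proof -
  define w where "w = (\<lambda>A. (\<Sum>j\<in>A. m j * ray_deg j, \<lambda>i. \<Sum>j\<in>A. int (m j) * ray_exp j i))"
  have pow: "mon (\<lambda>i. int k * ray_exp j i) = mon (ray_exp j) ^ k" for j k
    by (induction k) (simp_all add: mon_zero distrib_right mon_add)
  have "mon_u (w A) = (\<Prod>j\<in>A. mon_u (ray_deg j, ray_exp j) ^ m j)" if "finite A" for A
    using that
  proof (induction A rule: finite_induct)
    case empty
    then show ?case by (simp add: w_def mon_u_def mon_zero)
  next
    case (insert j A)
    have "w (insert j A) = sadd (m j * ray_deg j, \<lambda>i. int (m j) * ray_exp j i) (w A)"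
      using insert by (simp add: w_def sadd_def)
    then have "mon_u (w (insert j A)) = mon_u (m j * ray_deg j, \<lambda>i. int (m j) * ray_exp j i) * mon_u (w A)"
      by (simp add: mon_u_sadd)
    also have "mon_u (m j * ray_deg j, \<lambda>i. int (m j) * ray_exp j i) = mon_u (ray_deg j, ray_exp j) ^ m j"
      by (simp add: mon_u_def pow monom_power mult.commute)
    finally show ?case using insert by simp
  qed
  from this[of "{..n}"] show ?thesis by (simp add: w_def ray_red_comb_def)
qed

lemma homog_el_monom: "homog_el (monom c d)"
  by (cases "c = 0") (simp_all add: homog_el_def degree_monom_eq)

text \<open>Every component is a combination of reduced monomials, and each of these is a box point
  times ray monomials; the box point has degree below \<open>ray_sum\<close>, and each single ray
  has degree at most \<open>ray_sum\<close>.\<close>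

lemma generated:
  "sec_ring = alg_gen {p \<in> sec_ring. homog_el p \<and> degree p \<le> nat ray_sum}"
proof (intro equalityI subsetI)
  fix p assume p: "p \<in> sec_ring"
  let ?A = "{p \<in> sec_ring. homog_el p \<and> degree p \<le> nat ray_sum}"
  have small: "mon_u s \<in> alg_gen ?A" if "s \<in> expo 0" "int (fst s) \<le> ray_sum" for s
  proof (rule alg_gen.gen)
    have "degree (mon_u s) \<le> nat ray_sum"
      using that degree_monom_le[of "mon (snd s)" "fst s"] by (simp add: mon_u_def)
    then show "mon_u s \<in> ?A" using mon_u_in_sec_ring[OF that(1)] homog_el_monom by (simp add: mon_u_def)
  qed
  have all: "mon_u s \<in> alg_gen ?A" if s: "s \<in> expo 0" for s
  proof -
    have "mon_u s = mon_u (box_part s) * (\<Prod>j\<le>n. mon_u (ray_deg j, ray_exp j) ^ ray_mult s j)"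
      by (subst box_part_decomp[OF s]) (simp add: mon_u_sadd mon_u_ray_red_comb)
    moreover have "mon_u (box_part s) \<in> alg_gen ?A"
      using box_part_expo[OF s] fst_box_part_less_0[OF s] by (intro small) auto
    moreover have "mon_u (ray_deg j, ray_exp j) \<in> alg_gen ?A" if "j \<le> n" for j
      using ray_exp_expo[OF that] ray_deg_le[OF that] by (intro small) auto
    ultimately show ?thesis by (auto intro!: alg_gen.mult alg_gen_prod alg_gen_power)
  qed
  have "monom (coeff p d) d \<in> alg_gen ?A" for d
  proof -
    have "coeff p d \<in> H0 (floor_div d)" using p by (simp add: sec_ring_iff)
    then obtain W where W: "coeff p d = (\<Sum>\<mu>\<in>Poly_Mapping.keys W. const_frac (Poly_Mapping.lookup W \<mu>) * mon (snd (red_exp d \<mu>)))"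
      "\<And>\<mu>. \<mu> \<in> Poly_Mapping.keys W \<Longrightarrow> red_exp d \<mu> \<in> expo 0" using H0_red_comb by blast
    have "monom (coeff p d) d = (\<Sum>\<mu>\<in>Poly_Mapping.keys W. kconst (Poly_Mapping.lookup W \<mu>) * mon_u (red_exp d \<mu>))"
      unfolding W(1) by (simp add: kconst_const_frac mon_u_def monom_sum smult_monom red_exp_def)
    then show ?thesis by (simp only:) (intro alg_gen_sum alg_gen.mult alg_gen.const all W(2))
  qed
  then have "(\<Sum>d\<le>degree p. monom (coeff p d) d) \<in> alg_gen ?A" by (intro alg_gen_sum)
  then show "p \<in> alg_gen ?A" by (simp add: poly_as_sum_of_monoms)
next
  fix p assume "p \<in> alg_gen {p \<in> sec_ring. homog_el p \<and> degree p \<le> nat ray_sum}"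
  then show "p \<in> sec_ring" using alg_gen_subset_sec_ring[of "{p \<in> sec_ring. homog_el p \<and> degree p \<le> nat ray_sum}"] by auto
qed

text \<open>A generator of degree above \<open>ray_sum\<close> would be redundant: the other generators already produce all
  elements of degree at most \<open>ray_sum\<close>.\<close>

lemma min_gens_degree:
  assumes g: "min_hom_gens sec_ring r g" and i: "i < r"
  shows "degree (g i) \<le> nat ray_sum"
proof (rule ccontr)
  assume big: "\<not> degree (g i) \<le> nat ray_sum"
  let ?A = "g ` {..<r} - {g i}"
  have hom: "g j \<in> sec_ring" "homog_el (g j)" if "j < r" for j using g that by (auto simp: min_hom_gens_def)
  have gen: "alg_gen (g ` {..<r}) = sec_ring" using g by (simp add: min_hom_gens_def)
  \<comment> \<open>Elements of \<open>alg_gen\<close> need not be homogeneous, so the induction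
    follows all components up to \<open>ray_sum\<close> at once; in a product these involve only
    components of no larger degree.\<close>
  have low: "\<forall>d\<le>nat ray_sum. monom (coeff p d) d \<in> alg_gen ?A" if "p \<in> alg_gen (g ` {..<r})" for p
    using that
  proof induction
    case (const c)
    have "monom (coeff (kconst c) d) d = (if d = 0 then kconst c else 0 :: (('n \<Rightarrow>\<^sub>0 nat) \<Rightarrow>\<^sub>0 'k) fract poly)" for d
      by (auto simp: kconst_const_frac coeff_pCons monom_0 split: nat.split)
    then show ?case using alg_gen.const alg_gen_zero by auto
  next
    case (gen s)
    then obtain j where j: "j < r" "s = g j" by auto
    have s: "s = monom (lead_coeff s) (degree s)" using hom(2)[OF j(1)] j(2) by (simp add: homog_el_def)
    show ?case
    proof (intro allI impI)
      fix d assume d: "d \<le> nat ray_sum"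
      show "monom (coeff s d) d \<in> alg_gen ?A"
      proof (cases "d = degree s")
        case True
        \<comment> \<open>The deleted generator has degree above \<open>ray_sum\<close>, so it
          cannot be responsible for a component this low.\<close>
        then have "s \<noteq> g i" using d big by auto
        then have "s \<in> ?A" using gen by blast
        moreover have "monom (coeff s d) d = s" using s True by simp
        ultimately show ?thesis by (simp add: alg_gen.gen)
      next
        case False
        then have "coeff s d = 0" by (subst s) simp
        then show ?thesis by (simp add: alg_gen_zero)
      qed
    qed
  next
    case (add p q)
    then show ?case by (auto simp flip: add_monom intro!: alg_gen.add)
  next
    case (mult p q)
    show ?case
    proof (intro allI impI)
      fix d assume d: "d \<le> nat ray_sum"
      have "monom (coeff (p * q) d) d = (\<Sum>j\<le>d. monom (coeff p j) j * monom (coeff q (d - j)) (d - j))"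
        unfolding coeff_mult monom_sum by (intro sum.cong) (auto simp: mult_monom)
      then show "monom (coeff (p * q) d) d \<in> alg_gen ?A"
        using mult d by (auto intro!: alg_gen_sum alg_gen.mult)
    qed
  qed
  have "{p \<in> sec_ring. homog_el p \<and> degree p \<le> nat ray_sum} \<subseteq> alg_gen ?A"
  proof
    fix p assume p: "p \<in> {p \<in> sec_ring. homog_el p \<and> degree p \<le> nat ray_sum}"
    then have "monom (coeff p (degree p)) (degree p) \<in> alg_gen ?A" using low gen by blast
    then show "p \<in> alg_gen ?A" using p by (simp add: homog_el_def)
  qed
  then have "sec_ring \<subseteq> alg_gen ?A" using generated alg_gen_trans by blast
  moreover have "alg_gen ?A \<subseteq> sec_ring" using hom(1) by (intro alg_gen_subset_sec_ring) auto
  moreover have "?A \<subset> g ` {..<r}" using i by auto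
  moreover have "\<forall>A. A \<subset> g ` {..<r} \<longrightarrow> alg_gen A \<noteq> sec_ring" using g unfolding min_hom_gens_def by (elim conjE)
  ultimately show False by blast
qed

end

section \<open>Relations\<close>

lemma wdeg_superset:
  assumes "finite A" "Poly_Mapping.keys \<mu> \<subseteq> A"
  shows "wdeg e \<mu> = (\<Sum>i\<in>A. Poly_Mapping.lookup \<mu> i * e i)"
  unfolding wdeg_def using assms
  by (intro sum.mono_neutral_left) (auto simp: in_keys_iff)

lemma wdeg_add: "wdeg e (\<mu> + \<nu>) = wdeg e \<mu> + wdeg e \<nu>"
proof -
  let ?A = "Poly_Mapping.keys \<mu> \<union> Poly_Mapping.keys \<nu>"
  have "Poly_Mapping.keys (\<mu> + \<nu>) \<subseteq> ?A" by (rule Poly_Mapping.keys_add)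
  then show ?thesis
    by (simp add: wdeg_superset[of ?A] lookup_add sum.distrib distrib_right)
qed

lemma whomog_add: "whomog e t P \<Longrightarrow> whomog e t Q \<Longrightarrow> whomog e t (P + Q)"
  using Poly_Mapping.keys_add[of P Q] by (auto simp: whomog_def)

lemma whomog_uminus: "whomog e t P \<Longrightarrow> whomog e t (- P)" for P :: "(nat \<Rightarrow>\<^sub>0 nat) \<Rightarrow>\<^sub>0 'k::ab_group_add"
  by (simp add: whomog_def in_keys_iff)

lemma whomog_mult:
  fixes P Q :: "(nat \<Rightarrow>\<^sub>0 nat) \<Rightarrow>\<^sub>0 'k::semiring_0"
  assumes "whomog e t P" "whomog e u Q" shows "whomog e (t + u) (P * Q)"
  unfolding whomog_def
proof
  fix \<rho> assume "\<rho> \<in> Poly_Mapping.keys (P * Q)"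
  then obtain \<mu> \<nu> where "\<rho> = \<mu> + \<nu>" "\<mu> \<in> Poly_Mapping.keys P" "\<nu> \<in> Poly_Mapping.keys Q"
    using keys_mult[of P Q] by auto
  then show "wdeg e \<rho> = t + u" using assms by (simp add: whomog_def wdeg_add)
qed

lemma whomog_zero: "whomog e t 0"
  by (simp add: whomog_def)

lemma whomog_mconst: "whomog e 0 (mconst c)"
  by (auto simp: whomog_def mconst_def wdeg_def)

lemma whomog_pvar: "whomog e (e i) (pvar i :: (nat \<Rightarrow>\<^sub>0 nat) \<Rightarrow>\<^sub>0 'k::zero_neq_one)"
  by (auto simp: whomog_def pvar_def wdeg_def)

lemma in_vars_iff: "in_vars r P \<longleftrightarrow> P \<in> polys_in {..<r}"
  by (simp add: in_vars_def polys_in_def)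

text \<open>Minimality of the generators is recorded as the degree bound \<open>g_deg\<close>, which
  \<open>min_gens_degree\<close> supplies.\<close>

locale presentation = qdivisor f \<alpha> a n \<sigma>
  for f :: "nat \<Rightarrow> ('n::{finite,linorder} \<Rightarrow>\<^sub>0 nat) \<Rightarrow>\<^sub>0 'k::field"
    and \<alpha> :: "nat \<Rightarrow> rat" and a :: "nat \<Rightarrow> nat" and n :: nat and \<sigma> :: "'n \<Rightarrow> nat" +
  fixes r :: nat and g :: "nat \<Rightarrow> (('n \<Rightarrow>\<^sub>0 nat) \<Rightarrow>\<^sub>0 'k) fract poly"
  assumes g_homog: "i < r \<Longrightarrow> homog_el (g i)"
    and g_gen: "alg_gen (g ` {..<r}) = sec_ring"
    and g_deg: "i < r \<Longrightarrow> degree (g i) \<le> nat ray_sum"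
begin

definition rel_bound :: rat where
  "rel_bound = max (2 * of_int ray_sum) (of_nat (Max (a ` {..n})) / degD + of_int ray_sum)"

definition gen_deg :: "nat \<Rightarrow> nat" where
  "gen_deg i = degree (g i)"

text \<open>Homogeneous preimages, with the degree carried along so that differences of preimages
  become homogeneous relations of known degree.\<close>

definition lifts :: "((nat \<Rightarrow>\<^sub>0 nat) \<Rightarrow>\<^sub>0 'k) \<Rightarrow> nat \<Rightarrow> (('n \<Rightarrow>\<^sub>0 nat) \<Rightarrow>\<^sub>0 'k) fract poly \<Rightarrow> bool" where
  "lifts P d x \<longleftrightarrow> P \<in> polys_in {..<r} \<and> whomog gen_deg d P \<and> eval_w g P = x"

definition low_rels :: "((nat \<Rightarrow>\<^sub>0 nat) \<Rightarrow>\<^sub>0 'k) set" where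
  "low_rels = {P \<in> rel_kernel r g. \<exists>t. whomog gen_deg t P \<and> of_nat t \<le> rel_bound}"

definition low_ideal :: "((nat \<Rightarrow>\<^sub>0 nat) \<Rightarrow>\<^sub>0 'k) set" where
  "low_ideal = ideal_gen r low_rels"

lemma kconst_hom: "eval_hom (kconst :: 'k \<Rightarrow> (('n \<Rightarrow>\<^sub>0 nat) \<Rightarrow>\<^sub>0 'k) fract poly)"
  by unfold_locales (simp_all add: kconst_const_frac const_frac_hom one_pCons)

lemma eval_w_ev: "eval_w g P = ev kconst g P"
  by (simp add: eval_w_def ev_def mexp_def)

lemmas evw_add = eval_hom.ev_add[OF kconst_hom, of g, folded eval_w_ev]
  and evw_mult = eval_hom.ev_mult[OF kconst_hom, of g, folded eval_w_ev]
  and evw_diff = eval_hom.ev_diff[OF kconst_hom, of g, folded eval_w_ev]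
  and evw_sum = eval_hom.ev_sum[OF kconst_hom, of g, folded eval_w_ev]
  and evw_zero = eval_hom.ev_zero[OF kconst_hom, of g, folded eval_w_ev]
  and evw_mconst = eval_hom.ev_mconst[OF kconst_hom, of g, folded eval_w_ev]
  and evw_pvar = eval_hom.ev_pvar[OF kconst_hom, of g, folded eval_w_ev]

lemma polys_in_mconst: "mconst c \<in> polys_in V"
  by (simp add: mconst_def polys_in_single)

lemma lifts_add: "lifts P d x \<Longrightarrow> lifts Q d y \<Longrightarrow> lifts (P + Q) d (x + y)"
  by (auto simp: lifts_def evw_add intro: polys_in_add whomog_add)

lemma lifts_mult: "lifts P d x \<Longrightarrow> lifts Q e y \<Longrightarrow> lifts (P * Q) (d + e) (x * y)"
  by (auto simp: lifts_def evw_mult intro: polys_in_mult whomog_mult)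

lemma lifts_zero: "lifts 0 d 0"
  by (simp add: lifts_def evw_zero polys_in_zero whomog_zero)

lemma lifts_mconst: "lifts (mconst c) 0 (kconst c)"
  by (simp add: lifts_def evw_mconst polys_in_mconst whomog_mconst)

lemma lifts_one: "lifts 1 0 1"
  using lifts_mconst[of 1] by (simp add: mconst_def kconst_const_frac const_frac_hom one_pCons)

lemma lifts_pvar: "i < r \<Longrightarrow> lifts (pvar i) (degree (g i)) (g i)"
  unfolding lifts_def evw_pvar using whomog_pvar[of gen_deg i]
  by (simp add: gen_deg_def pvar_def polys_in_single)

lemma lifts_sum: "(\<And>x. x \<in> A \<Longrightarrow> lifts (P x) d (y x)) \<Longrightarrow> lifts (\<Sum>x\<in>A. P x) d (\<Sum>x\<in>A. y x)"
  by (induction A rule: infinite_finite_induct) (auto intro: lifts_add lifts_zero)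

lemma lifts_scale: "lifts P d x \<Longrightarrow> lifts (mconst c * P) d (kconst c * x)"
  using lifts_mult[OF lifts_mconst] by fastforce

lemma lifts_power: "lifts P d x \<Longrightarrow> lifts (P ^ k) (k * d) (x ^ k)"
  by (induction k) (auto intro: lifts_mult lifts_one)

lemma lifts_prod: "(\<And>x. x \<in> A \<Longrightarrow> lifts (P x) (d x) (y x)) \<Longrightarrow> lifts (\<Prod>x\<in>A. P x) (\<Sum>x\<in>A. d x) (\<Prod>x\<in>A. y x)"
  by (induction A rule: infinite_finite_induct) (auto intro: lifts_mult lifts_one)

text \<open>The construction of an element by \<open>alg_gen\<close> passes through inhomogeneous
  ones; quantifying over all \<open>d\<close> lets a component of a product be lifted as a
  convolution.\<close>

lemma ex_lift:
  assumes "p \<in> sec_ring" shows "\<exists>P. lifts P d (monom (coeff p d) d)"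
proof -
  have "p \<in> alg_gen (g ` {..<r})" using assms g_gen by simp
  then show ?thesis
  proof (induction arbitrary: d)
    case (const c)
    have "monom (coeff (kconst c) d) d = (if d = 0 then kconst c else 0 :: (('n \<Rightarrow>\<^sub>0 nat) \<Rightarrow>\<^sub>0 'k) fract poly)"
      by (auto simp: kconst_const_frac coeff_pCons monom_0 split: nat.split)
    then show ?case using lifts_mconst lifts_zero by (cases "d = 0") auto
  next
    case (gen s)
    then obtain i where i: "i < r" "s = g i" by auto
    have s: "s = monom (lead_coeff s) (degree s)" using g_homog[OF i(1)] i(2) by (simp add: homog_el_def)
    show ?case
    proof (cases "d = degree s")
      case True
      then have "monom (coeff s d) d = s" using s by simp
      then show ?thesis using lifts_pvar[OF i(1)] i(2) True by auto
    next
      case False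
      then have "coeff s d = 0" by (subst s) simp
      then show ?thesis using lifts_zero by auto
    qed
  next
    case (add p q)
    obtain P Q where "lifts P d (monom (coeff p d) d)" "lifts Q d (monom (coeff q d) d)"
      using add.IH by blast
    from lifts_add[OF this] show ?case by (auto simp: add_monom)
  next
    case (mult p q)
    have "\<forall>j. \<exists>P. lifts P j (monom (coeff p j) j)" "\<forall>j. \<exists>P. lifts P j (monom (coeff q j) j)"
      using mult.IH by blast+
    then obtain P Q where PQ: "\<And>j. lifts (P j) j (monom (coeff p j) j)" "\<And>j. lifts (Q j) j (monom (coeff q j) j)"
      by (auto dest!: choice)
    have "monom (coeff (p * q) d) d = (\<Sum>j\<le>d. monom (coeff p j) j * monom (coeff q (d - j)) (d - j))"
      unfolding coeff_mult monom_sum by (intro sum.cong) (auto simp: mult_monom)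
    moreover have "lifts (\<Sum>j\<le>d. P j * Q (d - j)) d (\<Sum>j\<le>d. monom (coeff p j) j * monom (coeff q (d - j)) (d - j))"
    proof (rule lifts_sum)
      fix j assume "j \<in> {..d}"
      then show "lifts (P j * Q (d - j)) d (monom (coeff p j) j * monom (coeff q (d - j)) (d - j))"
        using lifts_mult[OF PQ(1)[of j] PQ(2)[of "d - j"]] by simp
    qed
    ultimately show ?case by auto
  qed
qed

section \<open>The ideal generated by relations of bounded degree\<close>

lemma low_ideal_iff: "P \<in> low_ideal \<longleftrightarrow> (\<exists>q c s. P = (\<Sum>i<q::nat. c i * s i) \<and> (\<forall>i<q. in_vars r (c i) \<and> s i \<in> low_rels))"
  by (simp add: low_ideal_def ideal_gen_def)

lemma low_ideal_zero: "0 \<in> low_ideal"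
  unfolding low_ideal_iff by (intro exI[of _ 0]) simp

lemma low_ideal_step:
  assumes "P \<in> low_ideal" "c \<in> polys_in {..<r}" "s \<in> low_rels" shows "P + c * s \<in> low_ideal"
  using assms(1)[unfolded low_ideal_iff]
proof (elim exE conjE)
  fix q :: nat and c' s'
  assume P: "P = (\<Sum>i<q. c' i * s' i)" "\<forall>i<q. in_vars r (c' i) \<and> s' i \<in> low_rels"
  have "(\<Sum>i<Suc q. (c'(q := c)) i * (s'(q := s)) i) = P + c * s" unfolding P(1) by simp
  moreover have "\<forall>i<Suc q. in_vars r ((c'(q := c)) i) \<and> (s'(q := s)) i \<in> low_rels"
    using P(2) assms by (auto simp: in_vars_iff less_Suc_eq)
  ultimately show ?thesis unfolding low_ideal_iff
    by (intro exI[of _ "Suc q"] exI[of _ "c'(q := c)"] exI[of _ "s'(q := s)"]) simp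
qed

lemma low_ideal_induct [consumes 1, case_names zero step]:
  assumes "P \<in> low_ideal" "Q 0"
    and step: "\<And>P c s. P \<in> low_ideal \<Longrightarrow> Q P \<Longrightarrow> c \<in> polys_in {..<r} \<Longrightarrow> s \<in> low_rels \<Longrightarrow> Q (P + c * s)"
  shows "Q P"
  using assms(1)[unfolded low_ideal_iff]
proof (elim exE conjE)
  fix q :: nat and c s
  assume P: "P = (\<Sum>i<q. c i * s i)" "\<forall>i<q. in_vars r (c i) \<and> s i \<in> low_rels"
  have "j \<le> q \<Longrightarrow> (\<Sum>i<j. c i * s i) \<in> low_ideal \<and> Q (\<Sum>i<j. c i * s i)" for j
  proof (induction j)
    case (Suc j)
    then show ?case using P(2) step low_ideal_step by (simp add: in_vars_iff)
  qed (simp add: low_ideal_zero assms(2))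
  then show ?thesis using P(1) by blast
qed

lemma low_ideal_add: assumes "P \<in> low_ideal" "Q \<in> low_ideal" shows "P + Q \<in> low_ideal"
  using assms(2)
proof (induction rule: low_ideal_induct)
  case (step Q c s)
  then show ?case using low_ideal_step by (simp add: add.assoc[symmetric])
qed (simp add: assms)

lemma low_ideal_mult: assumes "P \<in> low_ideal" "c \<in> polys_in {..<r}" shows "c * P \<in> low_ideal"
  using assms(1)
proof (induction rule: low_ideal_induct)
  case (step P c' s)
  then show ?case using low_ideal_step[OF step.IH, of "c * c'" s] polys_in_mult[OF assms(2)]
    by (simp add: distrib_left mult.assoc)
qed (simp add: low_ideal_zero)

lemma low_rels_subset_low_ideal: "s \<in> low_rels \<Longrightarrow> s \<in> low_ideal"
  using low_ideal_step[OF low_ideal_zero polys_in_one] by simp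

lemma low_ideal_subset_kernel: "P \<in> low_ideal \<Longrightarrow> P \<in> polys_in {..<r} \<and> eval_w g P = 0"
proof (induction rule: low_ideal_induct)
  case (step P c s)
  then have "s \<in> polys_in {..<r}" "eval_w g s = 0" by (auto simp: low_rels_def rel_kernel_def in_vars_iff)
  with step show ?case by (auto simp: evw_add evw_mult intro: polys_in_add polys_in_mult)
qed (simp add: evw_zero polys_in_zero)

text \<open>Every relation used below arises in this way, so only the degree of the element being
  lifted ever has to be checked.\<close>

lemma lifts_cong:
  assumes "lifts P d x" "lifts Q d x" "of_nat d \<le> rel_bound" shows "P - Q \<in> low_ideal"
proof -
  have "P + - Q \<in> polys_in {..<r}" using assms by (intro polys_in_add polys_in_uminus) (auto simp: lifts_def)
  moreover have "whomog gen_deg d (P + - Q)" using assms by (intro whomog_add whomog_uminus) (auto simp: lifts_def)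
  moreover have "eval_w g (P - Q) = 0" using assms by (simp add: evw_diff lifts_def)
  ultimately show ?thesis using assms(3) by (intro low_rels_subset_low_ideal) (auto simp: low_rels_def rel_kernel_def in_vars_iff)
qed

text \<open>An arbitrary choice, used only at rays and box points; no compatibility between these
  choices is assumed.\<close>

definition base_lift :: "nat \<times> (nat \<Rightarrow> int) \<Rightarrow> (nat \<Rightarrow>\<^sub>0 nat) \<Rightarrow>\<^sub>0 'k" where
  "base_lift s = (SOME P. lifts P (fst s) (mon_u s))"

definition ray_lift :: "(nat \<Rightarrow> nat) \<Rightarrow> (nat \<Rightarrow>\<^sub>0 nat) \<Rightarrow>\<^sub>0 'k" where
  "ray_lift m = (\<Prod>j\<le>n. base_lift (ray_deg j, ray_exp j) ^ m j)"

text \<open>A section of the presentation on monomials which is, by construction, compatible with adding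
  multiples of the ray generators \<open>(ray_deg j, ray_exp j)\<close>.\<close>

definition mon_lift :: "nat \<times> (nat \<Rightarrow> int) \<Rightarrow> (nat \<Rightarrow>\<^sub>0 nat) \<Rightarrow>\<^sub>0 'k" where
  "mon_lift s = ray_lift (ray_mult s) * base_lift (box_part s)"

lemma base_lift_lifts: assumes "s \<in> expo 0" shows "lifts (base_lift s) (fst s) (mon_u s)"
proof -
  have "\<exists>P. lifts P (fst s) (mon_u s)"
    using ex_lift[OF mon_u_in_sec_ring[OF assms], of "fst s"] by (simp add: mon_u_def)
  then show ?thesis unfolding base_lift_def by (rule someI_ex)
qed

lemma ray_lift_lifts: "lifts (ray_lift m) (fst (ray_red_comb m)) (mon_u (ray_red_comb m))"
proof -
  have "lifts (ray_lift m) (\<Sum>j\<le>n. m j * ray_deg j) (\<Prod>j\<le>n. mon_u (ray_deg j, ray_exp j) ^ m j)"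
    unfolding ray_lift_def using base_lift_lifts[OF ray_exp_expo] by (intro lifts_prod lifts_power) auto
  then show ?thesis by (simp add: mon_u_ray_red_comb) (simp add: ray_red_comb_def)
qed

lemma ray_lift_add: "ray_lift (\<lambda>j. m j + m' j) = ray_lift m * ray_lift m'"
  by (simp add: ray_lift_def power_add prod.distrib)

lemma ray_lift_cong: "(\<And>j. j \<le> n \<Longrightarrow> m j = m' j) \<Longrightarrow> ray_lift m = ray_lift m'"
  unfolding ray_lift_def by (intro prod.cong) auto

lemma mon_lift_lifts: assumes s: "s \<in> expo 0" shows "lifts (mon_lift s) (fst s) (mon_u s)"
proof -
  have "lifts (mon_lift s) (fst (ray_red_comb (ray_mult s)) + fst (box_part s)) (mon_u (ray_red_comb (ray_mult s)) * mon_u (box_part s))"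
    unfolding mon_lift_def by (intro lifts_mult ray_lift_lifts base_lift_lifts box_part_expo[OF s])
  moreover have "fst s = fst (ray_red_comb (ray_mult s)) + fst (box_part s)"
    by (subst box_part_decomp[OF s]) (simp add: sadd_def)
  moreover have "mon_u s = mon_u (ray_red_comb (ray_mult s)) * mon_u (box_part s)"
    by (subst box_part_decomp[OF s]) (simp add: mon_u_sadd mult.commute)
  ultimately show ?thesis by simp
qed

lemma mon_lift_polys_in: "s \<in> expo 0 \<Longrightarrow> mon_lift s \<in> polys_in {..<r}"
  using mon_lift_lifts by (simp add: lifts_def)

lemma ray_lift_polys_in: "ray_lift m \<in> polys_in {..<r}"
  using ray_lift_lifts by (simp add: lifts_def)

text \<open>An equality of polynomials, not merely a congruence: adding rays keeps the box part and
  only raises the exponents in \<open>ray_lift\<close>.\<close>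

lemma mon_lift_ray_red_comb: assumes s: "s \<in> expo 0" shows "mon_lift (sadd s (ray_red_comb m)) = ray_lift m * mon_lift s"
proof -
  have "ray_lift (ray_mult (sadd s (ray_red_comb m))) = ray_lift (\<lambda>j. ray_mult s j + m j)"
    by (intro ray_lift_cong ray_mult_sadd_ray_red_comb[OF s])
  then show ?thesis by (simp add: mon_lift_def box_part_sadd_ray_red_comb[OF s] ray_lift_add mult_ac)
qed

lemma two_ray_sum_le_rel_bound: "int d \<le> 2 * ray_sum \<Longrightarrow> of_nat d \<le> rel_bound"
proof -
  assume "int d \<le> 2 * ray_sum"
  then have "(of_int (int d) :: rat) \<le> of_int (2 * ray_sum)" by (simp only: of_int_le_iff)
  then show "of_nat d \<le> rel_bound" by (simp add: rel_bound_def)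
qed

text \<open>The ray parts factor out exactly, so the congruence is needed only for the two box
  parts, whose degrees sum to less than \<open>2 * ray_sum\<close>.\<close>

lemma mon_lift_mult:
  assumes s: "s \<in> expo 0" and t: "t \<in> expo 0" shows "mon_lift s * mon_lift t - mon_lift (sadd s t) \<in> low_ideal"
proof -
  let ?b = "sadd (box_part s) (box_part t)"
  let ?m = "\<lambda>j. ray_mult s j + ray_mult t j"
  have b: "?b \<in> expo 0" using expo_sadd[OF box_part_expo[OF s] box_part_expo[OF t]] by simp
  have "lifts (base_lift (box_part s) * base_lift (box_part t)) (fst ?b) (mon_u ?b)"
    using lifts_mult[OF base_lift_lifts[OF box_part_expo[OF s]] base_lift_lifts[OF box_part_expo[OF t]]]
    unfolding mon_u_sadd by (simp add: sadd_def)
  moreover have "of_nat (fst ?b) \<le> rel_bound"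
    using fst_box_part_less_0[OF s] fst_box_part_less_0[OF t] by (intro two_ray_sum_le_rel_bound) (simp add: sadd_def)
  ultimately have "base_lift (box_part s) * base_lift (box_part t) - mon_lift ?b \<in> low_ideal" using lifts_cong mon_lift_lifts[OF b] by blast
  then have "ray_lift ?m * (base_lift (box_part s) * base_lift (box_part t) - mon_lift ?b) \<in> low_ideal" by (rule low_ideal_mult) (rule ray_lift_polys_in)
  \<comment> \<open>The sum \<open>?b\<close> of two box points may leave the box, so it is compared
    with \<open>mon_lift ?b\<close>, whose own rays then combine with those collected in
    \<open>?m\<close>.\<close>
  moreover have "sadd s t = sadd ?b (ray_red_comb ?m)"
    by (subst (1) box_part_decomp[OF s], subst (1) box_part_decomp[OF t]) (simp add: ray_red_comb_add sadd_def add_ac)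
  then have "mon_lift (sadd s t) = ray_lift ?m * mon_lift ?b" using mon_lift_ray_red_comb[OF b] by simp
  moreover have "mon_lift s * mon_lift t = ray_lift ?m * (base_lift (box_part s) * base_lift (box_part t))"
    by (simp add: mon_lift_def ray_lift_add mult_ac)
  ultimately show ?thesis by (simp add: right_diff_distrib)
qed

text \<open>The exponent of \<open>f i\<close> alone. Its weighted sum is \<open>a i\<close>, so it
  is no section by itself; it becomes one after adding a point of \<open>expo (a i)\<close>.\<close>

definition unit_exp :: "nat \<Rightarrow> nat \<times> (nat \<Rightarrow> int)" where
  "unit_exp i = (0, \<lambda>j. if j = i then 1 else 0)"

definition lin_shift :: "('n \<Rightarrow>\<^sub>0 nat) \<Rightarrow> nat \<times> (nat \<Rightarrow> int)" where
  "lin_shift \<mu> = (0, lin_exp \<mu>)"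

lemma sum_unit: "i \<le> n \<Longrightarrow> (\<Sum>j\<le>n. int (a j) * (if j = i then 1 else 0)) = int (a i)"
proof -
  assume "i \<le> n"
  have "(\<Sum>j\<le>n. int (a j) * (if j = i then 1 else 0)) = (\<Sum>j\<le>n. if j = i then int (a j) else 0)"
    by (intro sum.cong) auto
  then show ?thesis using \<open>i \<le> n\<close> by simp
qed

lemma sadd_unit_exp_expo: assumes i: "i \<le> n" and t: "t \<in> expo (a i)" shows "sadd t (unit_exp i) \<in> expo 0"
proof -
  note sum_unit[OF i]
  moreover have "slack (unit_exp i) j \<ge> 0" for j by (simp add: slack_def unit_exp_def)
  ultimately show ?thesis using i t
    by (auto simp: expo_def slack_sadd) (simp_all add: sadd_def unit_exp_def distrib_left sum.distrib)
qed

lemma sadd_lin_shift_expo: assumes t: "t \<in> expo (mdeg \<mu>)" shows "sadd t (lin_shift \<mu>) \<in> expo 0"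
proof -
  have "j \<notin> range \<sigma>" if "j > n" for j using \<sigma>_le that by (metis not_le rangeE)
  then have "lin_exp \<mu> j = 0" if "j > n" for j using that by (simp add: lin_exp_def)
  moreover have "slack (lin_shift \<mu>) j \<ge> 0" for j by (simp add: slack_def lin_shift_def lin_exp_nonneg)
  ultimately show ?thesis using t
    by (auto simp: expo_def slack_sadd) (simp_all add: sadd_def lin_shift_def distrib_left sum.distrib sum_a_lin_exp)
qed

lemma mon_u_unit_exp:
  assumes i: "i \<le> n" and W: "ev mconst (\<lambda>x. f (\<sigma> x)) W = f i"
  shows "mon_u (unit_exp i) = (\<Sum>\<mu>\<in>Poly_Mapping.keys W. kconst (Poly_Mapping.lookup W \<mu>) * mon_u (lin_shift \<mu>))"
proof -
  have "mon (snd (unit_exp i)) = (\<Prod>j\<le>n. if j = i then f_frac i else 1)"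
    unfolding mon_def by (intro prod.cong) (auto simp: unit_exp_def)
  also have "\<dots> = Fract (f i) 1" using i by (simp add: f_frac_def)
  also have "\<dots> = (\<Sum>\<mu>\<in>Poly_Mapping.keys W. const_frac (Poly_Mapping.lookup W \<mu>) * mon (lin_exp \<mu>))"
    unfolding W[symmetric] ev_def Fract_sum Fract_mult mon_lin_exp const_frac_def ..
  finally show ?thesis by (simp add: mon_u_def unit_exp_def lin_shift_def kconst_const_frac monom_sum smult_monom)
qed

text \<open>\<open>t\<close> is the cofactor common to all terms of the identity expressing
  \<open>f i\<close> in the coordinate forms. Its rays factor out of every term, and what remains
  has the degree of a box point of the cone shifted by \<open>a i\<close>.\<close>

lemma mon_lift_eliminate:
  assumes i: "i \<le> n" and t: "t \<in> expo (a i)"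
    and W: "homog_of (a i) W" "ev mconst (\<lambda>x. f (\<sigma> x)) W = f i"
  shows "mon_lift (sadd t (unit_exp i)) -
    (\<Sum>\<mu>\<in>Poly_Mapping.keys W. mconst (Poly_Mapping.lookup W \<mu>) * mon_lift (sadd t (lin_shift \<mu>))) \<in> low_ideal"
proof -
  \<comment> \<open>Only \<open>t\<close> is decomposed. The point
    \<open>sadd (box_part t) u\<close> may contain further rays, which \<open>mon_lift\<close>
    handles exactly.\<close>
  have shift: "mon_lift (sadd t u) = ray_lift (ray_mult t) * mon_lift (sadd (box_part t) u)" if "sadd (box_part t) u \<in> expo 0" for u
  proof -
    have "sadd t u = sadd (sadd (box_part t) u) (ray_red_comb (ray_mult t))"
      by (subst (1) box_part_decomp[OF t]) (simp add: sadd_def add_ac)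
    then show ?thesis using mon_lift_ray_red_comb[OF that] by simp
  qed
  have b: "box_part t \<in> expo (a i)" using box_part_expo[OF t] .
  have bi: "sadd (box_part t) (unit_exp i) \<in> expo 0" using sadd_unit_exp_expo[OF i b] .
  have bm: "sadd (box_part t) (lin_shift \<mu>) \<in> expo 0" if "\<mu> \<in> Poly_Mapping.keys W" for \<mu>
    using sadd_lin_shift_expo[of "box_part t" \<mu>] b W(1) that by (simp add: homog_of_def)
  have fst: "fst (sadd (box_part t) (unit_exp i)) = fst (box_part t)" "fst (sadd (box_part t) (lin_shift \<mu>)) = fst (box_part t)" for \<mu>
    by (simp_all add: sadd_def unit_exp_def lin_shift_def)
  let ?R = "\<Sum>\<mu>\<in>Poly_Mapping.keys W. mconst (Poly_Mapping.lookup W \<mu>) * mon_lift (sadd (box_part t) (lin_shift \<mu>))"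
  have "lifts ?R (fst (box_part t)) (\<Sum>\<mu>\<in>Poly_Mapping.keys W. kconst (Poly_Mapping.lookup W \<mu>) * mon_u (sadd (box_part t) (lin_shift \<mu>)))"
    using mon_lift_lifts[OF bm] by (intro lifts_sum lifts_scale) (simp add: fst)
  moreover have "(\<Sum>\<mu>\<in>Poly_Mapping.keys W. kconst (Poly_Mapping.lookup W \<mu>) * mon_u (sadd (box_part t) (lin_shift \<mu>))) = mon_u (sadd (box_part t) (unit_exp i))"
    by (simp add: mon_u_sadd mon_u_unit_exp[OF i W(2)] sum_distrib_left mult_ac)
  ultimately have R: "lifts ?R (fst (box_part t)) (mon_u (sadd (box_part t) (unit_exp i)))" by simp
  have "a i \<le> Max (a ` {..n})" using i by (intro Max_ge) auto
  then have "of_nat (a i) / degD \<le> of_nat (Max (a ` {..n})) / degD"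
    using degD_gt_0 by (intro divide_right_mono) auto
  then have "of_nat (fst (box_part t)) \<le> rel_bound" using fst_box_part_less[OF t] unfolding rel_bound_def by linarith
  then have "mon_lift (sadd (box_part t) (unit_exp i)) - ?R \<in> low_ideal" using lifts_cong[OF _ R] mon_lift_lifts[OF bi] fst by simp
  then have "ray_lift (ray_mult t) * (mon_lift (sadd (box_part t) (unit_exp i)) - ?R) \<in> low_ideal" by (rule low_ideal_mult) (rule ray_lift_polys_in)
  moreover have "(\<Sum>\<mu>\<in>Poly_Mapping.keys W. mconst (Poly_Mapping.lookup W \<mu>) * mon_lift (sadd t (lin_shift \<mu>))) = ray_lift (ray_mult t) * ?R"
    unfolding sum_distrib_left by (intro sum.cong) (simp_all add: shift[OF bm] mult_ac)
  ultimately show ?thesis by (simp add: right_diff_distrib shift[OF bi])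
qed

text \<open>Polynomials congruent modulo \<open>low_ideal\<close> to combinations of lifts of
  reduced monomials. Showing that this is everything reduces the kernel to the independence of
  reduced monomials.\<close>

inductive_set red_span :: "((nat \<Rightarrow>\<^sub>0 nat) \<Rightarrow>\<^sub>0 'k) set" where
  ideal: "P \<in> low_ideal \<Longrightarrow> P \<in> red_span"
| step: "P \<in> red_span \<Longrightarrow> red_exp d \<mu> \<in> expo 0 \<Longrightarrow> P + mconst c * mon_lift (red_exp d \<mu>) \<in> red_span"

lemma red_span_add: assumes "P \<in> red_span" "Q \<in> red_span" shows "P + Q \<in> red_span"
  using assms(2)
proof induction
  case (ideal Q)
  show ?case using assms(1)
  proof induction
    case (ideal P)
    then show ?case using \<open>Q \<in> low_ideal\<close> by (intro red_span.ideal low_ideal_add)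
  next
    case (step P d \<mu> c)
    then show ?case using red_span.step[of "P + Q" d \<mu> c] by (simp add: add_ac)
  qed
next
  case (step Q d \<mu> c)
  then show ?case using red_span.step[of "P + Q" d \<mu> c] by (simp add: add_ac)
qed

lemma red_span_zero: "0 \<in> red_span"
  by (rule red_span.ideal) (rule low_ideal_zero)

lemma red_span_scale: "P \<in> red_span \<Longrightarrow> mconst c * P \<in> red_span"
proof (induction rule: red_span.induct)
  case (ideal P)
  then show ?case by (intro red_span.ideal low_ideal_mult polys_in_mconst)
next
  case (step P d \<mu> c')
  then show ?case using red_span.step[of "mconst c * P" d \<mu> "c * c'"]
    by (simp add: distrib_left mult.assoc[symmetric] mconst_def mult_single)
qed

lemma red_span_sum: "(\<And>x. x \<in> A \<Longrightarrow> h x \<in> red_span) \<Longrightarrow> sum h A \<in> red_span"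
  by (induction A rule: infinite_finite_induct) (auto intro: red_span_add red_span_zero)

lemma red_span_cong: "Q \<in> red_span \<Longrightarrow> P - Q \<in> low_ideal \<Longrightarrow> P \<in> red_span"
  using red_span_add[OF _ red_span.ideal, of Q "P - Q"] by simp

lemma red_span_red_exp: "red_exp d \<mu> \<in> expo 0 \<Longrightarrow> mon_lift (red_exp d \<mu>) \<in> red_span"
  using red_span.step[OF red_span_zero, of d \<mu> 1] by (simp add: mconst_def)

text \<open>The induction measure is the total multiplicity, above the least one allowed, of the
  forms that are not coordinates. Eliminating one such \<open>f i\<close> lowers it by one, since
  the replacement terms raise only coordinate exponents.\<close>

lemma red_span_mon_lift: "s \<in> expo 0 \<Longrightarrow> mon_lift s \<in> red_span"
proof (induction "\<Sum>i\<in>{..n} - range \<sigma>. nat (snd s i + floor_coeff (fst s) i)" arbitrary: s rule: less_induct)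
  case less
  let ?b = "\<lambda>i. snd s i + floor_coeff (fst s) i"
  have nn: "?b i \<ge> 0" if "i \<le> n" for i
    using less.prems that neg_le_floor_coeff_iff[of "snd s i" "fst s" i] by (auto simp: expo_def slack_def)
  show ?case
  proof (cases "\<exists>i\<le>n. i \<notin> range \<sigma> \<and> ?b i \<noteq> 0")
    case False
    \<comment> \<open>With no excess left, the multiplicities of the coordinate forms are the
      exponents of the monomial being sought.\<close>
    define \<mu> where "\<mu> = Abs_poly_mapping (\<lambda>x. nat (?b (\<sigma> x)))"
    have \<mu>: "Poly_Mapping.lookup \<mu> x = nat (?b (\<sigma> x))" for x by (simp add: \<mu>_def)
    have "lin_exp \<mu> i - floor_coeff (fst s) i = snd s i" if "i \<le> n" for i
    proof (cases "i \<in> range \<sigma>")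
      case True
      then obtain x where "i = \<sigma> x" by blast
      then show ?thesis using nn[OF that] by (simp add: lin_exp_\<sigma> \<mu>)
    next
      case F: False
      then have "?b i = 0" using False that by blast
      then show ?thesis using F by (simp add: lin_exp_def)
    qed
    moreover have "snd s i = 0" if "i > n" for i using less.prems that by (simp add: expo_def)
    ultimately have "s = red_exp (fst s) \<mu>" by (auto simp: red_exp_def prod_eq_iff)
    then show ?thesis using red_span_red_exp[of "fst s" \<mu>] less.prems by simp
  next
    case True
    then obtain i where i: "i \<le> n" "i \<notin> range \<sigma>" "?b i \<noteq> 0" by blast
    then have bi: "?b i \<ge> 1" using nn[of i] by simp
    \<comment> \<open>One copy of \<open>f i\<close> is split off; \<open>?b i \<ge> 1\<close> keeps
      the remaining slack at \<open>i\<close> nonnegative.\<close>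
    define t where "t = (fst s, \<lambda>j. snd s j - (if j = i then 1 else 0))"
    have st: "s = sadd t (unit_exp i)" by (simp add: t_def sadd_def unit_exp_def prod_eq_iff)
    have "(\<Sum>j\<le>n. int (a j) * snd t j) = (\<Sum>j\<le>n. int (a j) * snd s j) - (\<Sum>j\<le>n. int (a j) * (if j = i then 1 else 0))"
      by (simp add: t_def right_diff_distrib sum_subtractf)
    also have "\<dots> = - int (a i)" using less.prems unfolding sum_unit[OF i(1)] by (simp add: expo_def)
    finally have "(\<Sum>j\<le>n. int (a j) * snd t j) = - int (a i)" .
    moreover have "slack t j \<ge> 0" if j: "j \<le> n" for j
    proof -
      have "- snd t j \<le> floor_coeff (fst s) j" using nn[OF j] bi by (auto simp: t_def)
      then show ?thesis unfolding neg_le_floor_coeff_iff by (simp add: slack_def t_def)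
    qed
    moreover have "snd t j = 0" if "j > n" for j using less.prems i(1) that by (simp add: expo_def t_def)
    ultimately have t: "t \<in> expo (a i)" by (simp add: expo_def)
    obtain W where W: "homog_of (a i) W" "ev mconst (\<lambda>x. f (\<sigma> x)) W = f i"
      using \<sigma>_expand[OF f_homog[OF i(1)]] by blast
    have "mon_lift (sadd t (lin_shift \<mu>)) \<in> red_span" if \<mu>: "\<mu> \<in> Poly_Mapping.keys W" for \<mu>
    proof (rule less.hyps)
      show "sadd t (lin_shift \<mu>) \<in> expo 0" using sadd_lin_shift_expo[of t \<mu>] t W(1) \<mu> by (simp add: homog_of_def)
      \<comment> \<open>Outside the coordinates the only change is the loss of one at
        \<open>i\<close>, while the degree, and with it every \<open>floor_coeff\<close>, stays the
        same.\<close>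
      have "snd (sadd t (lin_shift \<mu>)) j = snd s j - (if j = i then 1 else 0)" if "j \<notin> range \<sigma>" for j
        using that by (simp add: sadd_def lin_shift_def t_def lin_exp_def)
      moreover have "fst (sadd t (lin_shift \<mu>)) = fst s" by (simp add: sadd_def lin_shift_def t_def)
      ultimately show "(\<Sum>j\<in>{..n} - range \<sigma>. nat (snd (sadd t (lin_shift \<mu>)) j + floor_coeff (fst (sadd t (lin_shift \<mu>))) j))
          < (\<Sum>j\<in>{..n} - range \<sigma>. nat (?b j))"
        using i bi by (intro sum_strict_mono_ex1) (auto intro!: bexI[of _ i])
    qed
    then have "(\<Sum>\<mu>\<in>Poly_Mapping.keys W. mconst (Poly_Mapping.lookup W \<mu>) * mon_lift (sadd t (lin_shift \<mu>))) \<in> red_span"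
      by (intro red_span_sum red_span_scale)
    then show ?thesis using mon_lift_eliminate[OF i(1) t W] unfolding st by (rule red_span_cong)
  qed
qed

lemma red_span_polys_in: "P \<in> red_span \<Longrightarrow> P \<in> polys_in {..<r}"
  by (induction rule: red_span.induct)
    (auto intro!: polys_in_add polys_in_mult polys_in_mconst mon_lift_polys_in dest: low_ideal_subset_kernel)

text \<open>A product of two lifts is congruent to the lift of the sum of exponents. That sum need
  not be reduced, so the elimination is applied once more.\<close>

lemma red_span_mon_lift_mult:
  assumes s: "s \<in> expo 0" and "Q \<in> red_span" shows "mon_lift s * Q \<in> red_span"
  using assms(2)
proof induction
  case (ideal Q)
  then show ?case by (intro red_span.ideal low_ideal_mult mon_lift_polys_in s)
next
  case (step Q d \<mu> c)
  have "mon_lift s * mon_lift (red_exp d \<mu>) \<in> red_span"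
    using red_span_cong[OF red_span_mon_lift mon_lift_mult[OF s step(2)]] expo_sadd[OF s step(2)] by simp
  then have "mon_lift s * Q + mconst c * (mon_lift s * mon_lift (red_exp d \<mu>)) \<in> red_span" using step by (intro red_span_add red_span_scale)
  then show ?case by (simp add: distrib_left mult_ac)
qed

lemma red_span_mult: assumes "P \<in> red_span" "Q \<in> red_span" shows "P * Q \<in> red_span"
  using assms(1)
proof induction
  case (ideal P)
  then have "Q * P \<in> low_ideal" using red_span_polys_in[OF assms(2)] by (intro low_ideal_mult)
  then show ?case by (simp add: red_span.ideal mult.commute)
next
  case (step P d \<mu> c)
  then have "P * Q + mconst c * (mon_lift (red_exp d \<mu>) * Q) \<in> red_span" using assms(2) by (intro red_span_add red_span_scale red_span_mon_lift_mult)
  then show ?case by (simp only: distrib_right mult.assoc)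
qed

text \<open>The lift chosen for the zero exponent need not be the polynomial 1; the two differ by a
  relation of degree 0.\<close>

lemma red_span_one: "1 \<in> red_span"
proof -
  have z: "(0, \<lambda>_. 0) \<in> expo 0" by (simp add: expo_def slack_def)
  have "lifts (mon_lift (0, \<lambda>_. 0)) 0 1" using mon_lift_lifts[OF z] by (simp add: mon_u_def mon_zero monom_0 one_pCons)
  moreover have "of_nat 0 \<le> rel_bound" using ray_sum_pos by (intro two_ray_sum_le_rel_bound) simp
  ultimately have "1 - mon_lift (0, \<lambda>_. 0) \<in> low_ideal" using lifts_cong[OF lifts_one] by blast
  then show ?thesis by (rule red_span_cong[OF red_span_mon_lift[OF z]])
qed

text \<open>A generator is any homogeneous element, in general a sum of reduced monomials. Its
  degree is at most \<open>ray_sum\<close>, so its variable and the lifted sum differ by an allowed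
  relation.\<close>

lemma red_span_pvar: assumes i: "i < r" shows "pvar i \<in> red_span"
proof -
  let ?d = "degree (g i)"
  have "g i \<in> sec_ring" using alg_gen.gen[of "g i" "g ` {..<r}"] g_gen i by auto
  then have "coeff (g i) ?d \<in> H0 (floor_div ?d)" by (simp add: sec_ring_iff)
  then obtain W where W: "coeff (g i) ?d = (\<Sum>\<mu>\<in>Poly_Mapping.keys W. const_frac (Poly_Mapping.lookup W \<mu>) * mon (snd (red_exp ?d \<mu>)))"
    "\<And>\<mu>. \<mu> \<in> Poly_Mapping.keys W \<Longrightarrow> red_exp ?d \<mu> \<in> expo 0" using H0_red_comb by blast
  have "g i = monom (coeff (g i) ?d) ?d" using g_homog[OF i] by (simp add: homog_el_def)
  also have "\<dots> = (\<Sum>\<mu>\<in>Poly_Mapping.keys W. kconst (Poly_Mapping.lookup W \<mu>) * mon_u (red_exp ?d \<mu>))"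
    unfolding W(1) by (simp add: kconst_const_frac mon_u_def monom_sum smult_monom red_exp_def)
  finally have gi: "g i = (\<Sum>\<mu>\<in>Poly_Mapping.keys W. kconst (Poly_Mapping.lookup W \<mu>) * mon_u (red_exp ?d \<mu>))" .
  let ?R = "\<Sum>\<mu>\<in>Poly_Mapping.keys W. mconst (Poly_Mapping.lookup W \<mu>) * mon_lift (red_exp ?d \<mu>)"
  have fst: "fst (red_exp ?d \<mu>) = ?d" for \<mu> by (simp add: red_exp_def)
  have "lifts ?R ?d (\<Sum>\<mu>\<in>Poly_Mapping.keys W. kconst (Poly_Mapping.lookup W \<mu>) * mon_u (red_exp ?d \<mu>))"
    using mon_lift_lifts[OF W(2)] unfolding fst by (intro lifts_sum lifts_scale)
  then have "lifts ?R ?d (g i)" by (simp only: gi[symmetric])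
  moreover have "of_nat ?d \<le> rel_bound" using g_deg[OF i] ray_sum_pos by (intro two_ray_sum_le_rel_bound) linarith
  ultimately have "pvar i - ?R \<in> low_ideal" using lifts_cong[OF lifts_pvar[OF i]] by blast
  moreover have "?R \<in> red_span" by (intro red_span_sum red_span_scale red_span_red_exp W(2))
  ultimately show ?thesis by (rule_tac red_span_cong)
qed

lemma red_span_all: assumes P: "P \<in> polys_in {..<r}" shows "P \<in> red_span"
proof -
  have pow: "pvar i ^ k \<in> red_span" if "i < r" for i k
    by (induction k) (auto intro: red_span_one red_span_mult red_span_pvar that)
  have prod: "(\<And>x. x \<in> A \<Longrightarrow> h x \<in> red_span) \<Longrightarrow> prod h A \<in> red_span" for h and A :: "nat set"
    by (induction A rule: infinite_finite_induct) (auto intro: red_span_one red_span_mult)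
  have "mexp pvar \<mu> \<in> red_span" if "\<mu> \<in> Poly_Mapping.keys P" for \<mu>
    unfolding mexp_def using P that by (intro prod pow) (auto simp: polys_in_def)
  then have "ev mconst pvar P \<in> red_span" unfolding ev_def by (intro red_span_sum red_span_scale)
  then show ?thesis by (simp add: ev_mconst_pvar)
qed

text \<open>Membership in \<open>red_span\<close> may add the same exponent repeatedly. A finitely
  supported coefficient map merges the repetitions, as linear independence requires.\<close>

definition red_comb :: "(nat \<times> ('n \<Rightarrow>\<^sub>0 nat) \<Rightarrow>\<^sub>0 'k) \<Rightarrow> (nat \<Rightarrow>\<^sub>0 nat) \<Rightarrow>\<^sub>0 'k" where
  "red_comb C = (\<Sum>p\<in>Poly_Mapping.keys C. mconst (Poly_Mapping.lookup C p) * mon_lift (red_exp (fst p) (snd p)))"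

lemma red_span_red_comb:
  assumes "P \<in> red_span"
  shows "\<exists>C. (\<forall>p\<in>Poly_Mapping.keys C. red_exp (fst p) (snd p) \<in> expo 0) \<and> P - red_comb C \<in> low_ideal"
  using assms
proof induction
  case (ideal P)
  then show ?case by (intro exI[of _ 0]) (simp add: red_comb_def)
next
  case (step P d \<mu> c)
  then obtain C where C: "\<forall>p\<in>Poly_Mapping.keys C. red_exp (fst p) (snd p) \<in> expo 0" "P - red_comb C \<in> low_ideal" by blast
  let ?C = "C + Poly_Mapping.single (d, \<mu>) c"
  have "red_comb ?C = red_comb C + red_comb (Poly_Mapping.single (d, \<mu>) c)"
    unfolding red_comb_def
    by (rule setsum_keys_plus_distrib) (simp_all add: mconst_def single_add distrib_right)
  also have "red_comb (Poly_Mapping.single (d, \<mu>) c) = mconst c * mon_lift (red_exp d \<mu>)"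
    by (cases "c = 0") (simp_all add: red_comb_def mconst_def)
  finally have "P + mconst c * mon_lift (red_exp d \<mu>) - red_comb ?C \<in> low_ideal" using C(2) by simp
  moreover have "\<forall>p\<in>Poly_Mapping.keys ?C. red_exp (fst p) (snd p) \<in> expo 0"
    using Poly_Mapping.keys_add[of C "Poly_Mapping.single (d, \<mu>) c"] C(1) step(2) by (auto split: if_splits)
  ultimately show ?case by blast
qed

text \<open>Modulo \<open>low_ideal\<close> a kernel element is a combination of lifted reduced
  monomials. Evaluating it gives a vanishing combination of independent elements, so all
  coefficients are zero.\<close>

lemma kernel_subset_low_ideal: assumes P: "P \<in> polys_in {..<r}" "eval_w g P = 0" shows "P \<in> low_ideal"
proof -
  obtain C where C: "\<And>p. p \<in> Poly_Mapping.keys C \<Longrightarrow> red_exp (fst p) (snd p) \<in> expo 0" "P - red_comb C \<in> low_ideal"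
    using red_span_red_comb[OF red_span_all[OF P(1)]] by blast
  have "eval_w g (red_comb C) = 0" using low_ideal_subset_kernel[OF C(2)] P(2) by (simp add: evw_diff)
  then have "(\<Sum>p\<in>Poly_Mapping.keys C. kconst (Poly_Mapping.lookup C p) * eval_w g (mon_lift (red_exp (fst p) (snd p)))) = 0"
    by (simp add: red_comb_def evw_sum evw_mult evw_mconst)
  moreover have "eval_w g (mon_lift (red_exp (fst p) (snd p))) = mon_u (red_exp (fst p) (snd p))" if "p \<in> Poly_Mapping.keys C" for p
    using mon_lift_lifts[OF C(1)[OF that]] by (simp add: lifts_def)
  ultimately have "(\<Sum>p\<in>Poly_Mapping.keys C. kconst (Poly_Mapping.lookup C p) * mon_u (red_exp (fst p) (snd p))) = 0"
    by simp
  then have "C = 0" by (rule red_exp_indep)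
  then show ?thesis using C(2) by (simp add: red_comb_def)
qed

lemma relations_generated: "relations_generated_le r g rel_bound"
  unfolding relations_generated_le_def
proof (intro exI[of _ low_rels] conjI)
  show "low_rels \<subseteq> rel_kernel r g" by (auto simp: low_rels_def)
  show "\<forall>P\<in>low_rels. \<exists>t. whomog (\<lambda>i. degree (g i)) t P \<and> of_nat t \<le> rel_bound"
    unfolding low_rels_def gen_deg_def[abs_def] by blast
  show "ideal_gen r low_rels = rel_kernel r g"
    using low_ideal_subset_kernel kernel_subset_low_ideal unfolding low_ideal_def by (auto simp: rel_kernel_def in_vars_iff)
qed

end

theorem theorem1p2:
  fixes f :: "nat \<Rightarrow> ('n::{finite,linorder} \<Rightarrow>\<^sub>0 nat) \<Rightarrow>\<^sub>0 'k::alg_closed_field"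
    and \<alpha> :: "nat \<Rightarrow> rat" and a :: "nat \<Rightarrow> nat" and n :: nat
  assumes m_ge_1: "card (UNIV :: 'n set) \<ge> 2"
    and prime: "\<forall>i\<le>n. irreducible (f i) \<and> homog_of (a i) (f i)"
    and distinct: "\<forall>i\<le>n. \<forall>j\<le>n. i \<noteq> j \<longrightarrow> \<not> (f i dvd f j \<and> f j dvd f i)"
    and degD: "(\<Sum>i\<le>n. \<alpha> i * of_nat (a i)) > 0"
    and lin: "\<exists>J\<subseteq>{..n}. card J = card (UNIV :: 'n set) \<and> (\<forall>j\<in>J. a j = 1) \<and> lin_indep_on J f"
  shows "generated_in_degrees_le (section_ring n f \<alpha>)
           (nat (\<Sum>i\<le>n. ell n \<alpha> i * int (a i)))
       \<and> (\<forall>r g. min_hom_gens (section_ring n f \<alpha>) r g \<longrightarrow>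
            relations_generated_le r g
              (max (2 * of_int (\<Sum>i\<le>n. ell n \<alpha> i * int (a i)))
                   (of_nat (Max (a ` {..n})) / (\<Sum>i\<le>n. \<alpha> i * of_nat (a i))
                    + of_int (\<Sum>i\<le>n. ell n \<alpha> i * int (a i)))))"
proof -
  obtain J where J: "J \<subseteq> {..n}" "card J = card (UNIV :: 'n set)" "\<forall>j\<in>J. a j = 1" "lin_indep_on J f"
    using lin by blast
  have "finite J" using J(1) finite_subset by blast
  \<comment> \<open>Equal cardinalities allow the set \<open>J\<close> of linear forms to be indexed
    by the variables.\<close>
  then obtain \<sigma> where \<sigma>: "bij_betw \<sigma> (UNIV :: 'n set) J"
    using finite_same_card_bij[of "UNIV :: 'n set" J] J(2) by auto
  then have inj: "inj \<sigma>" and range: "range \<sigma> = J" by (auto simp: bij_betw_def)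
  have indep: "c = (\<lambda>_. 0)" if c: "(\<Sum>x\<in>UNIV. mconst (c x) * f (\<sigma> x)) = 0" for c
  proof -
    \<comment> \<open>The coefficients are moved back along \<open>\<sigma>\<close>, because
      \<open>lin_indep_on\<close> is stated over \<open>J\<close>.\<close>
    have "(\<Sum>j\<in>J. mconst (c (inv \<sigma> j)) * f j) = 0"
      using c inj by (simp add: range[symmetric] sum.reindex)
    then have "\<forall>j\<in>J. c (inv \<sigma> j) = 0"
      using J(4)[unfolded lin_indep_on_def, rule_format, of "\<lambda>j. c (inv \<sigma> j)"] by blast
    then show ?thesis using inj range by (metis inv_f_f rangeI)
  qed
  interpret qdivisor f \<alpha> a n \<sigma>
    using assms(2-4) J(1,3) inj range indep by unfold_locales blast+
  have "generated_in_degrees_le (section_ring n f \<alpha>) (nat ray_sum)"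
    unfolding generated_in_degrees_le_def using generated unfolding sec_ring_def .
  moreover have "relations_generated_le r g
      (max (2 * of_int ray_sum) (of_nat (Max (a ` {..n})) / degD + of_int ray_sum))"
    if g: "min_hom_gens (section_ring n f \<alpha>) r g" for r g
  proof -
    interpret presentation f \<alpha> a n \<sigma> r g
      using g min_gens_degree[of r g] by unfold_locales (auto simp: min_hom_gens_def sec_ring_def)
    show ?thesis using relations_generated unfolding rel_bound_def .
  qed
  ultimately show ?thesis unfolding ray_sum_def degD_def by blast
qed

end
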